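(* Let $(E,[\cdot,\cdot]_E,\rho_E)$ be a holomorphic Lie algebroid of rank $m$ over an $n$-dimensional complex manifold $M$, endowed with a complex Finsler function $F$, and let $f\in C^\infty(E)$. Let $\Delta^h f=\operatorname{div}^h(\operatorname{grad}^h f)$ and $\Delta^v f=\operatorname{div}^v(\operatorname{grad}^v f)$ be the horizontal and vertical Laplace operators on the prolongation $\mathcal{T}E$ associated with $F$ (as defined in the context). Then, in local coordinates $(z^k,u^\alpha)$ on $E$ (summation over repeated indices), $$\Delta^h f=\frac{1}{h}\,\delta_\alpha\big[h\,h^{\bar\gamma\alpha}(\delta_{\bar\gamma}f)\big]-\big[h^{\bar\gamma\alpha}(\delta_{\bar\gamma}f)\big]\mathcal{C}_\alpha$$ and $$\Delta^v f=\frac{1}{h}\,\dot\partial_\alpha\big[h\,h^{\bar\gamma\alpha}(\dot\partial_{\bar\gamma}f)\big]+\big[h^{\bar\gamma\alpha}(\dot\partial_{\bar\gamma}f)\big]C_\alpha ,$$ where $h=\det(h_{\alpha\bar\beta})$, $\mathcal{C}_\alpha=\mathcal{C}^{\beta}_{\alpha\beta}$ and $C_\alpha=C^{\beta}_{\alpha\beta}=C^{\beta}_{\beta\alpha}$.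
   Context: Holomorphic Lie algebroid: $\pi:E\to M$ is a holomorphic vector bundle of rank $m$ with a holomorphic bundle morphism (anchor) $\rho_E:E\to T'M$ ($T'M$ = holomorphic tangent bundle) and a Lie bracket $[\cdot,\cdot]_E$ on holomorphic sections such that $[s_1,fs_2]_E=f[s_1,s_2]_E+\rho_E(s_1)(f)s_2$ for holomorphic $f$. In local coordinates $(z^k)$ on $M$ and a local holomorphic frame $(e_\alpha)$ of $E$, $\rho_E(e_\alpha)=\rho^k_\alpha\,\partial/\partial z^k$ and $[e_\alpha,e_\beta]_E=\mathcal{C}^{\gamma}_{\alpha\beta}e_\gamma$, with $\rho^k_\alpha,\mathcal{C}^\gamma_{\alpha\beta}$ holomorphic functions of $z$. Local coordinates on $E$ are $(z^k,u^\alpha)$, $u=u^\alpha e_\alpha$. Notation: $\partial_k=\partial/\partial z^k$, $\dot\partial_\alpha=\partial/\partial u^\alpha$, $\partial_\alpha=\rho^k_\alpha\partial_k$; barred indices denote complex conjugates. Prolongation: $\mathcal{T}'E=\{(e,v)\in E\times T'E:\rho_E(e)=\pi_*(v)\}$, viewed as a bundle over $E$ of rank $2m$ via $(e,v)\mapsto$ base point of $v$, with anchor $\rho_{\mathcal T}(e,v)=v$. It has local frame $\mathcal{Z}_\alpha(u)=(e_\alpha(\pi(u)),\rho^k_\alpha\partial_k|_u)$, $\mathcal{V}_\alpha(u)=(0,\dot\partial_\alpha|_u)$. Its complexification $\mathcal{T}E$ has frame $\{\mathcal{Z}_\alpha,\mathcal{V}_\alpha,\mathcal{Z}_{\bar\alpha},\mathcal{V}_{\bar\alpha}\}$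 (the last two are conjugates), and is a complex Lie algebroid with anchor $\rho_{\mathcal T}(\mathcal{Z}_\alpha)=\partial_\alpha$, $\rho_{\mathcal T}(\mathcal{V}_\alpha)=\dot\partial_\alpha$ (and conjugates) and bracket determined by the Leibniz rule for smooth complex functions and by $[\mathcal{Z}_\alpha,\mathcal{Z}_\beta]=\mathcal{C}^\gamma_{\alpha\beta}\mathcal{Z}_\gamma$ (and its conjugate), all other brackets of frame elements being $0$. A section $Z$ acts on functions by $Zf=\rho_{\mathcal T}(Z)f$. Finsler function: $F:E\to\mathbb{R}_+$, smooth outside the zero section, homogeneous in the fibre variable ($F(z,\lambda u)=|\lambda|^2F(z,u)$, $\lambda\in\mathbb{C}$), with the Hermitian matrix $h_{\alpha\bar\beta}=\dot\partial_\alpha\dot\partial_{\bar\beta}F$ positive definite. Identities involving $F$ are understood outside the zero section of $E$. $(h^{\bar\beta\alpha})$ is the inverse matrix, i.e. $h^{\bar\sigma\gamma}h_{\alpha\bar\sigma}=\delta^\gamma_\alpha$ (Kronecker), and $h=\det(h_{\alpha\bar\beta})$. Chern-Finsler objects: $N^\beta_\alpha=h^{\bar\sigma\beta}\partial_\alpha\dot\partial_{\bar\sigma}F$; $\mathcal{X}_\alpha=\mathcal{Z}_\alpha-N^\beta_\alpha\mathcal{V}_\beta$; $\delta_\alpha=\rho_{\mathcal T}(\mathcal{X}_\alpha)=\rho^k_\alpha\partial_k-N^\beta_\alpha\dot\partial_\beta$. The adapted frame is $\{\mathcal{X}_\alpha,\mathcal{V}_\alpha,\mathcal{X}_{\bar\alpha},\mathcal{V}_{\bar\alpha}\}$,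 with dual frame $\{\mathcal{Z}^\alpha,\delta\mathcal{V}^\alpha=\mathcal{V}^\alpha+N^\alpha_\beta\mathcal{Z}^\beta,\mathcal{Z}^{\bar\alpha},\delta\mathcal{V}^{\bar\alpha}\}$, where $\{\mathcal{Z}^\alpha,\mathcal{V}^\alpha\}$ is dual to $\{\mathcal{Z}_\alpha,\mathcal{V}_\alpha\}$. Vertical connection coefficients: $C^\gamma_{\alpha\beta}=h^{\bar\sigma\gamma}\dot\partial_\beta(h_{\alpha\bar\sigma})$, which satisfy $C^\gamma_{\alpha\beta}=C^\gamma_{\beta\alpha}$. Volume form on $\mathcal{T}E$: with the Hermitian form $\Phi=i\,h_{\alpha\bar\beta}(\mathcal{Z}^\alpha\wedge\mathcal{Z}^{\bar\beta}+\delta\mathcal{V}^\alpha\wedge\delta\mathcal{V}^{\bar\beta})$, put $d\mathcal{V}=\frac{1}{(2m)!}\Phi^{2m}$, which is a constant multiple of $h^2\,\mathcal{Z}^1\wedge\dots\wedge\mathcal{Z}^m\wedge\mathcal{Z}^{\bar1}\wedge\dots\wedge\mathcal{Z}^{\bar m}\wedge\delta\mathcal{V}^1\wedge\dots\wedge\delta\mathcal{V}^m\wedge\delta\mathcal{V}^{\bar1}\wedge\dots\wedge\delta\mathcal{V}^{\bar m}$. Divergence: for a smooth section $Z$ of $\mathcal{T}E$, $\operatorname{div}Z$ is defined by $\mathcal{L}_Z d\mathcal{V}=(\operatorname{div}Z)\,d\mathcal{V}$, where for a top-degree form $\omega$ on $\mathcal{T}E$ the Lie derivative is $(\mathcal{L}_Z\omega)(Y_1,\dots,Y_{4m})=Z(\omega(Y_1,\dots,Y_{4m}))-\sum_i\omega(Y_1,\dots,[Z,Y_i],\dots,Y_{4m})$.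 For $Z=Z^\alpha\mathcal{X}_\alpha+V^\alpha\mathcal{V}_\alpha$, $\operatorname{div}^hZ=\operatorname{div}(Z^\alpha\mathcal{X}_\alpha)$ and $\operatorname{div}^vZ=\operatorname{div}(V^\alpha\mathcal{V}_\alpha)$. Gradient: $\operatorname{grad}^hf=h^{\bar\gamma\alpha}(\delta_{\bar\gamma}f)\mathcal{X}_\alpha$ and $\operatorname{grad}^vf=h^{\bar\gamma\alpha}(\dot\partial_{\bar\gamma}f)\mathcal{V}_\alpha$. *)

theory Defs
  imports "HOL-Analysis.Analysis"
begin

section \<open>Smooth and holomorphic functions on open subsets of complex coordinate space\<close>

text \<open>Used on open sets of finite-dimensional spaces only.\<close>

fun Ck_on :: "nat \<Rightarrow> ('a::real_normed_vector \<Rightarrow> 'b::real_normed_vector) \<Rightarrow> 'a set \<Rightarrow> bool" where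
  "Ck_on 0 f S \<longleftrightarrow> continuous_on S f"
| "Ck_on (Suc k) f S \<longleftrightarrow>
     (\<forall>x\<in>S. f differentiable (at x)) \<and> (\<forall>v. Ck_on k (\<lambda>x. frechet_derivative f (at x) v) S)"

definition smooth_on :: "'a::real_normed_vector set \<Rightarrow> ('a \<Rightarrow> 'b::real_normed_vector) \<Rightarrow> bool" where
  "smooth_on S f \<longleftrightarrow> (\<forall>k. Ck_on k f S)"

definition hol_fun_on :: "(complex^'i) set \<Rightarrow> (complex^'i \<Rightarrow> complex) \<Rightarrow> bool" where
  "hol_fun_on S f \<longleftrightarrow>
     (\<forall>x\<in>S. \<exists>D. (f has_derivative D) (at x) \<and> (\<forall>a v. D (a *s v) = a * D v))"

definition hol_map_on :: "(complex^'i) set \<Rightarrow> (complex^'i \<Rightarrow> complex^'j) \<Rightarrow> bool" where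
  "hol_map_on S f \<longleftrightarrow> (\<forall>j. hol_fun_on S (\<lambda>x. f x $ j))"

text \<open>The Wirtinger derivatives
  \<open>\<partial>/\<partial>z\<^sup>i = (\<partial>/\<partial>x\<^sup>i - \<i> \<partial>/\<partial>y\<^sup>i)/2\<close> and \<open>\<partial>/\<partial>z\<^sup>i\<close>-bar \<open>= (\<partial>/\<partial>x\<^sup>i + \<i> \<partial>/\<partial>y\<^sup>i)/2\<close>.\<close>

definition wirt :: "'i \<Rightarrow> (complex^'i \<Rightarrow> complex) \<Rightarrow> complex^'i \<Rightarrow> complex" where
  "wirt i g x = (frechet_derivative g (at x) (axis i 1)
                  - \<i> * frechet_derivative g (at x) (axis i \<i>)) / 2"

definition wirt_bar :: "'i \<Rightarrow> (complex^'i \<Rightarrow> complex) \<Rightarrow> complex^'i \<Rightarrow> complex" where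
  "wirt_bar i g x = (frechet_derivative g (at x) (axis i 1)
                  + \<i> * frechet_derivative g (at x) (axis i \<i>)) / 2"


section \<open>Complex manifolds and holomorphic tangent vectors\<close>

type_synonym ('x, 'i) chart = "'x set \<times> ('x \<Rightarrow> complex^('i::finite))"

abbreviation chart_inv :: "('x, 'i) chart \<Rightarrow> complex^'i \<Rightarrow> 'x" where
  "chart_inv c \<equiv> inv_into (fst c) (snd c)"

definition transition :: "('x, 'i) chart \<Rightarrow> ('x, 'i) chart \<Rightarrow> complex^'i \<Rightarrow> complex^'i" where
  "transition c c' = snd c' \<circ> chart_inv c"

definition complex_atlas :: "('x::topological_space, 'i::finite) chart set \<Rightarrow> bool" where
  "complex_atlas A \<longleftrightarrow>
     (\<Union>c\<in>A. fst c) = UNIV \<and>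
     (\<forall>c\<in>A. open (fst c) \<and> open (snd c ` fst c) \<and>
        homeomorphism (fst c) (snd c ` fst c) (snd c) (chart_inv c)) \<and>
     (\<forall>c\<in>A. \<forall>c'\<in>A. hol_map_on (snd c ` (fst c \<inter> fst c')) (transition c c'))"

text \<open>A holomorphic tangent vector at \<open>p\<close> is the family of its component vectors in the
  charts around \<open>p\<close>, related by the Jacobians of the transition maps (and \<open>0\<close> by convention
  on all other charts).\<close>

type_synonym ('x, 'i) tvector = "('x, 'i) chart \<Rightarrow> complex^'i"

definition hol_tangent :: "('x, 'i::finite) chart set \<Rightarrow> 'x \<Rightarrow> ('x, 'i) tvector set" where
  "hol_tangent A p = {v.
     (\<forall>c. \<not> (c \<in> A \<and> p \<in> fst c) \<longrightarrow> v c = 0) \<and>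
     (\<forall>c\<in>A. \<forall>c'\<in>A. p \<in> fst c \<inter> fst c' \<longrightarrow>
        v c' = frechet_derivative (transition c c') (at (snd c p)) (v c))}"

text \<open>The tangent vector at \<open>p\<close> with components \<open>w\<close> in the chart \<open>c\<close>.\<close>

definition tangent_of ::
    "('x, 'i::finite) chart set \<Rightarrow> ('x, 'i) chart \<Rightarrow> 'x \<Rightarrow> complex^'i \<Rightarrow> ('x, 'i) tvector" where
  "tangent_of A c p w = (\<lambda>c'. if c' \<in> A \<and> p \<in> fst c'
      then frechet_derivative (transition c c') (at (snd c p)) w else 0)"

text \<open>The derivative \<open>v(f)\<close> at \<open>p\<close> of a holomorphic function \<open>f\<close>; it does not depend on the chart.\<close>

definition tangent_apply ::
    "('x, 'i::finite) chart set \<Rightarrow> 'x \<Rightarrow> ('x, 'i) tvector \<Rightarrow> ('x \<Rightarrow> complex) \<Rightarrow> complex" where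
  "tangent_apply A p v f = (THE d. \<forall>c\<in>A. p \<in> fst c \<longrightarrow>
      d = (\<Sum>k\<in>UNIV. v c $ k * wirt k (f \<circ> chart_inv c) (snd c p)))"


section \<open>Holomorphic vector bundles\<close>

text \<open>A bundle chart \<open>(U, \<phi>, \<tau>)\<close> consists of a coordinate chart \<open>(U, \<phi>)\<close> of \<open>M\<close> and the fibre
  component \<open>\<tau>\<close> of a local trivialisation of \<open>E\<close> over \<open>U\<close>.  It gives the local coordinates
  \<open>(z\<^sup>k, u\<^sup>\<alpha>)\<close> on \<open>E\<close>, valued in \<open>complex^('n + 'm)\<close>: the index \<open>Inl k\<close> is that of \<open>z\<^sup>k\<close> and
  \<open>Inr \<alpha>\<close> that of \<open>u\<^sup>\<alpha>\<close>.\<close>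

type_synonym ('p, 'e, 'n, 'm) bchart = "'p set \<times> ('p \<Rightarrow> complex^'n) \<times> ('e \<Rightarrow> complex^'m)"

definition join :: "complex^('n::finite) \<Rightarrow> complex^('m::finite) \<Rightarrow> complex^('n + 'm)" where
  "join z u = (\<chi> i. case i of Inl k \<Rightarrow> z $ k | Inr a \<Rightarrow> u $ a)"

definition zpart :: "complex^('n::finite + 'm::finite) \<Rightarrow> complex^'n" where
  "zpart x = (\<chi> k. x $ Inl k)"

definition upart :: "complex^('n::finite + 'm::finite) \<Rightarrow> complex^'m" where
  "upart x = (\<chi> a. x $ Inr a)"

definition triv :: "('p, 'e, 'n, 'm) bchart \<Rightarrow> 'e \<Rightarrow> complex^'m" where
  "triv b = snd (snd b)"

definition base_chart :: "('p, 'e, 'n, 'm) bchart \<Rightarrow> ('p, 'n) chart" where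
  "base_chart b = (fst b, fst (snd b))"

definition total_chart ::
    "('e \<Rightarrow> 'p) \<Rightarrow> ('p, 'e, 'n::finite, 'm::finite) bchart \<Rightarrow> ('e, 'n + 'm) chart" where
  "total_chart pr b = (pr -` fst b, \<lambda>e. join (fst (snd b) (pr e)) (triv b e))"

abbreviation base_atlas where "base_atlas B \<equiv> base_chart ` B"
abbreviation total_atlas where "total_atlas pr B \<equiv> total_chart pr ` B"

text \<open>The vector space structure of the fibres is the one transported by the trivialisations.\<close>

definition hol_vector_bundle ::
    "('e::topological_space \<Rightarrow> 'p::topological_space) \<Rightarrow>
     ('p, 'e, 'n::finite, 'm::finite) bchart set \<Rightarrow> bool" where
  "hol_vector_bundle pr B \<longleftrightarrow>
     complex_atlas (base_atlas B) \<and> complex_atlas (total_atlas pr B) \<and>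
     (\<forall>b\<in>B. \<forall>p\<in>fst b. bij_betw (triv b) (pr -` {p}) UNIV) \<and>
     (\<forall>b\<in>B. \<forall>b'\<in>B. \<forall>p\<in>fst b \<inter> fst b'. \<exists>g :: complex^'m^'m.
        \<forall>e\<in>pr -` {p}. triv b' e = g *v triv b e)"

definition fibre_add ::
    "('e \<Rightarrow> 'p) \<Rightarrow> ('p, 'e, 'n::finite, 'm::finite) bchart set \<Rightarrow> 'e \<Rightarrow> 'e \<Rightarrow> 'e" where
  "fibre_add pr B e e' = (THE e''. pr e'' = pr e \<and>
     (\<forall>b\<in>B. pr e \<in> fst b \<longrightarrow> triv b e'' = triv b e + triv b e'))"

definition fibre_scale ::
    "('e \<Rightarrow> 'p) \<Rightarrow> ('p, 'e, 'n::finite, 'm::finite) bchart set \<Rightarrow> complex \<Rightarrow> 'e \<Rightarrow> 'e" where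
  "fibre_scale pr B a e = (THE e''. pr e'' = pr e \<and>
     (\<forall>b\<in>B. pr e \<in> fst b \<longrightarrow> triv b e'' = a *s triv b e))"

text \<open>Sections over \<open>U\<close> are total functions of which only the values on \<open>U\<close> matter.\<close>

definition hol_section ::
    "('e \<Rightarrow> 'p) \<Rightarrow> ('p, 'e, 'n::finite, 'm::finite) bchart set \<Rightarrow> 'p set \<Rightarrow> ('p \<Rightarrow> 'e) \<Rightarrow> bool" where
  "hol_section pr B U s \<longleftrightarrow> (\<forall>p\<in>U. pr (s p) = p) \<and>
     (\<forall>b\<in>B. hol_map_on (fst (snd b) ` (U \<inter> fst b)) (\<lambda>z. triv b (s (chart_inv (base_chart b) z))))"

definition hol_function ::
    "('p, 'e, 'n::finite, 'm::finite) bchart set \<Rightarrow> 'p set \<Rightarrow> ('p \<Rightarrow> complex) \<Rightarrow> bool" where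
  "hol_function B U f \<longleftrightarrow>
     (\<forall>b\<in>B. hol_fun_on (fst (snd b) ` (U \<inter> fst b)) (f \<circ> chart_inv (base_chart b)))"

definition local_frame ::
    "('e \<Rightarrow> 'p) \<Rightarrow> ('p, 'e, 'n::finite, 'm::finite) bchart \<Rightarrow> 'm \<Rightarrow> 'p \<Rightarrow> 'e" where
  "local_frame pr b \<alpha> p = (THE e. pr e = p \<and> triv b e = axis \<alpha> 1)"


section \<open>Holomorphic Lie algebroids\<close>

definition hol_bundle_morphism_to_tangent ::
    "('e::topological_space \<Rightarrow> 'p::topological_space) \<Rightarrow>
     ('p, 'e, 'n::finite, 'm::finite) bchart set \<Rightarrow> ('e \<Rightarrow> ('p, 'n) tvector) \<Rightarrow> bool" where
  "hol_bundle_morphism_to_tangent pr B \<rho> \<longleftrightarrow>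
     (\<forall>e. \<rho> e \<in> hol_tangent (base_atlas B) (pr e)) \<and>
     (\<forall>e e' c. pr e = pr e' \<longrightarrow> \<rho> (fibre_add pr B e e') c = \<rho> e c + \<rho> e' c) \<and>
     (\<forall>a e c. \<rho> (fibre_scale pr B a e) c = a *s \<rho> e c) \<and>
     (\<forall>b\<in>B. hol_map_on (snd (total_chart pr b) ` fst (total_chart pr b))
        (\<lambda>x. \<rho> (chart_inv (total_chart pr b) x) (base_chart b)))"

text \<open>The bracket is a bracket on the sheaf of holomorphic sections: \<open>br U\<close> is the bracket of
  sections over the open set \<open>U\<close>, and the family \<open>br\<close> is compatible with restrictions.\<close>

definition hol_lie_algebroid ::
    "('e::topological_space \<Rightarrow> 'p::topological_space) \<Rightarrow>
     ('p, 'e, 'n::finite, 'm::finite) bchart set \<Rightarrow> ('e \<Rightarrow> ('p, 'n) tvector) \<Rightarrow>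
     ('p set \<Rightarrow> ('p \<Rightarrow> 'e) \<Rightarrow> ('p \<Rightarrow> 'e) \<Rightarrow> 'p \<Rightarrow> 'e) \<Rightarrow> bool" where
  "hol_lie_algebroid pr B \<rho> br \<longleftrightarrow>
     hol_vector_bundle pr B \<and> hol_bundle_morphism_to_tangent pr B \<rho> \<and>
     (\<forall>U s\<^sub>1 s\<^sub>2. open U \<and> hol_section pr B U s\<^sub>1 \<and> hol_section pr B U s\<^sub>2 \<longrightarrow>
        hol_section pr B U (br U s\<^sub>1 s\<^sub>2)) \<and>
     (\<forall>U V s\<^sub>1 s\<^sub>2 t\<^sub>1 t\<^sub>2. open U \<and> open V \<and> V \<subseteq> U \<and>
        hol_section pr B U s\<^sub>1 \<and> hol_section pr B U s\<^sub>2 \<and> (\<forall>p\<in>V. t\<^sub>1 p = s\<^sub>1 p \<and> t\<^sub>2 p = s\<^sub>2 p) \<longrightarrow>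
        (\<forall>p\<in>V. br V t\<^sub>1 t\<^sub>2 p = br U s\<^sub>1 s\<^sub>2 p)) \<and>
     (\<forall>U s\<^sub>1 s\<^sub>2 s\<^sub>3. open U \<and> hol_section pr B U s\<^sub>1 \<and> hol_section pr B U s\<^sub>2 \<and> hol_section pr B U s\<^sub>3 \<longrightarrow>
        (\<forall>p\<in>U. br U (\<lambda>q. fibre_add pr B (s\<^sub>1 q) (s\<^sub>2 q)) s\<^sub>3 p
               = fibre_add pr B (br U s\<^sub>1 s\<^sub>3 p) (br U s\<^sub>2 s\<^sub>3 p)) \<and>
        (\<forall>a. \<forall>p\<in>U. br U (\<lambda>q. fibre_scale pr B a (s\<^sub>1 q)) s\<^sub>2 p = fibre_scale pr B a (br U s\<^sub>1 s\<^sub>2 p)) \<and>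
        (\<forall>p\<in>U. br U s\<^sub>1 s\<^sub>2 p = fibre_scale pr B (-1) (br U s\<^sub>2 s\<^sub>1 p)) \<and>
        (\<forall>p\<in>U. fibre_add pr B (br U s\<^sub>1 (br U s\<^sub>2 s\<^sub>3) p)
                  (fibre_add pr B (br U s\<^sub>2 (br U s\<^sub>3 s\<^sub>1) p) (br U s\<^sub>3 (br U s\<^sub>1 s\<^sub>2) p))
               = fibre_scale pr B 0 (s\<^sub>1 p))) \<and>
     (\<forall>U s\<^sub>1 s\<^sub>2 f. open U \<and> hol_section pr B U s\<^sub>1 \<and> hol_section pr B U s\<^sub>2 \<and> hol_function B U f \<longrightarrow>
        (\<forall>p\<in>U. br U s\<^sub>1 (\<lambda>q. fibre_scale pr B (f q) (s\<^sub>2 q)) p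
           = fibre_add pr B (fibre_scale pr B (f p) (br U s\<^sub>1 s\<^sub>2 p))
               (fibre_scale pr B (tangent_apply (base_atlas B) p (\<rho> (s\<^sub>1 p)) f) (s\<^sub>2 p))))"


section \<open>The prolongation\<close>

text \<open>An element of \<open>T'E\<close> is a pair \<open>(u, v)\<close> with \<open>v\<close> tangent at \<open>u\<close>.\<close>

definition prolongation ::
    "('e \<Rightarrow> 'p) \<Rightarrow> ('p, 'e, 'n::finite, 'm::finite) bchart set \<Rightarrow> ('e \<Rightarrow> ('p, 'n) tvector) \<Rightarrow>
     ('e \<times> 'e \<times> ('e, 'n + 'm) tvector) set" where
  "prolongation pr B \<rho> = {(e, u, v). v \<in> hol_tangent (total_atlas pr B) u \<and> pr u = pr e \<and>
     (\<forall>c\<in>total_atlas pr B. \<forall>c'\<in>base_atlas B. u \<in> fst c \<longrightarrow> pr u \<in> fst c' \<longrightarrow>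
        \<rho> e c' = frechet_derivative (snd c' \<circ> pr \<circ> chart_inv c) (at (snd c u)) (v c))}"

definition frame_Z ::
    "('e \<Rightarrow> 'p) \<Rightarrow> ('p, 'e, 'n::finite, 'm::finite) bchart set \<Rightarrow> ('e \<Rightarrow> ('p, 'n) tvector) \<Rightarrow>
     ('p, 'e, 'n, 'm) bchart \<Rightarrow> 'm \<Rightarrow> 'e \<Rightarrow> 'e \<times> 'e \<times> ('e, 'n + 'm) tvector" where
  "frame_Z pr B \<rho> b \<alpha> u = (local_frame pr b \<alpha> (pr u), u,
     tangent_of (total_atlas pr B) (total_chart pr b) u
       (join (\<rho> (local_frame pr b \<alpha> (pr u)) (base_chart b)) 0))"

definition frame_V ::
    "('e \<Rightarrow> 'p) \<Rightarrow> ('p, 'e, 'n::finite, 'm::finite) bchart set \<Rightarrow>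
     ('p, 'e, 'n, 'm) bchart \<Rightarrow> 'm \<Rightarrow> 'e \<Rightarrow> 'e \<times> 'e \<times> ('e, 'n + 'm) tvector" where
  "frame_V pr B b \<alpha> u = (fibre_scale pr B 0 u, u,
     tangent_of (total_atlas pr B) (total_chart pr b) u (join 0 (axis \<alpha> 1)))"


lemma hol_map_on_differentiable:
  assumes "hol_map_on S f" "x \<in> S"
  shows "f differentiable (at x)"
proof -
  have "\<forall>j. \<exists>D. ((\<lambda>y. f y $ j) has_derivative D) (at x)"
    using assms unfolding hol_map_on_def hol_fun_on_def by blast
  then have "\<forall>j. (\<lambda>y. f y $ j) differentiable (at x)"
    by (simp add: differentiable_def)
  then have "(\<lambda>y. \<Sum>j\<in>UNIV. axis j (f y $ j)) differentiable (at x)"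
  proof (intro differentiable_sum ballI)
    fix j :: 'b
    assume a: "\<forall>j. (\<lambda>y. f y $ j) differentiable (at x)"
    have "bounded_linear (axis j :: complex \<Rightarrow> complex^'b)"
      unfolding linear_conv_bounded_linear[symmetric]
      by (rule linearI) (simp_all add: axis_def vec_eq_iff)
    with a show "(\<lambda>y. axis j (f y $ j)) differentiable (at x)"
      using bounded_linear.has_derivative unfolding differentiable_def by blast
  qed simp
  moreover have "(\<lambda>y. \<Sum>j\<in>UNIV. axis j (f y $ j)) = f"
    by (simp add: fun_eq_iff vec_eq_iff axis_def)
  ultimately show ?thesis by simp
qed

lemma hol_tangentD:
  assumes "v \<in> hol_tangent A p" "c \<in> A" "c' \<in> A" "p \<in> fst c" "p \<in> fst c'"
  shows "v c' = frechet_derivative (transition c c') (at (snd c p)) (v c)"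
  using assms unfolding hol_tangent_def by blast

context
  fixes A :: "('x::topological_space, 'i::finite) chart set"
  assumes A: "complex_atlas A"
begin

lemma atlas_chart_inv:
  assumes "c \<in> A" "p \<in> fst c"
  shows "chart_inv c (snd c p) = p"
  using A assms unfolding complex_atlas_def homeomorphism_def by blast

lemma atlas_open_image:
  assumes "c \<in> A" "open W" "W \<subseteq> fst c"
  shows "open (snd c ` W)"
proof -
  have h: "homeomorphism (fst c) (snd c ` fst c) (snd c) (chart_inv c)" "open (snd c ` fst c)"
    using A assms unfolding complex_atlas_def by auto
  have "openin (top_of_set (fst c)) W"
    unfolding openin_open by (rule exI[of _ W]) (use assms in auto)
  then have "openin (top_of_set (snd c ` fst c)) (snd c ` W)"
    using homeomorphism_imp_open_map[OF h(1)] by blast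
  then show ?thesis using h(2) openin_open_trans by blast
qed

lemma atlas_open: "c \<in> A \<Longrightarrow> open (fst c)"
  using A unfolding complex_atlas_def by blast

lemma transition_has_derivative:
  assumes "c \<in> A" "c' \<in> A" "p \<in> fst c \<inter> fst c'"
  shows "(transition c c' has_derivative frechet_derivative (transition c c') (at (snd c p))) (at (snd c p))"
proof -
  have "transition c c' differentiable (at (snd c p))"
    using A assms hol_map_on_differentiable unfolding complex_atlas_def by blast
  then show ?thesis by (simp add: frechet_derivative_works)
qed

lemma transition_self:
  assumes "c \<in> A" "p \<in> fst c"
  shows "frechet_derivative (transition c c) (at (snd c p)) w = w"
proof -
  have "((\<lambda>x. x) has_derivative (\<lambda>x. x)) (at (snd c p))" by simp
  then have "(transition c c has_derivative (\<lambda>x. x)) (at (snd c p))"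
    by (rule has_derivative_transform_within_open[of _ _ _ _ "snd c ` fst c"])
      (use assms A in \<open>auto simp: transition_def atlas_chart_inv complex_atlas_def\<close>)
  then show ?thesis by (metis frechet_derivative_at)
qed

lemma transition_cocycle:
  assumes "c \<in> A" "c' \<in> A" "c'' \<in> A" "p \<in> fst c" "p \<in> fst c'" "p \<in> fst c''"
  shows "frechet_derivative (transition c' c'') (at (snd c' p))
           (frechet_derivative (transition c c') (at (snd c p)) w)
         = frechet_derivative (transition c c'') (at (snd c p)) w"
proof -
  let ?W = "fst c \<inter> fst c' \<inter> fst c''"
  let ?D = "frechet_derivative (transition c c') (at (snd c p))"
  let ?D' = "frechet_derivative (transition c' c'') (at (snd c' p))"
  have t: "transition c c' (snd c p) = snd c' p"
    using assms by (simp add: transition_def atlas_chart_inv)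
  have "((transition c' c'' \<circ> transition c c') has_derivative (?D' \<circ> ?D)) (at (snd c p))"
    by (rule diff_chain_at) (use assms t transition_has_derivative in auto)
  then have "(transition c c'' has_derivative (?D' \<circ> ?D)) (at (snd c p))"
  proof (rule has_derivative_transform_within_open[of _ _ _ _ "snd c ` ?W"])
    show "open (snd c ` ?W)"
      by (intro atlas_open_image open_Int atlas_open) (use assms in auto)
  qed (use assms in \<open>auto simp: transition_def atlas_chart_inv\<close>)
  then show ?thesis by (metis comp_apply frechet_derivative_at)
qed

lemma tangent_of_in:
  assumes "c \<in> A" "p \<in> fst c"
  shows "tangent_of A c p w \<in> hol_tangent A p"
  unfolding hol_tangent_def mem_Collect_eq
proof (intro conjI allI ballI impI)
  show "tangent_of A c p w d = 0" if "\<not> (d \<in> A \<and> p \<in> fst d)" for d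
    using that by (simp only: tangent_of_def if_False)
  fix d d' assume d: "d \<in> A" "d' \<in> A" "p \<in> fst d \<inter> fst d'"
  then have "p \<in> fst d" "p \<in> fst d'" by simp_all
  then show "tangent_of A c p w d' = frechet_derivative (transition d d') (at (snd d p)) (tangent_of A c p w d)"
    using transition_cocycle[OF assms(1) d(1,2) assms(2)] d(1,2) by (simp add: tangent_of_def)
qed

lemma tangent_of_self: "c \<in> A \<Longrightarrow> p \<in> fst c \<Longrightarrow> tangent_of A c p w c = w"
  by (simp add: tangent_of_def transition_self)

lemma hol_tangent_eq:
  assumes "c \<in> A" "p \<in> fst c" "v \<in> hol_tangent A p"
  shows "v = tangent_of A c p (v c)"
proof
  fix d
  show "v d = tangent_of A c p (v c) d"
  proof (cases "d \<in> A \<and> p \<in> fst d")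
    case True
    then have "v d = frechet_derivative (transition c d) (at (snd c p)) (v c)"
      using hol_tangentD[OF assms(3,1) _ assms(2)] by blast
    with True show ?thesis by (simp only: tangent_of_def if_True simp_thms)
  next
    case False
    moreover have "v d = 0" using assms(3) False unfolding hol_tangent_def by blast
    ultimately show ?thesis by (simp only: tangent_of_def if_False)
  qed
qed

lemma tangent_of_linear:
  assumes "c \<in> A" "p \<in> fst c"
  shows "tangent_of A c p (\<Sum>i\<in>I. a i *s w i) d = (\<Sum>i\<in>I. a i *s tangent_of A c p (w i) d)"
proof (cases "d \<in> A \<and> p \<in> fst d")
  case True
  let ?D = "frechet_derivative (transition c d) (at (snd c p))"
  have hd: "(transition c d has_derivative ?D) (at (snd c p))"
    using transition_has_derivative assms True by blast
  have "?D (r *s v) $ j = r * ?D v $ j" for r v j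
  proof -
    have "((\<lambda>y. transition c d y $ j) has_derivative (\<lambda>h. ?D h $ j)) (at (snd c p))"
      by (rule bounded_linear.has_derivative[OF bounded_linear_vec_nth hd])
    moreover have "hol_fun_on (snd c ` (fst c \<inter> fst d)) (\<lambda>y. transition c d y $ j)"
      using A assms True unfolding complex_atlas_def hol_map_on_def by blast
    then obtain E where "((\<lambda>y. transition c d y $ j) has_derivative E) (at (snd c p))"
        "\<forall>a v. E (a *s v) = a * E v"
      unfolding hol_fun_on_def using assms True by blast
    ultimately show ?thesis by (metis has_derivative_unique)
  qed
  then have sc: "?D (r *s v) = r *s ?D v" for r v by (simp add: vec_eq_iff)
  have "linear ?D" using hd has_derivative_linear by blast
  then show ?thesis using True by (simp add: tangent_of_def linear_sum sc)
next
  case False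
  then have "tangent_of A c p u d = 0" for u by (simp only: tangent_of_def if_False)
  then show ?thesis by simp
qed

end

lemma zpart_join [simp]: "zpart (join z u) = z" by (simp add: zpart_def join_def)
lemma upart_join [simp]: "upart (join z u) = u" by (simp add: upart_def join_def)
lemma join_parts [simp]: "join (zpart x) (upart x) = x"
proof -
  have "join (zpart x) (upart x) $ i = x $ i" for i
    by (cases i) (simp_all add: join_def zpart_def upart_def)
  then show ?thesis by (simp add: vec_eq_iff)
qed

context
  fixes pr :: "'e::topological_space \<Rightarrow> 'p::topological_space"
    and B :: "('p, 'e, 'n::finite, 'm::finite) bchart set"
    and b :: "('p, 'e, 'n, 'm) bchart"
  assumes E: "hol_vector_bundle pr B" and b: "b \<in> B"
begin

lemma triv_bij: "p \<in> fst b \<Longrightarrow> bij_betw (triv b) (pr -` {p}) UNIV"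
  using E b unfolding hol_vector_bundle_def by blast

lemma triv_inj:
  assumes "pr e = pr e'" "pr e \<in> fst b" "triv b e = triv b e'"
  shows "e = e'"
  by (rule inj_onD[OF bij_betw_imp_inj_on[OF triv_bij[OF assms(2)]] assms(3)]) (use assms in simp_all)

lemma triv_surj:
  assumes "p \<in> fst b"
  obtains e where "pr e = p" "triv b e = a"
proof -
  have "a \<in> triv b ` (pr -` {p})" using triv_bij[OF assms] by (simp add: bij_betw_def)
  then show thesis using that by auto
qed

lemma triv_local_frame:
  assumes p: "p \<in> fst b"
  shows "pr (local_frame pr b \<alpha> p) = p \<and> triv b (local_frame pr b \<alpha> p) = axis \<alpha> 1"
proof -
  obtain e where e: "pr e = p" "triv b e = axis \<alpha> 1" using triv_surj[OF p] by blast
  have "local_frame pr b \<alpha> p = e"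
    unfolding local_frame_def
    by (rule the_equality) (use e p in \<open>auto intro!: triv_inj\<close>)
  with e show ?thesis by simp
qed

lemma triv_transition:
  assumes "b' \<in> B" "p \<in> fst b" "p \<in> fst b'"
  obtains g :: "complex^'m^'m" where "\<And>e. pr e = p \<Longrightarrow> triv b' e = g *v triv b e"
proof -
  have "\<exists>g :: complex^'m^'m. \<forall>e\<in>pr -` {p}. triv b' e = g *v triv b e"
    using E b assms unfolding hol_vector_bundle_def by blast
  then show thesis using that by auto
qed

lemma fibre_scale_works:
  assumes p: "pr e \<in> fst b"
  shows "pr (fibre_scale pr B a e) = pr e \<and> triv b (fibre_scale pr B a e) = a *s triv b e"
proof -
  obtain e'' where e: "pr e'' = pr e" "triv b e'' = a *s triv b e"
    using triv_surj[OF p] by blast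
  have t: "triv b' e'' = a *s triv b' e" if b': "b' \<in> B" "pr e \<in> fst b'" for b'
  proof -
    obtain g :: "complex^'m^'m" where "\<And>x. pr x = pr e \<Longrightarrow> triv b' x = g *v triv b x"
      using triv_transition[OF b'(1) p b'(2)] by blast
    then show ?thesis using e by (simp add: vec.scale)
  qed
  have "fibre_scale pr B a e = e''"
    unfolding fibre_scale_def
  proof (rule the_equality)
    show "y = e''" if "pr y = pr e \<and> (\<forall>b'\<in>B. pr e \<in> fst b' \<longrightarrow> triv b' y = a *s triv b' e)" for y
      by (rule triv_inj) (use that e b p in simp_all)
  qed (use e t in blast)
  with e show ?thesis by simp
qed

lemma fibre_add_works:
  assumes p: "pr e \<in> fst b" and e': "pr e' = pr e"
  shows "pr (fibre_add pr B e e') = pr e \<and> triv b (fibre_add pr B e e') = triv b e + triv b e'"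
proof -
  obtain e'' where e: "pr e'' = pr e" "triv b e'' = triv b e + triv b e'"
    using triv_surj[OF p] by blast
  have t: "triv b' e'' = triv b' e + triv b' e'" if b': "b' \<in> B" "pr e \<in> fst b'" for b'
  proof -
    obtain g :: "complex^'m^'m" where "\<And>x. pr x = pr e \<Longrightarrow> triv b' x = g *v triv b x"
      using triv_transition[OF b'(1) p b'(2)] by blast
    then show ?thesis using e e' by (simp add: matrix_vector_right_distrib)
  qed
  have "fibre_add pr B e e' = e''"
    unfolding fibre_add_def
  proof (rule the_equality)
    show "y = e''" if "pr y = pr e \<and> (\<forall>b'\<in>B. pr e \<in> fst b' \<longrightarrow> triv b' y = triv b' e + triv b' e')" for y
      by (rule triv_inj) (use that e b p in simp_all)
  qed (use e t in blast)
  with e show ?thesis by simp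
qed

lemma anchor_expansion:
  assumes r: "hol_bundle_morphism_to_tangent pr B \<rho>" and e: "pr e \<in> fst b"
  shows "\<rho> e c = (\<Sum>\<alpha>\<in>UNIV. triv b e $ \<alpha> *s \<rho> (local_frame pr b \<alpha> (pr e)) c)"
proof -
  define p where "p = pr e"
  have p: "p \<in> fst b" using e p_def by simp
  have "\<exists>x. pr x = p \<and> triv b x = a" for a using triv_surj[OF p] by blast
  then obtain t where t: "pr (t a) = p" "triv b (t a) = a" for a by metis
  have teq: "t (triv b x) = x" if "pr x = p" for x
    by (rule triv_inj) (use t that p in simp_all)
  have add: "\<rho> (t (a + a')) c = \<rho> (t a) c + \<rho> (t a') c" for a a'
  proof -
    have "fibre_add pr B (t a) (t a') = t (a + a')"
      using fibre_add_works[of "t a" "t a'"] t p by (intro triv_inj) simp_all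
    then show ?thesis using r t unfolding hol_bundle_morphism_to_tangent_def by metis
  qed
  have sc: "\<rho> (t (r *s a)) c = r *s \<rho> (t a) c" for r a
  proof -
    have "fibre_scale pr B r (t a) = t (r *s a)"
      using fibre_scale_works[of "t a" r] t p by (intro triv_inj) simp_all
    then show ?thesis using assms(1) t unfolding hol_bundle_morphism_to_tangent_def by metis
  qed
  have z: "\<rho> (t 0) c = 0" using sc[of 0 0] by simp
  have "\<rho> (t (\<Sum>\<alpha>\<in>I. a \<alpha> *s axis \<alpha> 1)) c = (\<Sum>\<alpha>\<in>I. a \<alpha> *s \<rho> (t (axis \<alpha> 1)) c)"
    if "finite I" for I and a :: "'m \<Rightarrow> complex"
    using that by induction (auto simp: z add sc)
  from this[of UNIV "\<lambda>\<alpha>. triv b e $ \<alpha>"]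
  have "\<rho> (t (triv b e)) c = (\<Sum>\<alpha>\<in>UNIV. triv b e $ \<alpha> *s \<rho> (t (axis \<alpha> 1)) c)"
    by (simp add: basis_expansion)
  moreover have "t (axis \<alpha> 1) = local_frame pr b \<alpha> p" for \<alpha>
    using triv_local_frame[OF p, of \<alpha>] teq[of "local_frame pr b \<alpha> p"] by simp
  ultimately show ?thesis using teq[of e] p_def by simp
qed

lemma prolongation_iff:
  assumes r: "hol_bundle_morphism_to_tangent pr B \<rho>" and u: "pr u \<in> fst b"
  shows "(e, u, v) \<in> prolongation pr B \<rho> \<longleftrightarrow> pr e = pr u \<and>
     (\<exists>w. v = tangent_of (total_atlas pr B) (total_chart pr b) u (join (\<rho> e (base_chart b)) w))"
proof -
  let ?TA = "total_atlas pr B" let ?c = "total_chart pr b" let ?d = "base_chart b"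
  have TA: "complex_atlas ?TA" and BA: "complex_atlas (base_atlas B)"
    using E unfolding hol_vector_bundle_def by auto
  have c: "?c \<in> ?TA" "u \<in> fst ?c" and d: "?d \<in> base_atlas B" "pr u \<in> fst ?d"
    using b u by (auto simp: total_chart_def base_chart_def)
  have cd: "zpart (snd ?c x) = snd ?d (pr x)" for x
    by (simp add: total_chart_def base_chart_def)
  have zl: "bounded_linear (zpart :: complex^('n+'m) \<Rightarrow> complex^'n)"
  unfolding linear_conv_bounded_linear[symmetric]
    by (rule linearI) (simp_all add: zpart_def vec_eq_iff)
  have key: "frechet_derivative (snd d' \<circ> pr \<circ> chart_inv c') (at (snd c' u)) (v c')
      = frechet_derivative (transition ?d d') (at (snd ?d (pr u))) (zpart (v ?c))"
    if v: "v \<in> hol_tangent ?TA u" and c': "c' \<in> ?TA" "u \<in> fst c'" and d': "d' \<in> base_atlas B" "pr u \<in> fst d'"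
    for c' d' v
  proof -
    let ?D1 = "frechet_derivative (transition c' ?c) (at (snd c' u))"
    let ?D2 = "frechet_derivative (transition ?d d') (at (snd ?d (pr u)))"
    have t: "transition c' ?c (snd c' u) = snd ?c u"
      using c c' by (simp add: transition_def atlas_chart_inv[OF TA])
    have h1: "(transition c' ?c has_derivative ?D1) (at (snd c' u))"
      by (rule transition_has_derivative[OF TA]) (use c c' in auto)
    have h2: "((zpart \<circ> transition c' ?c) has_derivative (zpart \<circ> ?D1)) (at (snd c' u))"
      using bounded_linear.has_derivative[OF zl h1] by (simp add: comp_def)
    have h3: "(transition ?d d' has_derivative ?D2) (at ((zpart \<circ> transition c' ?c) (snd c' u)))"
      using transition_has_derivative[OF BA d(1) d'(1), of "pr u"] d d' t cd by simp
    from diff_chain_at[OF h2 h3]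
    have "((transition ?d d' \<circ> (zpart \<circ> transition c' ?c)) has_derivative (?D2 \<circ> (zpart \<circ> ?D1))) (at (snd c' u))" .
    then have "((snd d' \<circ> pr \<circ> chart_inv c') has_derivative (?D2 \<circ> (zpart \<circ> ?D1))) (at (snd c' u))"
    proof (rule has_derivative_transform_within_open[of _ _ _ _ "snd c' ` (fst ?c \<inter> fst c')"])
      show "open (snd c' ` (fst ?c \<inter> fst c'))"
        by (intro atlas_open_image[OF TA] open_Int atlas_open[OF TA]) (use c c' in auto)
      fix y assume "y \<in> snd c' ` (fst ?c \<inter> fst c')"
      then obtain x where x: "x \<in> fst ?c" "x \<in> fst c'" "y = snd c' x" by auto
      have "pr x \<in> fst ?d" using x by (simp add: total_chart_def base_chart_def)
      then show "(transition ?d d' \<circ> (zpart \<circ> transition c' ?c)) y = (snd d' \<circ> pr \<circ> chart_inv c') y"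
        using x c' c d by (simp add: transition_def atlas_chart_inv[OF TA] atlas_chart_inv[OF BA] cd)
    qed (use c c' in auto)
    then have "frechet_derivative (snd d' \<circ> pr \<circ> chart_inv c') (at (snd c' u)) = ?D2 \<circ> (zpart \<circ> ?D1)"
      by (rule frechet_derivative_at[symmetric])
    moreover have "?D1 (v c') = v ?c"
      by (rule hol_tangentD[symmetric, OF v c'(1) c(1) c'(2) c(2)])
    ultimately show ?thesis by (simp only: comp_apply)
  qed
  show ?thesis
  proof
    assume "(e, u, v) \<in> prolongation pr B \<rho>"
    then have v: "v \<in> hol_tangent ?TA u" and e: "pr e = pr u"
      and x: "\<forall>c\<in>?TA. \<forall>c'\<in>base_atlas B. u \<in> fst c \<longrightarrow> pr u \<in> fst c' \<longrightarrow>
        \<rho> e c' = frechet_derivative (snd c' \<circ> pr \<circ> chart_inv c) (at (snd c u)) (v c)"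
      unfolding prolongation_def by auto
    have "\<rho> e ?d = zpart (v ?c)"
      using x[rule_format, OF c(1) d(1) c(2) d(2)] key[OF v c d]
      by (simp only: transition_self[OF BA d])
    then have "v = tangent_of ?TA ?c u (join (\<rho> e ?d) (upart (v ?c)))"
      using hol_tangent_eq[OF TA c v] by simp
    with e show "pr e = pr u \<and> (\<exists>w. v = tangent_of ?TA ?c u (join (\<rho> e ?d) w))" by blast
  next
    assume "pr e = pr u \<and> (\<exists>w. v = tangent_of ?TA ?c u (join (\<rho> e ?d) w))"
    then obtain w where e: "pr e = pr u" and w: "v = tangent_of ?TA ?c u (join (\<rho> e ?d) w)" by blast
    have v: "v \<in> hol_tangent ?TA u" using w tangent_of_in[OF TA c] by simp
    have z: "zpart (v ?c) = \<rho> e ?d" using w tangent_of_self[OF TA c] by simp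
    have "\<rho> e \<in> hol_tangent (base_atlas B) (pr u)"
      using r unfolding hol_bundle_morphism_to_tangent_def e[symmetric] by blast
    then have rd: "\<rho> e d' = frechet_derivative (transition ?d d') (at (snd ?d (pr u))) (\<rho> e ?d)"
      if "d' \<in> base_atlas B" "pr u \<in> fst d'" for d'
      using hol_tangentD[OF _ d(1) that(1) d(2) that(2)] by blast
    have fin: "\<rho> e d' = frechet_derivative (snd d' \<circ> pr \<circ> chart_inv c') (at (snd c' u)) (v c')"
      if "c' \<in> ?TA" "d' \<in> base_atlas B" "u \<in> fst c'" "pr u \<in> fst d'" for c' d'
      by (simp only: key[OF v that(1,3,2,4)] z rd[OF that(2,4)])
    show "(e, u, v) \<in> prolongation pr B \<rho>"
      unfolding prolongation_def mem_Collect_eq case_prod_conv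
    proof (intro conjI ballI impI)
      show "pr u = pr e" using e by (rule sym)
    qed (rule v, rule fin)
  qed
qed

text \<open>\<open>frame_Z\<close> and \<open>frame_V\<close> are frames of the prolongation: at \<open>u\<close>, its elements are the
  unique linear combinations of the frame vectors.\<close>

lemma frame_mem:
  assumes "hol_bundle_morphism_to_tangent pr B \<rho>" "pr u \<in> fst b"
  shows "frame_Z pr B \<rho> b \<alpha> u \<in> prolongation pr B \<rho>" "frame_V pr B b \<alpha> u \<in> prolongation pr B \<rho>"
proof -
  show "frame_Z pr B \<rho> b \<alpha> u \<in> prolongation pr B \<rho>"
    unfolding frame_Z_def
    by (rule prolongation_iff[OF assms, THEN iffD2],
        intro conjI conjunct1[OF triv_local_frame[OF assms(2)]], rule exI, rule refl)
  have "\<rho> (fibre_scale pr B 0 u) (base_chart b) = 0 *s \<rho> u (base_chart b)"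
    by (rule assms(1)[unfolded hol_bundle_morphism_to_tangent_def,
          THEN conjunct2, THEN conjunct2, THEN conjunct1, rule_format])
  also have "\<dots> = 0" by (rule vector_smult_lzero)
  finally have z: "\<rho> (fibre_scale pr B 0 u) (base_chart b) = 0" .
  show "frame_V pr B b \<alpha> u \<in> prolongation pr B \<rho>"
    unfolding frame_V_def
    by (rule prolongation_iff[OF assms, THEN iffD2], unfold z,
        intro conjI conjunct1[OF fibre_scale_works[OF assms(2)]], rule exI, rule refl)
qed

lemma frame_expansion:
  assumes r: "hol_bundle_morphism_to_tangent pr B \<rho>" and u: "pr u \<in> fst b"
    and mem: "(e, u, v) \<in> prolongation pr B \<rho>"
  shows "\<exists>!(s, w). triv b e = (\<Sum>\<alpha>\<in>UNIV. s $ \<alpha> *s triv b (fst (frame_Z pr B \<rho> b \<alpha> u))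
           + w $ \<alpha> *s triv b (fst (frame_V pr B b \<alpha> u))) \<and>
      (\<forall>c. v c = (\<Sum>\<alpha>\<in>UNIV. s $ \<alpha> *s snd (snd (frame_Z pr B \<rho> b \<alpha> u)) c
           + w $ \<alpha> *s snd (snd (frame_V pr B b \<alpha> u)) c))"
proof -
  let ?T = "tangent_of (total_atlas pr B) (total_chart pr b) u"
  let ?r = "\<lambda>\<alpha>. \<rho> (local_frame pr b \<alpha> (pr u)) (base_chart b)"
  have TA: "complex_atlas (total_atlas pr B)" using E unfolding hol_vector_bundle_def by auto
  have c: "total_chart pr b \<in> total_atlas pr B" "u \<in> fst (total_chart pr b)"
    using b u by (auto simp: total_chart_def)
  have comb: "(\<Sum>\<alpha>\<in>UNIV. s $ \<alpha> *s ?T (join (?r \<alpha>) 0) c + w $ \<alpha> *s ?T (join 0 (axis \<alpha> 1)) c)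
      = ?T (join (\<Sum>\<alpha>\<in>UNIV. s $ \<alpha> *s ?r \<alpha>) w) c" for s w :: "complex^'m" and c
  proof -
    have "join (\<Sum>\<alpha>\<in>UNIV. s $ \<alpha> *s ?r \<alpha>) w
      = (\<Sum>i\<in>UNIV. (case i of Inl \<alpha> \<Rightarrow> s $ \<alpha> | Inr \<alpha> \<Rightarrow> w $ \<alpha>) *s
            (case i of Inl \<alpha> \<Rightarrow> join (?r \<alpha>) 0 | Inr \<alpha> \<Rightarrow> join 0 (axis \<alpha> 1)))"
      by (auto simp: vec_eq_iff UNIV_Plus_UNIV[symmetric] sum.Plus join_def axis_def if_distrib
          split: sum.split cong: if_cong simp del: UNIV_Plus_UNIV)
    then show ?thesis
      by (simp only: tangent_of_linear[OF TA c])
        (simp add: UNIV_Plus_UNIV[symmetric] sum.Plus sum.distrib del: UNIV_Plus_UNIV)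
  qed
  have tz: "triv b (fst (frame_Z pr B \<rho> b \<alpha> u)) = axis \<alpha> 1"
    "triv b (fst (frame_V pr B b \<alpha> u)) = 0" for \<alpha>
    using triv_local_frame[OF u] fibre_scale_works[OF u] by (auto simp: frame_Z_def frame_V_def)
  obtain w0 where e: "pr e = pr u" and v: "v = ?T (join (\<rho> e (base_chart b)) w0)"
    using prolongation_iff[OF r u] mem by blast
  have re: "\<rho> e (base_chart b) = (\<Sum>\<alpha>\<in>UNIV. triv b e $ \<alpha> *s ?r \<alpha>)"
  proof -
    have "pr e \<in> fst b" using u by (simp only: e)
    from anchor_expansion[OF r this, of "base_chart b"] show ?thesis by (simp only: e)
  qed
  have "(triv b e = (\<Sum>\<alpha>\<in>UNIV. s $ \<alpha> *s triv b (fst (frame_Z pr B \<rho> b \<alpha> u))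
           + w $ \<alpha> *s triv b (fst (frame_V pr B b \<alpha> u))) \<and>
      (\<forall>c. v c = (\<Sum>\<alpha>\<in>UNIV. s $ \<alpha> *s snd (snd (frame_Z pr B \<rho> b \<alpha> u)) c
           + w $ \<alpha> *s snd (snd (frame_V pr B b \<alpha> u)) c)))
    \<longleftrightarrow> s = triv b e \<and> w = w0" for s w
  proof -
    have 1: "(\<forall>c. v c = ?T (join (\<Sum>\<alpha>\<in>UNIV. s $ \<alpha> *s ?r \<alpha>) w) c) \<longleftrightarrow> w = w0" if "s = triv b e"
    proof
      assume "\<forall>c. v c = ?T (join (\<Sum>\<alpha>\<in>UNIV. s $ \<alpha> *s ?r \<alpha>) w) c"
      then have "v (total_chart pr b) = ?T (join (\<Sum>\<alpha>\<in>UNIV. s $ \<alpha> *s ?r \<alpha>) w) (total_chart pr b)"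
        by (rule spec)
      then have "v (total_chart pr b) = join (\<Sum>\<alpha>\<in>UNIV. s $ \<alpha> *s ?r \<alpha>) w"
        by (simp only: tangent_of_self[OF TA c])
      moreover have "v (total_chart pr b) = join (\<rho> e (base_chart b)) w0"
        unfolding v by (rule tangent_of_self[OF TA c])
      ultimately have "upart (join (\<Sum>\<alpha>\<in>UNIV. s $ \<alpha> *s ?r \<alpha>) w) = upart (join (\<rho> e (base_chart b)) w0)"
        by (simp only:)
      then show "w = w0" by (simp only: upart_join)
    next
      assume "w = w0"
      then show "\<forall>c. v c = ?T (join (\<Sum>\<alpha>\<in>UNIV. s $ \<alpha> *s ?r \<alpha>) w) c"
        by (simp only: v re that simp_thms)
    qed
    have 2: "(\<Sum>\<alpha>\<in>UNIV. s $ \<alpha> *s triv b (fst (frame_Z pr B \<rho> b \<alpha> u))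
           + w $ \<alpha> *s triv b (fst (frame_V pr B b \<alpha> u))) = s"
      by (simp add: tz basis_expansion)
    show ?thesis unfolding 2 using 1 by (auto simp: frame_Z_def frame_V_def comb)
  qed
  then show ?thesis by auto
qed

end


section \<open>Functions on \<open>E\<close> and Finsler functions\<close>

definition local_rep ::
    "('e \<Rightarrow> 'p) \<Rightarrow> ('p, 'e, 'n::finite, 'm::finite) bchart \<Rightarrow> ('e \<Rightarrow> 'b) \<Rightarrow> complex^('n + 'm) \<Rightarrow> 'b" where
  "local_rep pr b f = f \<circ> chart_inv (total_chart pr b)"

definition coord_domain ::
    "('e \<Rightarrow> 'p) \<Rightarrow> ('p, 'e, 'n::finite, 'm::finite) bchart \<Rightarrow> (complex^('n + 'm)) set" where
  "coord_domain pr b = snd (total_chart pr b) ` fst (total_chart pr b)"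

text \<open>The coordinate domain with the zero section removed.\<close>

definition slit_domain ::
    "('e \<Rightarrow> 'p) \<Rightarrow> ('p, 'e, 'n::finite, 'm::finite) bchart \<Rightarrow> (complex^('n + 'm)) set" where
  "slit_domain pr b = {x \<in> coord_domain pr b. upart x \<noteq> 0}"

definition smooth_function ::
    "('e \<Rightarrow> 'p) \<Rightarrow> ('p, 'e, 'n::finite, 'm::finite) bchart set \<Rightarrow> ('e \<Rightarrow> complex) \<Rightarrow> bool" where
  "smooth_function pr B f \<longleftrightarrow> (\<forall>b\<in>B. smooth_on (coord_domain pr b) (local_rep pr b f))"

text \<open>\<open>levi F x\<close> is the matrix \<open>h\<close> with row index \<open>\<alpha>\<close> and column index \<open>\<beta>\<close>-bar.\<close>

definition levi :: "(complex^('n::finite + 'm::finite) \<Rightarrow> complex) \<Rightarrow> complex^('n + 'm) \<Rightarrow> complex^'m^'m" where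
  "levi F x = (\<chi> \<alpha> \<beta>. wirt (Inr \<alpha>) (wirt_bar (Inr \<beta>) F) x)"

definition complex_finsler ::
    "('e \<Rightarrow> 'p) \<Rightarrow> ('p, 'e, 'n::finite, 'm::finite) bchart set \<Rightarrow> ('e \<Rightarrow> real) \<Rightarrow> bool" where
  "complex_finsler pr B F \<longleftrightarrow>
     (\<forall>e. 0 \<le> F e) \<and>
     (\<forall>a e. F (fibre_scale pr B a e) = (cmod a)\<^sup>2 * F e) \<and>
     (\<forall>b\<in>B. smooth_on (slit_domain pr b) (local_rep pr b F)) \<and>
     (\<forall>b\<in>B. \<forall>x\<in>slit_domain pr b. \<forall>v :: complex^'m. v \<noteq> 0 \<longrightarrow>
        0 < Re (\<Sum>\<alpha>\<in>UNIV. \<Sum>\<beta>\<in>UNIV.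
              levi (complex_of_real \<circ> local_rep pr b F) x $ \<alpha> $ \<beta> * v $ \<alpha> * cnj (v $ \<beta>)))"


section \<open>Local data of a Lie algebroid with Finsler function in a bundle chart\<close>

text \<open>\<open>rho G k \<alpha>\<close> is \<open>\<rho>\<^sup>k\<^sub>\<alpha>\<close>, \<open>str G \<gamma> \<alpha> \<beta>\<close> is the coefficient of \<open>e\<^sub>\<gamma>\<close> in \<open>[e\<^sub>\<alpha>, e\<^sub>\<beta>]\<close>, both as
  functions of \<open>z\<close>; \<open>fins G\<close> is the coordinate expression of \<open>F\<close> and \<open>slit G\<close> the coordinate
  domain without the zero section.\<close>

record ('n, 'm) local_data =
  rho :: "'n \<Rightarrow> 'm \<Rightarrow> complex^'n \<Rightarrow> complex"
  str :: "'m \<Rightarrow> 'm \<Rightarrow> 'm \<Rightarrow> complex^'n \<Rightarrow> complex"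
  fins :: "complex^('n + 'm) \<Rightarrow> complex"
  slit :: "(complex^('n + 'm)) set"

definition chart_data ::
    "('e \<Rightarrow> 'p) \<Rightarrow> ('e \<Rightarrow> ('p, 'n) tvector) \<Rightarrow> ('p set \<Rightarrow> ('p \<Rightarrow> 'e) \<Rightarrow> ('p \<Rightarrow> 'e) \<Rightarrow> 'p \<Rightarrow> 'e) \<Rightarrow>
     ('e \<Rightarrow> real) \<Rightarrow> ('p, 'e, 'n::finite, 'm::finite) bchart \<Rightarrow> ('n, 'm) local_data" where
  "chart_data pr \<rho> br F b = \<lparr>
     rho = (\<lambda>k \<alpha> z. \<rho> (local_frame pr b \<alpha> (chart_inv (base_chart b) z)) (base_chart b) $ k),
     str = (\<lambda>\<gamma> \<alpha> \<beta> z. triv b (br (fst b) (local_frame pr b \<alpha>) (local_frame pr b \<beta>)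
                                (chart_inv (base_chart b) z)) $ \<gamma>),
     fins = complex_of_real \<circ> local_rep pr b F,
     slit = slit_domain pr b\<rparr>"

definition d_base :: "('n::finite, 'm::finite) local_data \<Rightarrow> 'm \<Rightarrow>
    (complex^('n + 'm) \<Rightarrow> complex) \<Rightarrow> complex^('n + 'm) \<Rightarrow> complex" where
  "d_base G \<alpha> g x = (\<Sum>k\<in>UNIV. rho G k \<alpha> (zpart x) * wirt (Inl k) g x)"

definition d_base_bar :: "('n::finite, 'm::finite) local_data \<Rightarrow> 'm \<Rightarrow>
    (complex^('n + 'm) \<Rightarrow> complex) \<Rightarrow> complex^('n + 'm) \<Rightarrow> complex" where
  "d_base_bar G \<alpha> g x = (\<Sum>k\<in>UNIV. cnj (rho G k \<alpha> (zpart x)) * wirt_bar (Inl k) g x)"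

definition d_fib :: "'m \<Rightarrow> (complex^('n::finite + 'm::finite) \<Rightarrow> complex) \<Rightarrow> complex^('n + 'm) \<Rightarrow> complex" where
  "d_fib \<alpha> = wirt (Inr \<alpha>)"

definition d_fib_bar :: "'m \<Rightarrow> (complex^('n::finite + 'm::finite) \<Rightarrow> complex) \<Rightarrow> complex^('n + 'm) \<Rightarrow> complex" where
  "d_fib_bar \<alpha> = wirt_bar (Inr \<alpha>)"

text \<open>\<open>hinv G x $ \<sigma> $ \<gamma>\<close> is the inverse matrix entry with upper indices \<open>\<sigma>\<close>-bar, \<open>\<gamma>\<close>.\<close>

definition hmat :: "('n::finite, 'm::finite) local_data \<Rightarrow> complex^('n + 'm) \<Rightarrow> complex^'m^'m" where
  "hmat G x = levi (fins G) x"

definition hinv :: "('n::finite, 'm::finite) local_data \<Rightarrow> complex^('n + 'm) \<Rightarrow> complex^'m^'m" where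
  "hinv G x = matrix_inv (hmat G x)"

definition hdet :: "('n::finite, 'm::finite) local_data \<Rightarrow> complex^('n + 'm) \<Rightarrow> complex" where
  "hdet G x = det (hmat G x)"

text \<open>\<open>Ncoef G \<beta> \<alpha>\<close> is \<open>N\<^sup>\<beta>\<^sub>\<alpha>\<close>, and \<open>Cvert G \<gamma> \<alpha> \<beta>\<close> is the vertical connection coefficient
  with upper index \<open>\<gamma>\<close> and lower indices \<open>\<alpha>\<close>, \<open>\<beta>\<close>.\<close>

definition Ncoef :: "('n::finite, 'm::finite) local_data \<Rightarrow> 'm \<Rightarrow> 'm \<Rightarrow> complex^('n + 'm) \<Rightarrow> complex" where
  "Ncoef G \<beta> \<alpha> x = (\<Sum>\<sigma>\<in>UNIV. hinv G x $ \<sigma> $ \<beta> * d_base G \<alpha> (d_fib_bar \<sigma> (fins G)) x)"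

definition Cvert :: "('n::finite, 'm::finite) local_data \<Rightarrow> 'm \<Rightarrow> 'm \<Rightarrow> 'm \<Rightarrow> complex^('n + 'm) \<Rightarrow> complex" where
  "Cvert G \<gamma> \<alpha> \<beta> x = (\<Sum>\<sigma>\<in>UNIV. hinv G x $ \<sigma> $ \<gamma> * d_fib \<beta> (\<lambda>y. hmat G y $ \<alpha> $ \<sigma>) x)"

definition delta :: "('n::finite, 'm::finite) local_data \<Rightarrow> 'm \<Rightarrow>
    (complex^('n + 'm) \<Rightarrow> complex) \<Rightarrow> complex^('n + 'm) \<Rightarrow> complex" where
  "delta G \<alpha> g x = d_base G \<alpha> g x - (\<Sum>\<beta>\<in>UNIV. Ncoef G \<beta> \<alpha> x * d_fib \<beta> g x)"

definition delta_bar :: "('n::finite, 'm::finite) local_data \<Rightarrow> 'm \<Rightarrow>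
    (complex^('n + 'm) \<Rightarrow> complex) \<Rightarrow> complex^('n + 'm) \<Rightarrow> complex" where
  "delta_bar G \<alpha> g x = d_base_bar G \<alpha> g x - (\<Sum>\<beta>\<in>UNIV. cnj (Ncoef G \<beta> \<alpha> x) * d_fib_bar \<beta> g x)"


section \<open>Sections of the complexified prolongation\<close>

text \<open>Indices of the frame of sections of the complexified prolongation over the domain of a
  bundle chart: \<open>frame_Z\<close>, \<open>frame_V\<close> and their conjugates.\<close>

datatype 'm frame_idx = IZ 'm | IV 'm | IZbar 'm | IVbar 'm

instance frame_idx :: (finite) finite
proof
  have "x \<in> range IZ \<union> range IV \<union> range IZbar \<union> range IVbar" for x :: "'a frame_idx"
    by (cases x) simp_all
  then have "(UNIV :: 'a frame_idx set) \<subseteq> range IZ \<union> range IV \<union> range IZbar \<union> range IVbar"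
    by (rule subsetI)
  then show "finite (UNIV :: 'a frame_idx set)"
    by (rule finite_subset) simp
qed

type_synonym 'm tvec = "complex^('m frame_idx)"
type_synonym ('n, 'm) sec = "complex^('n + 'm) \<Rightarrow> 'm tvec"

fun frame_act :: "('n::finite, 'm::finite) local_data \<Rightarrow> 'm frame_idx \<Rightarrow>
    (complex^('n + 'm) \<Rightarrow> complex) \<Rightarrow> complex^('n + 'm) \<Rightarrow> complex" where
  "frame_act G (IZ \<alpha>) = d_base G \<alpha>"
| "frame_act G (IV \<alpha>) = d_fib \<alpha>"
| "frame_act G (IZbar \<alpha>) = d_base_bar G \<alpha>"
| "frame_act G (IVbar \<alpha>) = d_fib_bar \<alpha>"

definition sec_act :: "('n::finite, 'm::finite) local_data \<Rightarrow> ('n, 'm) sec \<Rightarrow>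
    (complex^('n + 'm) \<Rightarrow> complex) \<Rightarrow> complex^('n + 'm) \<Rightarrow> complex" where
  "sec_act G Z g x = (\<Sum>I\<in>UNIV. Z x $ I * frame_act G I g x)"

text \<open>\<open>frame_str G K I J\<close> is the \<open>K\<close>-th coefficient of the bracket of the \<open>I\<close>-th and \<open>J\<close>-th frame sections.\<close>

definition frame_str :: "('n::finite, 'm::finite) local_data \<Rightarrow> 'm frame_idx \<Rightarrow> 'm frame_idx \<Rightarrow> 'm frame_idx \<Rightarrow>
    complex^('n + 'm) \<Rightarrow> complex" where
  "frame_str G K I J x = (case (K, I, J) of
       (IZ \<gamma>, IZ \<alpha>, IZ \<beta>) \<Rightarrow> str G \<gamma> \<alpha> \<beta> (zpart x)
     | (IZbar \<gamma>, IZbar \<alpha>, IZbar \<beta>) \<Rightarrow> cnj (str G \<gamma> \<alpha> \<beta> (zpart x))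
     | _ \<Rightarrow> 0)"

text \<open>The extension of the frame brackets to all sections by the Leibniz rule.\<close>

definition bracket :: "('n::finite, 'm::finite) local_data \<Rightarrow>
    ('n, 'm) sec \<Rightarrow> ('n, 'm) sec \<Rightarrow> ('n, 'm) sec" where
  "bracket G Y Z x = (\<chi> K. sec_act G Y (\<lambda>y. Z y $ K) x - sec_act G Z (\<lambda>y. Y y $ K) x
     + (\<Sum>I\<in>UNIV. \<Sum>J\<in>UNIV. Y x $ I * Z x $ J * frame_str G K I J x))"

definition Xframe :: "('n::finite, 'm::finite) local_data \<Rightarrow> 'm \<Rightarrow> ('n, 'm) sec" where
  "Xframe G \<alpha> x = axis (IZ \<alpha>) 1 - (\<Sum>\<beta>\<in>UNIV. Ncoef G \<beta> \<alpha> x *s axis (IV \<beta>) 1)"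

definition Vframe :: "'m \<Rightarrow> ('n::finite, 'm::finite) sec" where
  "Vframe \<alpha> x = axis (IV \<alpha>) 1"

text \<open>The coframe dual to the adapted frame; \<open>coZ \<alpha>\<close>, \<open>coV \<alpha>\<close> are \<open>\<Z>\<^sup>\<alpha>\<close>, \<open>\<delta>\<V>\<^sup>\<alpha>\<close>.\<close>

definition coZ :: "'m \<Rightarrow> 'm::finite tvec \<Rightarrow> complex" where
  "coZ \<alpha> Y = Y $ IZ \<alpha>"

definition coZ_bar :: "'m \<Rightarrow> 'm::finite tvec \<Rightarrow> complex" where
  "coZ_bar \<alpha> Y = Y $ IZbar \<alpha>"

definition coV :: "('n::finite, 'm::finite) local_data \<Rightarrow> complex^('n + 'm) \<Rightarrow> 'm \<Rightarrow> 'm tvec \<Rightarrow> complex" where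
  "coV G x \<alpha> Y = Y $ IV \<alpha> + (\<Sum>\<beta>\<in>UNIV. Ncoef G \<alpha> \<beta> x * Y $ IZ \<beta>)"

definition coV_bar :: "('n::finite, 'm::finite) local_data \<Rightarrow> complex^('n + 'm) \<Rightarrow> 'm \<Rightarrow> 'm tvec \<Rightarrow> complex" where
  "coV_bar G x \<alpha> Y = Y $ IVbar \<alpha> + (\<Sum>\<beta>\<in>UNIV. cnj (Ncoef G \<alpha> \<beta> x) * Y $ IZbar \<beta>)"


section \<open>Volume form, divergence, gradient, Laplace operators\<close>

definition wedge11 :: "('v \<Rightarrow> complex) \<Rightarrow> ('v \<Rightarrow> complex) \<Rightarrow> 'v \<Rightarrow> 'v \<Rightarrow> complex" where
  "wedge11 \<omega> \<eta> X Y = \<omega> X * \<eta> Y - \<omega> Y * \<eta> X"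

text \<open>The \<open>k\<close>-fold wedge power of a 2-form \<open>\<omega>\<close>, evaluated on \<open>Y 0, \<dots>, Y (2 * k - 1)\<close>, in the
  convention of \<open>wedge11\<close>: the wedge of \<open>p\<close>- and \<open>q\<close>-forms is the signed sum over all
  permutations divided by \<open>p! q!\<close>.\<close>

definition wedge_power :: "nat \<Rightarrow> ('v \<Rightarrow> 'v \<Rightarrow> complex) \<Rightarrow> (nat \<Rightarrow> 'v) \<Rightarrow> complex" where
  "wedge_power k \<omega> Y = (\<Sum>\<sigma> | \<sigma> permutes {..<2*k}.
     of_int (sign \<sigma>) * (\<Prod>i<k. \<omega> (Y (\<sigma> (2*i))) (Y (\<sigma> (2*i+1))))) / 2 ^ k"

definition Phi :: "('n::finite, 'm::finite) local_data \<Rightarrow> complex^('n + 'm) \<Rightarrow> 'm tvec \<Rightarrow> 'm tvec \<Rightarrow> complex" where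
  "Phi G x X Y = \<i> * (\<Sum>\<alpha>\<in>UNIV. \<Sum>\<beta>\<in>UNIV. hmat G x $ \<alpha> $ \<beta> *
     (wedge11 (coZ \<alpha>) (coZ_bar \<beta>) X Y + wedge11 (coV G x \<alpha>) (coV_bar G x \<beta>) X Y))"

definition volume_form :: "('n::finite, 'm::finite) local_data \<Rightarrow> complex^('n + 'm) \<Rightarrow> (nat \<Rightarrow> 'm tvec) \<Rightarrow> complex" where
  "volume_form G x Y = wedge_power (2 * CARD('m)) (Phi G x) Y / fact (2 * CARD('m))"

definition lie_derivative :: "('n::finite, 'm::finite) local_data \<Rightarrow> ('n, 'm) sec \<Rightarrow>
    (complex^('n + 'm) \<Rightarrow> (nat \<Rightarrow> 'm tvec) \<Rightarrow> complex) \<Rightarrow> (nat \<Rightarrow> ('n, 'm) sec) \<Rightarrow>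
    complex^('n + 'm) \<Rightarrow> complex" where
  "lie_derivative G Z \<omega> Y x = sec_act G Z (\<lambda>y. \<omega> y (\<lambda>i. Y i y)) x
     - (\<Sum>i<4 * CARD('m). \<omega> x ((\<lambda>j. Y j x)(i := bracket G Z (Y i) x)))"

definition divergence :: "('n::finite, 'm::finite) local_data \<Rightarrow> ('n, 'm) sec \<Rightarrow> complex^('n + 'm) \<Rightarrow> complex" where
  "divergence G Z x = (THE d. \<forall>Y. (\<forall>i<4 * CARD('m). smooth_on (slit G) (Y i)) \<longrightarrow>
     lie_derivative G Z (volume_form G) Y x = d * volume_form G x (\<lambda>i. Y i x))"

definition hor_divergence :: "('n::finite, 'm::finite) local_data \<Rightarrow> ('n, 'm) sec \<Rightarrow> complex^('n + 'm) \<Rightarrow> complex" where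
  "hor_divergence G Z = divergence G (\<lambda>x. \<Sum>\<alpha>\<in>UNIV. coZ \<alpha> (Z x) *s Xframe G \<alpha> x)"

definition ver_divergence :: "('n::finite, 'm::finite) local_data \<Rightarrow> ('n, 'm) sec \<Rightarrow> complex^('n + 'm) \<Rightarrow> complex" where
  "ver_divergence G Z = divergence G (\<lambda>x. \<Sum>\<alpha>\<in>UNIV. coV G x \<alpha> (Z x) *s Vframe \<alpha> x)"

definition hor_grad :: "('n::finite, 'm::finite) local_data \<Rightarrow> (complex^('n + 'm) \<Rightarrow> complex) \<Rightarrow> ('n, 'm) sec" where
  "hor_grad G f x = (\<Sum>\<alpha>\<in>UNIV. (\<Sum>\<gamma>\<in>UNIV. hinv G x $ \<gamma> $ \<alpha> * delta_bar G \<gamma> f x) *s Xframe G \<alpha> x)"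

definition ver_grad :: "('n::finite, 'm::finite) local_data \<Rightarrow> (complex^('n + 'm) \<Rightarrow> complex) \<Rightarrow> ('n, 'm) sec" where
  "ver_grad G f x = (\<Sum>\<alpha>\<in>UNIV. (\<Sum>\<gamma>\<in>UNIV. hinv G x $ \<gamma> $ \<alpha> * d_fib_bar \<gamma> f x) *s Vframe \<alpha> x)"

definition hor_laplacian :: "('n::finite, 'm::finite) local_data \<Rightarrow> (complex^('n + 'm) \<Rightarrow> complex) \<Rightarrow>
    complex^('n + 'm) \<Rightarrow> complex" where
  "hor_laplacian G f = hor_divergence G (hor_grad G f)"

definition ver_laplacian :: "('n::finite, 'm::finite) local_data \<Rightarrow> (complex^('n + 'm) \<Rightarrow> complex) \<Rightarrow>
    complex^('n + 'm) \<Rightarrow> complex" where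
  "ver_laplacian G f = ver_divergence G (ver_grad G f)"

end

theory Submission
  imports Defs
begin

text \<open>
  Everything happens in one bundle chart.  The coframe of \<open>Phi\<close> arises from the coframe dual to
  \<open>\<Z>\<^sub>\<alpha>, \<V>\<^sub>\<alpha>\<close> by a shear with coefficients \<open>N\<^sup>\<beta>\<^sub>\<alpha>\<close>, which has determinant 1; absorbing \<open>h\<close> into the
  barred covectors makes \<open>Phi\<close> \<open>\<i>\<close> times a standard symplectic form.  A top wedge power of a bilinear
  form is its value on a basis times a determinant (\<open>wedge_power_bilinear_eq_det\<close>), and on a
  symplectic basis that value does not vanish, so that the volume form is a nonzero constant times
  \<open>h\<^sup>2 det Y\<close> (\<open>volume_form_eq_det\<close>).

  The Leibniz rule for the determinant then turns the Lie derivative into a trace, and for a section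
  \<open>Z\<close> with components \<open>Z\<^sup>K\<close> in the frame with structure functions \<open>f\<close> (\<open>divergence_eq\<close>)
  \<open>div Z = 2 Z(h)/h + \<Sum>\<^sub>K K(Z\<^sup>K) - \<Sum>\<^sub>I\<^sub>K Z\<^sup>I f\<^sup>K\<^sub>I\<^sub>K\<close>,
  where \<open>K\<close> acts on functions through the anchor.

  For \<open>Z = w\<^sup>\<alpha> \<X>\<^sub>\<alpha>\<close> the middle term is \<open>\<delta>\<^sub>\<alpha> w\<^sup>\<alpha>\<close> minus \<open>w\<^sup>\<alpha>\<close> times the sum over \<open>\<beta>\<close> of the
  \<open>u\<^sup>\<beta>\<close>-derivatives of \<open>N\<^sup>\<beta>\<^sub>\<alpha>\<close>.  That sum equals \<open>\<delta>\<^sub>\<alpha> h / h\<close> (\<open>sum_d_fib_Ncoef\<close>): differentiate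
  the defining relation of \<open>N\<close> along the fibre, commute derivatives, and apply Jacobi's formula
  \<open>D h = h tr(H\<^sup>-\<^sup>1 D H)\<close> for the matrix \<open>H\<close> of \<open>h\<^sub>\<alpha>\<^sub>\<beta>\<close>-bar.  It cancels one of the two copies of
  \<open>w\<^sup>\<alpha> \<delta>\<^sub>\<alpha> h / h\<close>, and the remaining one combines with \<open>\<delta>\<^sub>\<alpha> w\<^sup>\<alpha>\<close> to \<open>\<delta>\<^sub>\<alpha> (h w\<^sup>\<alpha>) / h\<close>.  For
  \<open>Z = w\<^sup>\<alpha> \<V>\<^sub>\<alpha>\<close> nothing cancels: both copies remain, and by Jacobi's formula and the symmetry of
  the vertical coefficients the second one is \<open>w\<^sup>\<alpha> C\<^sub>\<alpha>\<close>.  The gradients are the sections of these two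
  kinds with \<open>w\<^sup>\<alpha>\<close> equal to \<open>h\<close>-raised derivatives of the function.
\<close>

section \<open>Determinants\<close>

text \<open>Infinitesimally, the determinant changes by the trace.  In the Leibniz expansion the factor
  \<open>A\<^sub>J\<^sub>K\<close> multiplies the determinant of \<open>M\<close> with column \<open>K\<close> replaced by column \<open>J\<close>, which has two
  equal columns unless \<open>J = K\<close>.  Both the Lie derivative of the volume form and Jacobi's formula
  for the derivative of a determinant are instances of this identity.\<close>

lemma sum_det_replace_row:
  fixes M A :: "'a::comm_ring_1^'n^'n"
  shows "(\<Sum>i\<in>UNIV. det (\<chi> r. if r = i then (M ** A) $ r else M $ r)) = trace A * det M"
proof -
  have repl: "det (\<chi> r c. if c = K then M $ r $ J else M $ r $ c) = (if J = K then det M else 0)"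
    for J K :: 'n
  proof (cases "J = K")
    case True
    then have "(\<chi> r c. if c = K then M $ r $ J else M $ r $ c) = M" by (simp add: vec_eq_iff)
    with True show ?thesis by simp
  next
    case False
    then have "det (\<chi> r c. if c = K then M $ r $ J else M $ r $ c) = 0"
      by (intro det_identical_columns[of J K]) (auto simp: column_def vec_eq_iff)
    with False show ?thesis by simp
  qed
  have row: "det (\<chi> r. if r = i then (M ** A) $ r else M $ r) =
      (\<Sum>p | p permutes UNIV. \<Sum>J\<in>UNIV. of_int (sign p) * (A $ J $ p i *
         (\<Prod>r\<in>UNIV. if p r = p i then M $ r $ J else M $ r $ p r)))" for i
  proof -
    have "of_int (sign p) * (\<Prod>r\<in>UNIV. (\<chi> r. if r = i then (M ** A) $ r else M $ r) $ r $ p r)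
       = (\<Sum>J\<in>UNIV. of_int (sign p) * (A $ J $ p i *
         (\<Prod>r\<in>UNIV. if p r = p i then M $ r $ J else M $ r $ p r)))" if p: "p permutes UNIV" for p
    proof -
      have inj: "p r = p i \<longleftrightarrow> r = i" for r
        using permutes_inj[OF p] by (simp add: inj_eq)
      have spl: "(\<Prod>r\<in>UNIV. if r = i then f else g r) = f * prod g (UNIV - {i})"
        for f :: 'a and g
        by (subst prod.remove[of _ i]) (auto intro!: prod.cong)
      have "(\<Prod>r\<in>UNIV. (\<chi> r. if r = i then (M ** A) $ r else M $ r) $ r $ p r)
          = (\<Prod>r\<in>UNIV. if r = i then (M ** A) $ i $ p i else M $ r $ p r)"
        by (rule prod.cong) auto
      also have "\<dots> = (\<Sum>J\<in>UNIV. A $ J $ p i * (M $ i $ J * (\<Prod>r\<in>UNIV - {i}. M $ r $ p r)))"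
        by (simp add: spl matrix_matrix_mult_def sum_distrib_left mult_ac)
      also have "\<dots> = (\<Sum>J\<in>UNIV. A $ J $ p i * (\<Prod>r\<in>UNIV. if p r = p i then M $ r $ J else M $ r $ p r))"
      proof (rule sum.cong[OF refl])
        fix J
        have "(\<Prod>r\<in>UNIV. if p r = p i then M $ r $ J else M $ r $ p r)
            = (\<Prod>r\<in>UNIV. if r = i then M $ i $ J else M $ r $ p r)"
          by (rule prod.cong) (auto simp: inj)
        then show "A $ J $ p i * (M $ i $ J * (\<Prod>r\<in>UNIV - {i}. M $ r $ p r))
            = A $ J $ p i * (\<Prod>r\<in>UNIV. if p r = p i then M $ r $ J else M $ r $ p r)"
          by (simp add: spl)
      qed
      finally show ?thesis by (simp add: sum_distrib_left)
    qed
    then show ?thesis unfolding det_def by (intro sum.cong) auto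
  qed
  have "(\<Sum>i\<in>UNIV. det (\<chi> r. if r = i then (M ** A) $ r else M $ r)) =
      (\<Sum>p | p permutes UNIV. \<Sum>i\<in>UNIV. \<Sum>J\<in>UNIV. of_int (sign p) * (A $ J $ p i *
         (\<Prod>r\<in>UNIV. if p r = p i then M $ r $ J else M $ r $ p r)))"
    unfolding row by (rule sum.swap)
  also have "\<dots> = (\<Sum>p | p permutes UNIV. \<Sum>K\<in>UNIV. \<Sum>J\<in>UNIV. of_int (sign p) * (A $ J $ K *
         (\<Prod>r\<in>UNIV. if p r = K then M $ r $ J else M $ r $ p r)))"
    by (intro sum.cong refl
          sum.reindex_bij_betw[where g = "\<lambda>K. \<Sum>J\<in>UNIV. of_int (sign _) * (A $ J $ K * _ J K)"])
       (use permutes_imp_bij in auto)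
  also have "\<dots> = (\<Sum>K\<in>UNIV. \<Sum>J\<in>UNIV. A $ J $ K * 
       det (\<chi> r c. if c = K then M $ r $ J else M $ r $ c))"
    unfolding det_def sum_distrib_left
    by (subst sum.swap, intro sum.cong refl, subst sum.swap, intro sum.cong refl)
      (simp add: mult_ac)
  also have "\<dots> = trace A * det M"
    by (simp add: repl trace_def sum_distrib_right if_distrib cong: if_cong)
  finally show ?thesis .
qed

text \<open>A permutation contributing to the Leibniz expansion fixes every index outside \<open>S\<close>, and cannot
  send an index of \<open>S\<close> to one of these fixed indices.\<close>

lemma det_unipotent:
  fixes M :: "'a::comm_ring_1^'n^'n"
  assumes diag: "\<And>i. M $ i $ i = 1"
    and off: "\<And>i j. i \<noteq> j \<Longrightarrow> M $ i $ j \<noteq> 0 \<Longrightarrow> i \<in> S \<and> j \<notin> S"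
  shows "det M = 1"
proof -
  have "(\<Prod>i\<in>UNIV. M $ i $ p i) = 0" if p: "p permutes UNIV" "p \<noteq> id" for p
  proof (rule ccontr)
    assume "(\<Prod>i\<in>UNIV. M $ i $ p i) \<noteq> 0"
    then have nz: "M $ i $ p i \<noteq> 0" for i by (metis UNIV_I finite prod_zero)
    have "p i = i" for i
    proof (rule ccontr)
      assume "p i \<noteq> i"
      moreover from this have "p (p i) \<noteq> p i" using permutes_inj[OF p(1)] by (simp add: inj_eq)
      ultimately show False using off nz by metis
    qed
    with p(2) show False by auto
  qed
  then have "det M = (\<Sum>p\<in>{id}. of_int (sign p) * (\<Prod>i\<in>UNIV. M $ i $ p i))"
    unfolding det_def by (intro sum.mono_neutral_right) (auto simp: permutes_id)
  then show ?thesis by (simp add: diag)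
qed

lemma det_embedded_block:
  fixes h :: "'a::comm_ring_1^'m^'m" and M :: "'a^'n^'n"
  assumes inj: "inj f"
    and block: "\<And>a b. M $ f a $ f b = h $ a $ b"
    and id: "\<And>i j. i \<notin> range f \<Longrightarrow> M $ i $ j = (if i = j then 1 else 0)"
  shows "det M = det h"
proof -
  have bij: "bij_betw f UNIV (range f)" using inj by (simp add: bij_betw_def)
  have "det M = (\<Sum>p | p permutes range f. of_int (sign p) * (\<Prod>i\<in>UNIV. M $ i $ p i))"
    unfolding det_def
  proof (rule sum.mono_neutral_right)
    show "{p. p permutes range f} \<subseteq> {p. p permutes (UNIV :: 'n set)}"
      by (auto intro: permutes_subset)
    show "\<forall>p\<in>{p. p permutes UNIV} - {p. p permutes range f}.
        of_int (sign p) * (\<Prod>i\<in>UNIV. M $ i $ p i) = 0"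
    proof
      fix p :: "'n \<Rightarrow> 'n" assume "p \<in> {p. p permutes UNIV} - {p. p permutes range f}"
      then have "p permutes UNIV" "\<not> p permutes range f" by auto
      then obtain i where "i \<notin> range f" "p i \<noteq> i" unfolding permutes_def by blast
      then have "M $ i $ p i = 0" using id by simp
      then have "(\<Prod>i\<in>UNIV. M $ i $ p i) = 0" by (intro prod_zero) auto
      then show "of_int (sign p) * (\<Prod>i\<in>UNIV. M $ i $ p i) = 0" by simp
    qed
  qed simp
  also have "\<dots> = (\<Sum>q | q permutes UNIV. of_int (sign q) * (\<Prod>a\<in>UNIV. h $ a $ q a))"
  proof (rule sum.reindex_bij_witness[of _ "map_permutation UNIV f" "map_permutation (range f) (inv f)"])
    fix q :: "'m \<Rightarrow> 'm" assume "q \<in> {q. q permutes UNIV}"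
    then show "map_permutation UNIV f q \<in> {p. p permutes range f}"
      "map_permutation (range f) (inv f) (map_permutation UNIV f q) = q"
      using map_permutation_permutes[OF bij] map_permutation_compose_inv[OF bij] inj by auto
  next
    fix p assume "p \<in> {p. p permutes range f}"
    then have p: "p permutes range f" by simp
    have bij': "bij_betw (inv f) (range f) UNIV" using inj by (simp add: bij_betw_inv_into bij)
    define q where "q = map_permutation (range f) (inv f) p"
    have q: "q permutes UNIV" unfolding q_def using map_permutation_permutes[OF bij'] p by auto
    show "map_permutation (range f) (inv f) p \<in> {q. q permutes UNIV}" using q q_def by simp
    show inv: "map_permutation UNIV f (map_permutation (range f) (inv f) p) = p"
      by (rule map_permutation_compose_inv[OF bij' p]) (auto simp: f_inv_into_f)
    have s: "sign q = sign p" unfolding q_def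
      by (rule sign_map_permutation) (use p inj in \<open>auto simp: inj_on_inv_into\<close>)
    have pf: "p (f a) = f (q a)" for a
      using inv map_permutation_apply[OF inj, of a q] unfolding q_def by simp
    have "(\<Prod>i\<in>UNIV. M $ i $ p i) = (\<Prod>i\<in>range f. M $ i $ p i)"
      by (rule prod.mono_neutral_right) (use p id in \<open>auto simp: permutes_not_in\<close>)
    also have "\<dots> = (\<Prod>a\<in>UNIV. h $ a $ q a)"
      by (simp add: prod.reindex inj pf block)
    finally show "of_int (sign (map_permutation (range f) (inv f) p)) *
        (\<Prod>a\<in>UNIV. h $ a $ map_permutation (range f) (inv f) p a)
        = of_int (sign p) * (\<Prod>i\<in>UNIV. M $ i $ p i)"
      using s q_def by simp
  qed
  finally show ?thesis by (simp add: det_def)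
qed

section \<open>Top wedge powers of 2-forms\<close>

text \<open>\<open>wedge_power\<close> sums over permutations of an initial segment of the naturals, while the vectors
  are indexed by a finite type; an enumeration of the type carries one sum into the other.\<close>

lemma sum_permutes_nat_eq_det:
  fixes A :: "nat \<Rightarrow> nat \<Rightarrow> 'a::comm_ring_1" and enc :: "'n::finite \<Rightarrow> nat"
  assumes bij: "bij_betw enc UNIV {..<n}"
  shows "(\<Sum>\<sigma> | \<sigma> permutes {..<n}. of_int (sign \<sigma>) * (\<Prod>j<n. A (\<sigma> j) j))
     = det (\<chi> I J. A (enc I) (enc J))"
proof -
  define dec where "dec = inv enc"
  have inj: "inj enc" and ran: "range enc = {..<n}" using bij by (auto simp: bij_betw_def)
  have bij': "bij_betw dec {..<n} UNIV" using bij_betw_inv_into[OF bij] by (simp add: dec_def)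
  have "(\<Sum>\<sigma> | \<sigma> permutes {..<n}. of_int (sign \<sigma>) * (\<Prod>j<n. A (\<sigma> j) j))
     = (\<Sum>p | p permutes UNIV. of_int (sign p) * (\<Prod>I\<in>UNIV. A (enc (p I)) (enc I)))"
  proof (rule sum.reindex_bij_witness[of _ "map_permutation UNIV enc" "map_permutation {..<n} dec"])
    fix p :: "'n \<Rightarrow> 'n" assume "p \<in> {p. p permutes UNIV}"
    then show "map_permutation UNIV enc p \<in> {p. p permutes {..<n}}"
      "map_permutation {..<n} dec (map_permutation UNIV enc p) = p"
      using map_permutation_permutes[OF bij] map_permutation_compose_inv[OF bij] inj
      by (auto simp: dec_def)
  next
    fix \<sigma> assume "\<sigma> \<in> {p. p permutes {..<n}}"
    then have p: "\<sigma> permutes {..<n}" by simp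
    define q where "q = map_permutation {..<n} dec \<sigma>"
    have q: "q permutes UNIV" unfolding q_def using map_permutation_permutes[OF bij'] p by auto
    show "map_permutation {..<n} dec \<sigma> \<in> {p. p permutes UNIV}" using q q_def by simp
    show inv: "map_permutation UNIV enc (map_permutation {..<n} dec \<sigma>) = \<sigma>"
      by (rule map_permutation_compose_inv[OF bij' p])
        (use bij in \<open>auto simp: dec_def ran f_inv_into_f\<close>)
    have s: "sign q = sign \<sigma>" unfolding q_def
      by (rule sign_map_permutation) (use p bij' in \<open>auto simp: bij_betw_def\<close>)
    have pf: "\<sigma> (enc a) = enc (q a)" for a
      using inv map_permutation_apply[OF inj, of a q] unfolding q_def by simp
    have "(\<Prod>j<n. A (\<sigma> j) j) = (\<Prod>I\<in>UNIV. A (enc (q I)) (enc I))"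
      by (simp add: prod.reindex inj pf flip: ran)
    then show "of_int (sign (map_permutation {..<n} dec \<sigma>)) *
        (\<Prod>I\<in>UNIV. A (enc (map_permutation {..<n} dec \<sigma> I)) (enc I))
        = of_int (sign \<sigma>) * (\<Prod>j<n. A (\<sigma> j) j)"
      using s q_def by simp
  qed
  also have "\<dots> = det (transpose (\<chi> I J. A (enc I) (enc J)))"
    by (simp add: det_def Finite_Cartesian_Product.transpose_def)
  finally show ?thesis by simp
qed

lemma prod_pairs: "(\<Prod>j<2*(k::nat). g j) = (\<Prod>i<k. g (2*i) * g (2*i+1) :: 'a::comm_monoid_mult)"
  by (induction k) (simp_all add: mult.assoc)

text \<open>Expanding the product: a choice of a pair \<open>(a, b)\<close> for each of the \<open>k\<close> factors is the same as
  a function \<open>f\<close> on the \<open>2 k\<close> slots.\<close>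

lemma prod_double_sum_eq_sum_PiE:
  fixes s :: "nat \<Rightarrow> nat \<Rightarrow> 'a::comm_semiring_1" and k n :: nat
  shows "(\<Prod>i<k. \<Sum>a<n. \<Sum>b<n. s a b * (u (2*i) a * u (2*i+1) b))
    = (\<Sum>f\<in>{..<2*k} \<rightarrow>\<^sub>E {..<n}. (\<Prod>i<k. s (f (2*i)) (f (2*i+1))) * (\<Prod>j<2*k. u j (f j)))"
proof -
  let ?g = "\<lambda>i (a, b). s a b * (u (2*i) a * u (2*i+1) b)"
  have "(\<Prod>i<k. \<Sum>a<n. \<Sum>b<n. s a b * (u (2*i) a * u (2*i+1) b))
      = (\<Prod>i<k. \<Sum>c\<in>{..<n} \<times> {..<n}. ?g i c)"
    by (simp add: sum.cartesian_product)
  also have "\<dots> = (\<Sum>c\<in>{..<k} \<rightarrow>\<^sub>E {..<n} \<times> {..<n}. \<Prod>i<k. ?g i (c i))"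
    by (rule prod_sum_PiE) simp_all
  also have "\<dots> = (\<Sum>f\<in>{..<2*k} \<rightarrow>\<^sub>E {..<n}. (\<Prod>i<k. s (f (2*i)) (f (2*i+1))) * (\<Prod>j<2*k. u j (f j)))"
  proof (rule sum.reindex_bij_witness[of _ "\<lambda>f. \<lambda>i\<in>{..<k}. (f (2*i), f (2*i+1))"
        "\<lambda>c. \<lambda>j\<in>{..<2*k}. if even j then fst (c (j div 2)) else snd (c (j div 2))"])
    fix c assume c: "c \<in> {..<k} \<rightarrow>\<^sub>E {..<n} \<times> {..<n}"
    let ?f = "\<lambda>j\<in>{..<2*k}. if even j then fst (c (j div 2)) else snd (c (j div 2))"
    show "(\<lambda>i\<in>{..<k}. (?f (2*i), ?f (2*i+1))) = c"
      using c by (auto simp: fun_eq_iff PiE_def extensional_def)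
    have cc: "c (j div 2) \<in> {..<n} \<times> {..<n}" if "j < 2*k" for j
      using c that by (auto simp: PiE_def Pi_def less_mult_imp_div_less)
    then show "?f \<in> {..<2*k} \<rightarrow>\<^sub>E {..<n}" by (auto simp: PiE_def mem_Times_iff)
    show "(\<Prod>i<k. s (?f (2*i)) (?f (2*i+1))) * (\<Prod>j<2*k. u j (?f j)) = (\<Prod>i<k. ?g i (c i))"
      unfolding prod_pairs prod.distrib[symmetric]
      by (rule prod.cong) (auto simp: case_prod_beta)
  next
    fix f assume f: "f \<in> {..<2*k} \<rightarrow>\<^sub>E {..<n}"
    show "(\<lambda>i\<in>{..<k}. (f (2*i), f (2*i+1))) \<in> {..<k} \<rightarrow>\<^sub>E {..<n} \<times> {..<n}"
      using f by (auto simp: PiE_def Pi_def)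
    let ?c = "\<lambda>i\<in>{..<k}. (f (2*i), f (2*i+1))"
    show "(\<lambda>j\<in>{..<2*k}. if even j then fst (?c (j div 2)) else snd (?c (j div 2))) = f"
    proof
      fix j
      have "j div 2 < k" if "j < 2*k" using that by (simp add: less_mult_imp_div_less)
      moreover have "f (Suc (2 * (j div 2))) = f j" if "odd j" using that by simp
      ultimately show "(\<lambda>j\<in>{..<2*k}. if even j then fst (?c (j div 2)) else snd (?c (j div 2))) j = f j"
        using f by (auto simp: PiE_def extensional_def)
    qed
  qed
  finally show ?thesis .
qed

lemma sum_PiE_injective_eq_sum_permutes:
  assumes "\<And>f. f \<in> {..<n::nat} \<rightarrow>\<^sub>E {..<n} \<Longrightarrow> \<not> inj_on f {..<n} \<Longrightarrow> g f = 0"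
    and "\<And>f f'. (\<And>j. j < n \<Longrightarrow> f j = f' j) \<Longrightarrow> g f = g f'"
  shows "(\<Sum>f\<in>{..<n} \<rightarrow>\<^sub>E {..<n}. g f) = (\<Sum>p | p permutes {..<n}. g p :: 'a::comm_monoid_add)"
proof -
  have "(\<Sum>f\<in>{..<n} \<rightarrow>\<^sub>E {..<n}. g f) = (\<Sum>f\<in>{f \<in> {..<n} \<rightarrow>\<^sub>E {..<n}. inj_on f {..<n}}. g f)"
    by (rule sum.mono_neutral_right) (use assms(1) in \<open>auto intro: finite_PiE\<close>)
  also have "\<dots> = (\<Sum>p | p permutes {..<n}. g p)"
  proof (rule sum.reindex_bij_witness[of _ "\<lambda>p. restrict p {..<n}" "\<lambda>f j. if j < n then f j else j"])
    fix f assume f: "f \<in> {f \<in> {..<n} \<rightarrow>\<^sub>E {..<n}. inj_on f {..<n}}"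
    show "restrict (\<lambda>j. if j < n then f j else j) {..<n} = f"
      using f by (auto simp: PiE_def extensional_def restrict_def fun_eq_iff)
    have "bij_betw f {..<n} {..<n}"
      using f endo_inj_surj[of "{..<n}" f] by (auto simp: bij_betw_def)
    then have "bij_betw (\<lambda>j. if j < n then f j else j) {..<n} {..<n}"
      by (rule bij_betw_cong[THEN iffD1, rotated]) simp
    then have "(\<lambda>j. if j < n then f j else j) permutes {..<n}"
      by (rule bij_imp_permutes) simp
    then show "(\<lambda>j. if j < n then f j else j) \<in> {p. p permutes {..<n}}" by simp
    show "g (\<lambda>j. if j < n then f j else j) = g f" by (rule assms(2)) simp
  next
    fix p assume "p \<in> {p. p permutes {..<n}}"
    then have p: "p permutes {..<n}" by simp
    show "(\<lambda>j. if j < n then restrict p {..<n} j else j) = p"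
      using permutes_not_in[OF p] by (auto simp: fun_eq_iff)
    show "restrict p {..<n} \<in> {f \<in> {..<n} \<rightarrow>\<^sub>E {..<n}. inj_on f {..<n}}"
      using permutes_in_image[OF p] permutes_inj_on[OF p, of "{..<n}"] by (auto simp: inj_on_def)
  qed
  finally show ?thesis .
qed

text \<open>The uniqueness of top-degree forms, in coordinates.  After expansion, each choice \<open>f\<close> of
  coordinates for the slots contributes a coefficient \<open>P f\<close> times the determinant of the columns
  selected by \<open>f\<close>.  It vanishes if a column is repeated and is \<open>\<plusminus> det Y\<close> otherwise, so that
  \<open>det Y\<close> factors out; comparison with \<open>Y\<close> the standard basis identifies the other factor.\<close>

lemma wedge_power_bilinear_eq_det:
  fixes W :: "complex^'n^'n" and Y :: "nat \<Rightarrow> complex^'n" and enc :: "'n \<Rightarrow> nat"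
  assumes bij: "bij_betw enc UNIV {..<2*k}"
    and \<omega>: "\<And>X Z. \<omega> X Z = (\<Sum>a\<in>UNIV. \<Sum>b\<in>UNIV. W $ a $ b * (X $ a * Z $ b))"
  shows "wedge_power k \<omega> Y = det (\<chi> I. Y (enc I)) * wedge_power k \<omega> (\<lambda>i. axis (inv enc i) 1)"
proof -
  define n where "n = 2 * k"
  define dec where "dec = inv enc"
  define s where "s a b = W $ dec a $ dec b" for a b
  define P where "P f = (\<Prod>i<k. s (f (2*i)) (f (2*i+1)))" for f :: "nat \<Rightarrow> nat"
  define M where "M = (\<chi> I. Y (enc I))"
  have bn: "bij_betw enc UNIV {..<n}" using bij n_def by simp
  have dec: "bij_betw dec {..<n} UNIV" using bij_betw_inv_into[OF bn] by (simp add: dec_def)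
  have de: "dec (enc I) = I" for I using bij by (simp add: dec_def bij_betw_def)
  have \<omega>': "\<omega> X Z = (\<Sum>a<n. \<Sum>b<n. s a b * (X $ dec a * Z $ dec b))" for X Z
    unfolding \<omega> s_def
    by (subst sum.reindex_bij_betw[OF dec, symmetric])+ (rule refl)
  have expand: "(\<Sum>\<sigma> | \<sigma> permutes {..<n}. of_int (sign \<sigma>) * (\<Prod>i<k. \<omega> (Y (\<sigma> (2*i))) (Y (\<sigma> (2*i+1)))))
     = (\<Sum>p | p permutes {..<n}. P p * det (\<chi> I J. Y (enc I) $ dec (p (enc J))))" for Y :: "nat \<Rightarrow> complex^'n"
  proof -
    have D: "(\<Sum>\<sigma> | \<sigma> permutes {..<n}. of_int (sign \<sigma>) * (\<Prod>j<n. Y (\<sigma> j) $ dec (f j)))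
       = det (\<chi> I J. Y (enc I) $ dec (f (enc J)))" for f :: "nat \<Rightarrow> nat"
      by (rule sum_permutes_nat_eq_det[OF bn])
    have "(\<Sum>\<sigma> | \<sigma> permutes {..<n}. of_int (sign \<sigma>) * (\<Prod>i<k. \<omega> (Y (\<sigma> (2*i))) (Y (\<sigma> (2*i+1)))))
      = (\<Sum>\<sigma> | \<sigma> permutes {..<n}. of_int (sign \<sigma>) *
          (\<Sum>f\<in>{..<n} \<rightarrow>\<^sub>E {..<n}. P f * (\<Prod>j<n. Y (\<sigma> j) $ dec (f j))))"
      unfolding \<omega>' P_def n_def
      by (subst prod_double_sum_eq_sum_PiE[where u = "\<lambda>j a. Y (_ j) $ dec a"]) (rule refl)
    also have "\<dots> = (\<Sum>f\<in>{..<n} \<rightarrow>\<^sub>E {..<n}. P f * (\<Sum>\<sigma> | \<sigma> permutes {..<n}.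
          of_int (sign \<sigma>) * (\<Prod>j<n. Y (\<sigma> j) $ dec (f j))))"
      unfolding sum_distrib_left by (subst sum.swap) (simp add: mult_ac)
    also have "\<dots> = (\<Sum>f\<in>{..<n} \<rightarrow>\<^sub>E {..<n}. P f * det (\<chi> I J. Y (enc I) $ dec (f (enc J))))"
      by (simp only: D)
    also have "\<dots> = (\<Sum>p | p permutes {..<n}. P p * det (\<chi> I J. Y (enc I) $ dec (p (enc J))))"
    proof (rule sum_PiE_injective_eq_sum_permutes)
      fix f :: "nat \<Rightarrow> nat" assume "\<not> inj_on f {..<n}"
      then obtain i j where ij: "i < n" "j < n" "i \<noteq> j" "f i = f j" by (auto simp: inj_on_def)
      have ed: "enc (dec a) = a" if "a < n" for a
        using that bn by (simp add: dec_def bij_betw_def f_inv_into_f)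
      have "dec i \<noteq> dec j" using ed ij by metis
      then have "det (\<chi> I J. Y (enc I) $ dec (f (enc J))) = 0"
        by (rule det_identical_columns) (use ij ed in \<open>simp add: column_def vec_eq_iff\<close>)
      then show "P f * det (\<chi> I J. Y (enc I) $ dec (f (enc J))) = 0" by simp
    next
      fix f f' :: "nat \<Rightarrow> nat" assume *: "\<And>j. j < n \<Longrightarrow> f j = f' j"
      have "enc J < n" for J using bn by (auto simp: bij_betw_def)
      moreover have "P f = P f'" unfolding P_def
        by (rule prod.cong) (use * in \<open>auto simp: n_def\<close>)
      ultimately show "P f * det (\<chi> I J. Y (enc I) $ dec (f (enc J)))
          = P f' * det (\<chi> I J. Y (enc I) $ dec (f' (enc J)))" using * by simp
    qed
    finally show ?thesis .
  qed
  have perm: "det (\<chi> I J. Y (enc I) $ dec (p (enc J))) = of_int (sign p) * det (\<chi> I. Y (enc I))"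
    if p: "p permutes {..<n}" for p and Y :: "nat \<Rightarrow> complex^'n"
  proof -
    define q where "q = map_permutation {..<n} dec p"
    have q: "q permutes UNIV" unfolding q_def using map_permutation_permutes[OF dec p] .
    have s: "sign q = sign p" unfolding q_def
      by (rule sign_map_permutation) (use p dec in \<open>auto simp: bij_betw_def\<close>)
    have "enc J < n" for J using bn by (auto simp: bij_betw_def)
    then have "dec (p (enc J)) = q J" for J
      unfolding q_def using map_permutation_apply[of dec "{..<n}" "enc J" p] dec
      by (simp add: bij_betw_def de)
    then have "det (\<chi> I J. Y (enc I) $ dec (p (enc J))) = det (\<chi> I J. (\<chi> I. Y (enc I)) $ I $ q J)"
      by simp
    also have "\<dots> = of_int (sign q) * det (\<chi> I. Y (enc I))"
      by (rule det_permute_columns[OF q])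
    finally show ?thesis by (simp add: s)
  qed
  have main: "wedge_power k \<omega> Y = det (\<chi> I. Y (enc I)) * ((\<Sum>p | p permutes {..<n}. P p * of_int (sign p)) / 2 ^ k)"
    for Y
    unfolding wedge_power_def n_def[symmetric] expand
    by (simp add: perm sum_distrib_left mult_ac)
  have "(\<chi> I. axis (dec (enc I)) 1) = (mat 1 :: complex^'n^'n)"
    by (simp add: de mat_def vec_eq_iff axis_def eq_commute)
  then have "wedge_power k \<omega> (\<lambda>i. axis (dec i) 1) = (\<Sum>p | p permutes {..<n}. P p * of_int (sign p)) / 2 ^ k"
    unfolding main by simp
  with main show ?thesis by (simp add: dec_def)
qed

text \<open>The Gram matrix of a symplectic basis ordered as \<open>e\<^sub>0, f\<^sub>0, e\<^sub>1, f\<^sub>1, \<dots>\<close>.\<close>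

definition symp :: "nat \<Rightarrow> nat \<Rightarrow> int" where
  "symp a b = (if a div 2 = b div 2 then int (b mod 2) - int (a mod 2) else 0)"

lemma symp_pair: "symp (2*k) (Suc (2*k)) = 1" "symp (Suc (2*k)) (2*k) = -1"
  by (simp_all add: symp_def)

lemma symp_swap_pairs:
  assumes "j \<noteq> k"
  defines "\<pi> \<equiv> Transposition.transpose (2*j) (2*k) \<circ> Transposition.transpose (2*j+1) (2*k+1)"
  shows "symp (\<pi> a) (\<pi> b) = symp a b" "sign \<pi> = 1"
proof -
  let ?t = "Transposition.transpose j k"
  have \<pi>: "\<pi> (2*c+r) = 2 * ?t c + r" if "r < 2" for c r
  proof -
    have "r = 0 \<or> r = 1" using that by linarith
    moreover have "2*p \<noteq> Suc (2*q)" "Suc (2*q) \<noteq> 2*p" for p q :: nat by presburger+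
    ultimately show ?thesis by (auto simp: \<pi>_def Transposition.transpose_def)
  qed
  have "\<pi> a div 2 = ?t (a div 2) \<and> \<pi> a mod 2 = a mod 2" for a
    using \<pi>[of "a mod 2" "a div 2"] by simp
  then show "symp (\<pi> a) (\<pi> b) = symp a b"
    unfolding symp_def by (simp add: inj_eq)
  show "sign \<pi> = 1" unfolding \<pi>_def using assms(1)
    by (simp add: sign_compose permutation_swap_id sign_swap_id)
qed

text \<open>All terms of the wedge power on a symplectic basis have the same sign.  In a nonzero term
  \<open>\<sigma>\<close> maps pairs to pairs.  Exchanging two whole pairs is an even permutation that preserves \<open>symp\<close>,
  and exchanging the two elements of one pair changes the sign of both \<open>\<sigma>\<close> and one factor.  Such
  moves, which preserve the term, make \<open>\<sigma>\<close> fix the last pair; then induct on the number of pairs.\<close>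

lemma signed_symp_product_nonneg:
  assumes "\<sigma> permutes {..<2*k}"
  shows "0 \<le> sign \<sigma> * (\<Prod>i<k. symp (\<sigma> (2*i)) (\<sigma> (2*i+1)))"
  using assms
proof (induction k arbitrary: \<sigma>)
  case 0
  then show ?case by simp
next
  case (Suc k)
  define T where "T \<sigma> = sign \<sigma> * (\<Prod>i<Suc k. symp (\<sigma> (2*i)) (\<sigma> (2*i+1)))" for \<sigma> :: "nat \<Rightarrow> nat"
  have fixed: "0 \<le> T \<sigma>" if \<sigma>: "\<sigma> permutes {..<2*Suc k}" "\<sigma> (2*k) = 2*k" "\<sigma> (2*k+1) = 2*k+1" for \<sigma>
  proof -
    have "\<sigma> permutes {..<2*k}"
    proof (rule permutes_superset[OF \<sigma>(1)])
      fix x assume "x \<in> {..<2*Suc k} - {..<2*k}"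
      then have "x = 2*k \<or> x = 2*k+1" by auto
      then show "\<sigma> x = x" using \<sigma> by auto
    qed
    from Suc.IH[OF this] show ?thesis using \<sigma> by (simp add: T_def symp_pair)
  qed
  have last: "0 \<le> T \<sigma>" if \<sigma>: "\<sigma> permutes {..<2*Suc k}" "{\<sigma> (2*k), \<sigma> (2*k+1)} = {2*k, 2*k+1}" for \<sigma>
  proof (cases "\<sigma> (2*k) = 2*k")
    case True
    then show ?thesis using \<sigma> fixed by (auto simp: doubleton_eq_iff)
  next
    case False
    let ?t = "Transposition.transpose (2*k) (2*k+1)"
    from False \<sigma>(2) have v: "\<sigma> (2*k) = 2*k+1" "\<sigma> (2*k+1) = 2*k" by (auto simp: doubleton_eq_iff)
    have t: "?t permutes {..<2*Suc k}" by (rule permutes_swap_id) auto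
    have p: "?t \<circ> \<sigma> permutes {..<2*Suc k}" by (rule permutes_compose[OF \<sigma>(1) t])
    have inj: "\<sigma> a = \<sigma> b \<longleftrightarrow> a = b" for a b using permutes_inj[OF \<sigma>(1)] by (simp add: inj_eq)
    have same: "?t (\<sigma> a) = \<sigma> a" if "a < 2*k" for a
    proof -
      have "\<sigma> a \<noteq> 2*k" "\<sigma> a \<noteq> 2*k+1" using that inj[of a "2*k"] inj[of a "2*k+1"] v by auto
      then show ?thesis by (simp add: Transposition.transpose_def)
    qed
    have sg: "sign (?t \<circ> \<sigma>) = - sign \<sigma>"
      using sign_compose[of ?t \<sigma>] t \<sigma>(1) sign_swap_id[of "2*k" "2*k+1"]
      by (metis add_eq_self_zero finite_lessThan mult_minus1 one_neq_zero permutation_permutes)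
    have "T (?t \<circ> \<sigma>) = T \<sigma>"
      using v by (simp add: T_def sg[simplified] same[simplified] symp_pair)
    moreover have "0 \<le> T (?t \<circ> \<sigma>)" by (rule fixed[OF p]) (simp_all only: comp_apply v transpose_apply_first transpose_apply_second)
    ultimately show ?thesis by simp
  qed
  have "0 \<le> T \<sigma>"
  proof (cases "symp (\<sigma> (2*k)) (\<sigma> (2*k+1)) = 0")
    case True
    then show ?thesis by (simp add: T_def)
  next
    case False
    let ?a = "\<sigma> (2*k)" and ?b = "\<sigma> (2*k+1)"
    define j where "j = ?a div 2"
    have pair: "a = 2*(a div 2) \<and> b = 2*(a div 2)+1 \<or> a = 2*(a div 2)+1 \<and> b = 2*(a div 2)"
      if "symp a b \<noteq> 0" for a b
    proof -
      from that have "a div 2 = b div 2" unfolding symp_def by metis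
      moreover from this that have "a mod 2 \<noteq> b mod 2" unfolding symp_def by (metis diff_self)
      moreover have "a = 2 * (a div 2) + a mod 2" "b = 2 * (b div 2) + b mod 2"
        "a mod 2 < 2" "b mod 2 < 2" by simp_all
      ultimately show ?thesis by linarith
    qed
    from pair[OF False] have "?a = 2*j \<and> ?b = 2*j+1 \<or> ?a = 2*j+1 \<and> ?b = 2*j"
      unfolding j_def .
    then have j: "{?a, ?b} = {2*j, 2*j+1}" by auto
    have "\<sigma> (2*k) < 2*Suc k" "\<sigma> (2*k+1) < 2*Suc k"
      using permutes_in_image[OF Suc.prems, of "2*k"] permutes_in_image[OF Suc.prems, of "2*k+1"] by auto
    with j have jk: "j \<le> k" by (auto simp: doubleton_eq_iff)
    show ?thesis
    proof (cases "j = k")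
      case True
      with j Suc.prems last show ?thesis by blast
    next
      case False
      define \<pi> where "\<pi> = Transposition.transpose (2*j) (2*k) \<circ> Transposition.transpose (2*j+1) (2*k+1)"
      note sp = symp_swap_pairs[OF False, folded \<pi>_def]
      have pp: "\<pi> permutes {..<2*Suc k}" unfolding \<pi>_def
        by (intro permutes_compose permutes_swap_id) (use jk in auto)
      then have p: "\<pi> \<circ> \<sigma> permutes {..<2*Suc k}" by (rule permutes_compose[OF Suc.prems])
      have sg: "sign (\<pi> \<circ> \<sigma>) = sign \<sigma>"
        using sign_compose[of \<pi> \<sigma>] pp Suc.prems sp(2)
        by (metis finite_lessThan mult_1 permutation_permutes)
      have \<pi>j: "\<pi> (2*j) = 2*k" "\<pi> (2*j+1) = 2*k+1"
        using False by (auto simp: \<pi>_def Transposition.transpose_def)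
      have "{(\<pi> \<circ> \<sigma>) (2*k), (\<pi> \<circ> \<sigma>) (2*k+1)} = \<pi> ` {\<sigma> (2*k), \<sigma> (2*k+1)}" by simp
      also have "\<dots> = {2*k, 2*k+1}" unfolding j using \<pi>j by simp
      finally have "0 \<le> T (\<pi> \<circ> \<sigma>)" by (rule last[OF p])
      moreover have "T (\<pi> \<circ> \<sigma>) = T \<sigma>" unfolding T_def sg by (simp only: comp_apply sp)
      ultimately show ?thesis by simp
    qed
  qed
  then show ?case by (simp add: T_def)
qed

text \<open>No term is negative and the identity contributes 1, so the terms cannot cancel.\<close>

lemma wedge_power_symplectic_basis_nonzero:
  assumes "\<And>i j. i < 2*k \<Longrightarrow> j < 2*k \<Longrightarrow> \<omega> (Y i) (Y j) = of_int (symp i j)"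
  shows "wedge_power k \<omega> Y \<noteq> 0"
proof -
  define T where "T \<sigma> = sign \<sigma> * (\<Prod>i<k. symp (\<sigma> (2*i)) (\<sigma> (2*i+1)))" for \<sigma> :: "nat \<Rightarrow> nat"
  have "wedge_power k \<omega> Y = of_int (\<Sum>\<sigma> | \<sigma> permutes {..<2*k}. T \<sigma>) / 2 ^ k"
  proof -
    have "(\<Prod>i<k. \<omega> (Y (\<sigma> (2*i))) (Y (\<sigma> (2*i+1)))) = (\<Prod>i<k. of_int (symp (\<sigma> (2*i)) (\<sigma> (2*i+1))))"
      if \<sigma>: "\<sigma> permutes {..<2*k}" for \<sigma>
      using permutes_in_image[OF \<sigma>] by (intro prod.cong refl assms) auto
    then show ?thesis unfolding wedge_power_def T_def by simp
  qed
  moreover have "(\<Sum>\<sigma> | \<sigma> permutes {..<2*k}. T \<sigma>) \<ge> T id"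
    by (rule member_le_sum)
      (use signed_symp_product_nonneg in \<open>auto simp: permutes_id T_def finite_permutations simp del: id_apply\<close>)
  moreover have "T id = 1" by (simp add: T_def symp_pair)
  ultimately show ?thesis by (simp del: of_int_sum)
qed

section \<open>Smooth functions\<close>

lemma Ck_on_cong:
  assumes "open S" "\<And>x. x \<in> S \<Longrightarrow> f x = g x"
  shows "Ck_on k f S \<longleftrightarrow> Ck_on k g S"
proof -
  have "Ck_on k g S" if "Ck_on k f S" "\<And>x. x \<in> S \<Longrightarrow> f x = g x" for f g
    using that
  proof (induction k arbitrary: f g)
    case 0
    then show ?case by (simp cong: continuous_on_cong)
  next
    case (Suc k)
    have df: "f differentiable (at x)" if "x \<in> S" for x using Suc.prems that by simp
    have fr: "frechet_derivative f (at x) = frechet_derivative g (at x)" if "x \<in> S" for x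
      by (rule frechet_derivative_transform_within_open[OF df[OF that] \<open>open S\<close> that]) (rule Suc.prems)
    have "g differentiable (at x)" if "x \<in> S" for x
      using df[OF that] has_derivative_transform_within_open[OF _ \<open>open S\<close> that, of f _ UNIV g] Suc.prems(2)
      unfolding differentiable_def by blast
    moreover have "Ck_on k (\<lambda>x. frechet_derivative g (at x) v) S" for v
      by (rule Suc.IH[of "\<lambda>x. frechet_derivative f (at x) v"]) (use Suc.prems fr in auto)
    ultimately show ?case by simp
  qed
  from this[of f g] this[of g f] assms show ?thesis by auto
qed

lemma frechet_derivative_bounded_linear_comp:
  assumes "bounded_linear L" "f differentiable (at x)"
  shows "frechet_derivative (\<lambda>y. L (f y)) (at x) v = L (frechet_derivative f (at x) v)"
    and "(\<lambda>y. L (f y)) differentiable (at x)"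
proof -
  have "((\<lambda>y. L (f y)) has_derivative (\<lambda>v. L (frechet_derivative f (at x) v))) (at x)"
    using bounded_linear.has_derivative[OF assms(1)] assms(2) frechet_derivative_works by blast
  then show "frechet_derivative (\<lambda>y. L (f y)) (at x) v = L (frechet_derivative f (at x) v)"
    "(\<lambda>y. L (f y)) differentiable (at x)"
    by (metis frechet_derivative_at, auto simp: differentiable_def)
qed

lemma Ck_on_bounded_linear_comp:
  assumes "open S" "bounded_linear L" "Ck_on k f S"
  shows "Ck_on k (\<lambda>x. L (f x)) S"
  using assms(3)
proof (induction k arbitrary: f)
  case 0
  then show ?case using bounded_linear.continuous_on[OF assms(2)] by simp
next
  case (Suc k)
  have "Ck_on k (\<lambda>x. frechet_derivative (\<lambda>y. L (f y)) (at x) v) S" for v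
    by (rule Ck_on_cong[OF assms(1), THEN iffD1, OF _ Suc.IH[of "\<lambda>x. frechet_derivative f (at x) v"]])
      (use Suc.prems in \<open>auto simp: frechet_derivative_bounded_linear_comp[OF assms(2)]\<close>)
  with Suc.prems show ?case by (auto intro: frechet_derivative_bounded_linear_comp[OF assms(2)])
qed

lemma frechet_derivative_add:
  assumes "f differentiable (at x)" "g differentiable (at x)"
  shows "frechet_derivative (\<lambda>y. f y + g y) (at x) v
    = frechet_derivative f (at x) v + frechet_derivative g (at x) v"
  using has_derivative_add[OF assms[THEN frechet_derivative_works[THEN iffD1]]]
  by (metis frechet_derivative_at)

lemma Ck_on_add:
  assumes "open S" "Ck_on k f S" "Ck_on k g S"
  shows "Ck_on k (\<lambda>x. f x + g x) S"
  using assms(2,3)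
proof (induction k arbitrary: f g)
  case 0
  then show ?case by (simp add: continuous_on_add)
next
  case (Suc k)
  have "Ck_on k (\<lambda>x. frechet_derivative (\<lambda>y. f y + g y) (at x) v) S" for v
    by (rule Ck_on_cong[OF assms(1), THEN iffD1, OF _ Suc.IH[of "\<lambda>x. frechet_derivative f (at x) v"
            "\<lambda>x. frechet_derivative g (at x) v"]])
      (use Suc.prems in \<open>auto simp: frechet_derivative_add\<close>)
  with Suc.prems show ?case by (auto intro: differentiable_add)
qed

lemma smooth_on_frechet_derivative:
  "smooth_on S f \<Longrightarrow> smooth_on S (\<lambda>x. frechet_derivative f (at x) v)"
  unfolding smooth_on_def by (metis Ck_on.simps(2))

lemma smooth_on_differentiable:
  "smooth_on S f \<Longrightarrow> x \<in> S \<Longrightarrow> f differentiable (at x)"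
  unfolding smooth_on_def by (metis Ck_on.simps(2))

lemma smooth_on_const: "smooth_on S (\<lambda>x. c)"
proof -
  have "Ck_on k (\<lambda>x. c) S" for k and c :: 'b by (induction k arbitrary: c) auto
  then show ?thesis by (simp add: smooth_on_def)
qed

lemma smooth_on_subset: "smooth_on S f \<Longrightarrow> T \<subseteq> S \<Longrightarrow> smooth_on T f"
proof -
  have "Ck_on k f S \<Longrightarrow> T \<subseteq> S \<Longrightarrow> Ck_on k f T" for k and f :: "'a \<Rightarrow> 'b"
    by (induction k arbitrary: f) (auto intro: continuous_on_subset)
  then show "smooth_on S f \<Longrightarrow> T \<subseteq> S \<Longrightarrow> smooth_on T f" by (auto simp: smooth_on_def)
qed

section \<open>Symmetry of second derivatives\<close>

text \<open>The mean value theorem, applied along \<open>v\<close> to the increment of \<open>f\<close> along \<open>w\<close> and then along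
  \<open>w\<close> to the derivative.  The left side is symmetric in \<open>v\<close> and \<open>w\<close>, which is the reason for the
  symmetry of second derivatives.\<close>

lemma second_difference_mean_value:
  fixes f :: "'a::real_normed_vector \<Rightarrow> real"
  assumes f: "Ck_on 2 f S" and t: "0 < t"
    and S: "\<And>a b. 0 \<le> a \<Longrightarrow> a \<le> t \<Longrightarrow> 0 \<le> b \<Longrightarrow> b \<le> t \<Longrightarrow> x + a *\<^sub>R v + b *\<^sub>R w \<in> S"
  shows "\<exists>a b. 0 < a \<and> a < t \<and> 0 < b \<and> b < t \<and>
    f (x + t *\<^sub>R v + t *\<^sub>R w) - f (x + t *\<^sub>R v) - f (x + t *\<^sub>R w) + f x
    = t * (t * frechet_derivative (\<lambda>y. frechet_derivative f (at y) v) (at (x + a *\<^sub>R v + b *\<^sub>R w)) w)"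
proof -
  define g where "g y = frechet_derivative f (at y) v" for y
  have along: "((\<lambda>s. k (p + s *\<^sub>R u)) has_real_derivative frechet_derivative k (at (p + s *\<^sub>R u)) u) (at s)"
    if "k differentiable (at (p + s *\<^sub>R u))" for k :: "'a \<Rightarrow> real" and p u s
  proof -
    have k: "(k has_derivative frechet_derivative k (at (p + s *\<^sub>R u))) (at (p + s *\<^sub>R u))"
      using that frechet_derivative_works by blast
    have "((\<lambda>s. p + s *\<^sub>R u) has_derivative (\<lambda>h. h *\<^sub>R u)) (at s)"
      by (auto intro!: derivative_eq_intros)
    from diff_chain_at[OF this k]
    have "((\<lambda>s. k (p + s *\<^sub>R u)) has_derivative (\<lambda>h. frechet_derivative k (at (p + s *\<^sub>R u)) (h *\<^sub>R u))) (at s)"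
      by (simp add: o_def)
    moreover have "frechet_derivative k (at (p + s *\<^sub>R u)) (h *\<^sub>R u) = frechet_derivative k (at (p + s *\<^sub>R u)) u * h" for h
      using linear_scale[OF linear_frechet_derivative[OF that], of h u] by simp
    ultimately show ?thesis by (simp add: has_field_derivative_def)
  qed
  have fd: "f differentiable (at y)" and gd: "g differentiable (at y)" if "y \<in> S" for y
    using f that by (auto simp: numeral_2_eq_2 g_def[abs_def])
  have "\<exists>a>0. a < t \<and> (f (x + t *\<^sub>R w + t *\<^sub>R v) - f (x + t *\<^sub>R v)) - (f (x + t *\<^sub>R w + 0 *\<^sub>R v) - f (x + 0 *\<^sub>R v))
      = (t - 0) * (g (x + t *\<^sub>R w + a *\<^sub>R v) - g (x + a *\<^sub>R v))"
  proof (rule MVT2[OF t])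
    fix a assume a: "0 \<le> a" "a \<le> t"
    show "((\<lambda>a. f (x + t *\<^sub>R w + a *\<^sub>R v) - f (x + a *\<^sub>R v)) has_real_derivative
       g (x + t *\<^sub>R w + a *\<^sub>R v) - g (x + a *\<^sub>R v)) (at a)"
      unfolding g_def
      by (intro DERIV_diff along fd)
        (use S[of a t] S[of a 0] a t in \<open>auto simp: algebra_simps\<close>)
  qed
  then obtain a where a: "0 < a" "a < t"
    and 1: "f (x + t *\<^sub>R w + t *\<^sub>R v) - f (x + t *\<^sub>R v) - f (x + t *\<^sub>R w) + f x
      = t * (g (x + a *\<^sub>R v + t *\<^sub>R w) - g (x + a *\<^sub>R v))"
    by (auto simp: algebra_simps)
  have "\<exists>b>0. b < t \<and> g (x + a *\<^sub>R v + t *\<^sub>R w) - g (x + a *\<^sub>R v + 0 *\<^sub>R w)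
     = (t - 0) * frechet_derivative g (at (x + a *\<^sub>R v + b *\<^sub>R w)) w"
    by (rule MVT2[OF t], rule along, rule gd, rule S) (use a t in auto)
  then obtain b where "0 < b" "b < t"
    and "g (x + a *\<^sub>R v + t *\<^sub>R w) - g (x + a *\<^sub>R v) = t * frechet_derivative g (at (x + a *\<^sub>R v + b *\<^sub>R w)) w"
    by auto
  with 1 a show ?thesis unfolding g_def[abs_def]
    by (intro exI[of _ a] exI[of _ b]) (simp add: algebra_simps)
qed

text \<open>Both mixed derivatives, taken at points near \<open>x\<close>, are equal to the same second difference
  divided by \<open>t\<^sup>2\<close>; by continuity they agree at \<open>x\<close> as \<open>t\<close> shrinks.\<close>

lemma second_derivative_symmetric_real:
  fixes f :: "'a::real_normed_vector \<Rightarrow> real"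
  assumes S: "open S" "x \<in> S" and f: "Ck_on 2 f S"
  shows "frechet_derivative (\<lambda>y. frechet_derivative f (at y) v) (at x) w
       = frechet_derivative (\<lambda>y. frechet_derivative f (at y) w) (at x) v"
proof -
  define A where "A v w y = frechet_derivative (\<lambda>y. frechet_derivative f (at y) v) (at y) w" for v w y
  have cont: "continuous_on S (A v w)" for v w
    using f by (simp add: A_def numeral_2_eq_2)
  have near: "\<exists>d>0. \<forall>y. dist y x < d \<longrightarrow> y \<in> S \<and> dist (A v w y) (A v w x) < e" if "e > 0" for v w e
  proof -
    obtain d1 where d1: "d1 > 0" "\<And>y. y \<in> S \<Longrightarrow> dist y x < d1 \<Longrightarrow> dist (A v w y) (A v w x) < e"
      using cont[of v w] S(2) \<open>e > 0\<close> unfolding continuous_on_iff by metis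
    obtain d2 where d2: "d2 > 0" "\<And>y. dist y x < d2 \<Longrightarrow> y \<in> S"
      using S unfolding open_dist by metis
    show ?thesis by (rule exI[of _ "min d1 d2"]) (use d1 d2 in auto)
  qed
  have bound: "\<bar>A v w x - A w v x\<bar> \<le> e" if e: "e > 0" for e
  proof -
    have "e/2 > 0" using e by simp
    obtain d where d: "d > 0" "\<And>y. dist y x < d \<Longrightarrow> y \<in> S \<and> dist (A v w y) (A v w x) < e/2"
      using near[OF \<open>e/2 > 0\<close>] by blast
    obtain d' where d': "d' > 0" "\<And>y. dist y x < d' \<Longrightarrow> dist (A w v y) (A w v x) < e/2"
      using near[OF \<open>e/2 > 0\<close>] by blast
    define N where "N = norm v + norm w + 1"
    define t where "t = min d d' / (2 * N)"
    have N: "N > 0" unfolding N_def by (simp add: add_nonneg_pos)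
    have t: "t > 0" using d(1) d'(1) N by (simp add: t_def)
    have close: "dist (x + a *\<^sub>R v + b *\<^sub>R w) x < min d d'" if "0 \<le> a" "a \<le> t" "0 \<le> b" "b \<le> t" for a b
    proof -
      have "dist (x + a *\<^sub>R v + b *\<^sub>R w) x = norm (a *\<^sub>R v + b *\<^sub>R w)"
        by (simp add: dist_norm algebra_simps)
      also have "\<dots> \<le> a * norm v + b * norm w"
        using norm_triangle_ineq[of "a *\<^sub>R v" "b *\<^sub>R w"] that by simp
      also have "\<dots> \<le> t * norm v + t * norm w"
        using that by (intro add_mono mult_right_mono) auto
      also have "\<dots> \<le> t * N" using t by (simp add: N_def algebra_simps)
      also have "\<dots> = min d d' / 2" using N by (simp add: t_def)
      also have "\<dots> < min d d'" using d(1) d'(1) by (simp add: min_def)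
      finally show ?thesis .
    qed
    obtain a b where ab: "0 < a" "a < t" "0 < b" "b < t"
      and 1: "f (x + t *\<^sub>R v + t *\<^sub>R w) - f (x + t *\<^sub>R v) - f (x + t *\<^sub>R w) + f x
          = t * (t * A v w (x + a *\<^sub>R v + b *\<^sub>R w))"
      using second_difference_mean_value[OF f t, of x v w] close d(2) unfolding A_def by force
    obtain a' b' where ab': "0 < a'" "a' < t" "0 < b'" "b' < t"
      and 2: "f (x + t *\<^sub>R w + t *\<^sub>R v) - f (x + t *\<^sub>R w) - f (x + t *\<^sub>R v) + f x
          = t * (t * A w v (x + a' *\<^sub>R w + b' *\<^sub>R v))"
    proof -
      have "x + a *\<^sub>R w + b *\<^sub>R v \<in> S" if "0 \<le> a" "a \<le> t" "0 \<le> b" "b \<le> t" for a b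
        using close[of b a] d(2)[of "x + b *\<^sub>R v + a *\<^sub>R w"] that by (simp add: algebra_simps)
      from second_difference_mean_value[OF f t this] show thesis using that unfolding A_def by blast
    qed
    have "t * (t * A v w (x + a *\<^sub>R v + b *\<^sub>R w)) = t * (t * A w v (x + a' *\<^sub>R w + b' *\<^sub>R v))"
      using 1 2 by (simp add: algebra_simps)
    then have eq: "A v w (x + a *\<^sub>R v + b *\<^sub>R w) = A w v (x + a' *\<^sub>R w + b' *\<^sub>R v)" using t by simp
    have "dist (A v w (x + a *\<^sub>R v + b *\<^sub>R w)) (A v w x) < e/2"
      using close[of a b] ab d(2) by simp
    moreover have "dist (A w v (x + a' *\<^sub>R w + b' *\<^sub>R v)) (A w v x) < e/2"
      using close[of b' a'] ab' d'(2)[of "x + a' *\<^sub>R w + b' *\<^sub>R v"] by (simp add: algebra_simps)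
    ultimately show ?thesis using eq unfolding dist_real_def by linarith
  qed
  have "\<bar>A v w x - A w v x\<bar> \<le> 0"
    by (rule field_le_epsilon) (simp only: add_0 bound)
  then show ?thesis by (simp add: A_def)
qed

lemma second_derivative_symmetric:
  fixes f :: "'a::real_normed_vector \<Rightarrow> complex"
  assumes S: "open S" "x \<in> S" and f: "smooth_on S f"
  shows "frechet_derivative (\<lambda>y. frechet_derivative f (at y) v) (at x) w
       = frechet_derivative (\<lambda>y. frechet_derivative f (at y) w) (at x) v"
proof -
  have part: "frechet_derivative (\<lambda>y. frechet_derivative (\<lambda>z. L (f z)) (at y) v) (at x) w
      = L (frechet_derivative (\<lambda>y. frechet_derivative f (at y) v) (at x) w)"
    if L: "bounded_linear L" for L :: "complex \<Rightarrow> real" and v w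
  proof -
    have fd: "f differentiable (at y)" if "y \<in> S" for y using smooth_on_differentiable[OF f that] .
    have fd2: "(\<lambda>y. frechet_derivative f (at y) v) differentiable (at x)"
      by (rule smooth_on_differentiable[OF smooth_on_frechet_derivative[OF f] S(2)])
    have "frechet_derivative (\<lambda>y. L (frechet_derivative f (at y) v)) (at x)
        = frechet_derivative (\<lambda>y. frechet_derivative (\<lambda>z. L (f z)) (at y) v) (at x)"
      by (rule frechet_derivative_transform_within_open[OF _ S])
        (simp_all add: frechet_derivative_bounded_linear_comp[OF L] fd fd2)
    then show ?thesis by (metis frechet_derivative_bounded_linear_comp(1)[OF L fd2])
  qed
  have Ck: "Ck_on 2 (\<lambda>z. L (f z)) S" if L: "bounded_linear L" for L :: "complex \<Rightarrow> real"
    using Ck_on_bounded_linear_comp[OF S(1) L] f by (simp add: smooth_on_def)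
  show ?thesis
    using second_derivative_symmetric_real[OF S Ck[OF bounded_linear_Re], of v w]
      second_derivative_symmetric_real[OF S Ck[OF bounded_linear_Im], of v w]
    by (intro complex_eqI) (simp_all only: part[OF bounded_linear_Re] part[OF bounded_linear_Im])
qed

section \<open>Point derivations\<close>

text \<open>All first-order operators here (the Wirtinger derivatives, the anchored frame, \<open>\<delta>\<^sub>\<alpha>\<close>, the action
  of a section), evaluated at a point, are complex-linear functions of the real derivative there.
  The calculus rules follow from this alone and are thus available to all of them.\<close>

definition derivation_at :: "'a::real_normed_vector \<Rightarrow> (('a \<Rightarrow> complex) \<Rightarrow> complex) \<Rightarrow> bool" where
  "derivation_at x D \<longleftrightarrow> (\<exists>L. (\<forall>f. D f = L (frechet_derivative f (at x))) \<and>
     (\<forall>A B. L (\<lambda>v. A v + B v) = L A + L B) \<and> (\<forall>c A. L (\<lambda>v. c * A v) = c * L A))"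

lemma derivation_atI:
  assumes "\<And>f. D f = L (frechet_derivative f (at x))"
    "\<And>A B. L (\<lambda>v. A v + B v) = L A + L B" "\<And>c A. L (\<lambda>v. c * A v) = c * L A"
  shows "derivation_at x D"
  using assms unfolding derivation_at_def by blast

lemma derivation_at_wirt: "derivation_at x (\<lambda>f. wirt i f x)"
  by (rule derivation_atI[where L = "\<lambda>A. (A (axis i 1) - \<i> * A (axis i \<i>)) / 2"])
    (simp_all add: wirt_def field_simps)

lemma derivation_at_wirt_bar: "derivation_at x (\<lambda>f. wirt_bar i f x)"
  by (rule derivation_atI[where L = "\<lambda>A. (A (axis i 1) + \<i> * A (axis i \<i>)) / 2"])
    (simp_all add: wirt_bar_def field_simps)

lemma derivation_at_mult:
  assumes "derivation_at x D" shows "derivation_at x (\<lambda>f. c * D f)"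
proof -
  from assms obtain L where "\<forall>f. D f = L (frechet_derivative f (at x))"
     "\<forall>A B. L (\<lambda>v. A v + B v) = L A + L B" "\<forall>c A. L (\<lambda>v. c * A v) = c * L A"
    unfolding derivation_at_def by blast
  then show ?thesis by (intro derivation_atI[where L = "\<lambda>A. c * L A"]) (auto simp: algebra_simps)
qed

lemma derivation_at_diff:
  assumes "derivation_at x D" "derivation_at x E" shows "derivation_at x (\<lambda>f. D f - E f)"
proof -
  from assms obtain L L' where "\<forall>f. D f = L (frechet_derivative f (at x))"
     "\<forall>A B. L (\<lambda>v. A v + B v) = L A + L B" "\<forall>c A. L (\<lambda>v. c * A v) = c * L A"
     "\<forall>f. E f = L' (frechet_derivative f (at x))"
     "\<forall>A B. L' (\<lambda>v. A v + B v) = L' A + L' B" "\<forall>c A. L' (\<lambda>v. c * A v) = c * L' A"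
    unfolding derivation_at_def by blast
  then show ?thesis by (intro derivation_atI[where L = "\<lambda>A. L A - L' A"]) (auto simp: algebra_simps)
qed

lemma derivation_at_sum:
  assumes "\<And>i. i \<in> I \<Longrightarrow> derivation_at x (D i)" shows "derivation_at x (\<lambda>f. \<Sum>i\<in>I. D i f)"
proof -
  from assms obtain L where "\<forall>i\<in>I. (\<forall>f. D i f = L i (frechet_derivative f (at x))) \<and>
     (\<forall>A B. L i (\<lambda>v. A v + B v) = L i A + L i B) \<and> (\<forall>c A. L i (\<lambda>v. c * A v) = c * L i A)"
    unfolding derivation_at_def by metis
  then show ?thesis
    by (intro derivation_atI[where L = "\<lambda>A. \<Sum>i\<in>I. L i A"])
      (auto simp: sum.distrib sum_distrib_left intro!: sum.cong)
qed

lemma differentiable_prod: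
  fixes f :: "'i \<Rightarrow> 'a::real_normed_vector \<Rightarrow> complex"
  assumes "\<And>i. i \<in> I \<Longrightarrow> f i differentiable (at x)"
  shows "(\<lambda>y. \<Prod>i\<in>I. f i y) differentiable (at x)"
proof -
  have "((\<lambda>y. \<Prod>i\<in>I. f i y) has_derivative
      (\<lambda>v. \<Sum>i\<in>I. frechet_derivative (f i) (at x) v * (\<Prod>j\<in>I - {i}. f j x))) (at x)"
    by (rule has_derivative_prod) (use assms frechet_derivative_works in blast)
  then show ?thesis unfolding differentiable_def by blast
qed

lemma differentiable_det:
  fixes M :: "'a::real_normed_vector \<Rightarrow> complex^'n^'n"
  assumes "\<And>i j. (\<lambda>y. M y $ i $ j) differentiable (at x)"
  shows "(\<lambda>y. det (M y)) differentiable (at x)"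
  unfolding det_def using assms
  by (intro differentiable_sum differentiable_mult differentiable_prod ballI) auto

context
  fixes x :: "'a::real_normed_vector" and D
  assumes D: "derivation_at x D"
begin

lemma derivation_cong:
  assumes "f differentiable (at x)" "open S" "x \<in> S" "\<And>y. y \<in> S \<Longrightarrow> f y = g y"
  shows "D f = D g"
  using frechet_derivative_transform_within_open[OF assms] D unfolding derivation_at_def by metis

lemma derivation_const: "D (\<lambda>y. c) = 0"
proof -
  obtain L where L: "\<And>f. D f = L (frechet_derivative f (at x))"
     "\<And>c A. L (\<lambda>v. c * A v) = c * L A"
    using D unfolding derivation_at_def by blast
  have "frechet_derivative (\<lambda>y. c) (at x) = (\<lambda>v. 0)" by (simp add: frechet_derivative_const)
  then show ?thesis using L(1)[of "\<lambda>y. c"] L(2)[of 0 "\<lambda>v. 0"] by simp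
qed

lemma derivation_add:
  assumes "f differentiable (at x)" "g differentiable (at x)"
  shows "D (\<lambda>y. f y + g y) = D f + D g"
proof -
  obtain L where L: "\<And>f. D f = L (frechet_derivative f (at x))"
     "\<And>A B. L (\<lambda>v. A v + B v) = L A + L B"
    using D unfolding derivation_at_def by blast
  have "frechet_derivative (\<lambda>y. f y + g y) (at x)
     = (\<lambda>v. frechet_derivative f (at x) v + frechet_derivative g (at x) v)"
    by (rule ext) (rule frechet_derivative_add[OF assms])
  then show ?thesis using L by simp
qed

lemma derivation_mult:
  assumes "f differentiable (at x)" "g differentiable (at x)"
  shows "D (\<lambda>y. f y * g y) = D f * g x + f x * D g"
proof -
  obtain L where L: "\<And>f. D f = L (frechet_derivative f (at x))"
     "\<And>A B. L (\<lambda>v. A v + B v) = L A + L B" "\<And>c A. L (\<lambda>v. c * A v) = c * L A"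
    using D unfolding derivation_at_def by blast
  have "frechet_derivative (\<lambda>y. f y * g y) (at x)
     = (\<lambda>v. f x * frechet_derivative g (at x) v + g x * frechet_derivative f (at x) v)"
    using has_derivative_mult[OF assms[THEN frechet_derivative_works[THEN iffD1]]]
    by (metis (no_types, lifting) ext frechet_derivative_at mult.commute)
  then have "D (\<lambda>y. f y * g y) = L (\<lambda>v. f x * frechet_derivative g (at x) v + g x * frechet_derivative f (at x) v)"
    using L(1)[of "\<lambda>y. f y * g y"] by simp
  then show ?thesis by (simp add: L mult.commute)
qed

lemma derivation_cmult:
  "f differentiable (at x) \<Longrightarrow> D (\<lambda>y. c * f y) = c * D f"
  using derivation_mult[of "\<lambda>y. c" f] by (simp add: derivation_const)

lemma derivation_uminus:
  "f differentiable (at x) \<Longrightarrow> D (\<lambda>y. - f y) = - D f"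
  using derivation_cmult[of f "-1"] by simp

lemma derivation_lincomb:
  assumes "f differentiable (at x)" "g differentiable (at x)"
  shows "D (\<lambda>y. a * f y + b * g y) = a * D f + b * D g"
  using assms by (simp add: derivation_add derivation_cmult)

lemma derivation_sum:
  assumes "finite I" "\<And>i. i \<in> I \<Longrightarrow> f i differentiable (at x)"
  shows "D (\<lambda>y. \<Sum>i\<in>I. f i y) = (\<Sum>i\<in>I. D (f i))"
  using assms
  by (induction I) (auto simp: derivation_const derivation_add differentiable_sum)

lemma derivation_prod:
  assumes "finite I" "\<And>i. i \<in> I \<Longrightarrow> f i differentiable (at x)"
  shows "D (\<lambda>y. \<Prod>i\<in>I. f i y) = (\<Sum>i\<in>I. D (f i) * (\<Prod>j\<in>I - {i}. f j x))"
  using assms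
proof (induction I)
  case empty
  then show ?case by (simp add: derivation_const)
next
  case (insert a I)
  have "(\<Sum>i\<in>I. D (f i) * (\<Prod>j\<in>insert a I - {i}. f j x))
      = (\<Sum>i\<in>I. f a x * (D (f i) * (\<Prod>j\<in>I - {i}. f j x)))"
  proof (rule sum.cong[OF refl])
    fix i assume "i \<in> I"
    then have "insert a I - {i} = insert a (I - {i})" using insert.hyps by auto
    then show "D (f i) * (\<Prod>j\<in>insert a I - {i}. f j x) = f a x * (D (f i) * (\<Prod>j\<in>I - {i}. f j x))"
      using insert.hyps by simp
  qed
  then show ?case
    using insert by (simp add: derivation_mult differentiable_prod sum_distrib_left)
qed

text \<open>The determinant is multilinear in its rows, so it is differentiated row by row.\<close>

lemma derivation_det:
  fixes M :: "'a \<Rightarrow> complex^'n^'n"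
  assumes M: "\<And>i j. (\<lambda>y. M y $ i $ j) differentiable (at x)"
  shows "D (\<lambda>y. det (M y)) =
    (\<Sum>i\<in>UNIV. det (\<chi> r. if r = i then (\<chi> c. D (\<lambda>y. M y $ i $ c)) else M x $ r))"
proof -
  have "D (\<lambda>y. det (M y)) = (\<Sum>p | p permutes UNIV. of_int (sign p) *
      (\<Sum>i\<in>UNIV. D (\<lambda>y. M y $ i $ p i) * (\<Prod>r\<in>UNIV - {i}. M x $ r $ p r)))"
    unfolding det_def using M
    by (subst derivation_sum)
      (auto simp: derivation_cmult derivation_prod differentiable_prod differentiable_mult)
  also have "\<dots> = (\<Sum>p | p permutes UNIV. \<Sum>i\<in>UNIV. of_int (sign p) *
      (\<Prod>r\<in>UNIV. (\<chi> r. if r = i then (\<chi> c. D (\<lambda>y. M y $ i $ c)) else M x $ r) $ r $ p r))"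
    unfolding sum_distrib_left
  proof (intro sum.cong refl)
    fix p and i :: 'n
    have "(\<Prod>r\<in>UNIV. (\<chi> r. if r = i then (\<chi> c. D (\<lambda>y. M y $ i $ c)) else M x $ r) $ r $ p r)
       = D (\<lambda>y. M y $ i $ p i) * (\<Prod>r\<in>UNIV - {i}. M x $ r $ p r)"
      by (subst prod.remove[of _ i]) (auto intro!: prod.cong)
    then show "of_int (sign p) * (D (\<lambda>y. M y $ i $ p i) * (\<Prod>r\<in>UNIV - {i}. M x $ r $ p r))
      = of_int (sign p) * (\<Prod>r\<in>UNIV. (\<chi> r. if r = i then (\<chi> c. D (\<lambda>y. M y $ i $ c)) else M x $ r) $ r $ p r)"
      by simp
  qed
  also have "\<dots> = (\<Sum>i\<in>UNIV. det (\<chi> r. if r = i then (\<chi> c. D (\<lambda>y. M y $ i $ c)) else M x $ r))"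
    unfolding det_def by (rule sum.swap)
  finally show ?thesis .
qed

end

section \<open>The volume form\<close>

lemma wedge_power_pullback:
  "wedge_power k (\<lambda>X Z. c * \<omega> (t X) (t Z)) Y = c ^ k * wedge_power k \<omega> (\<lambda>i. t (Y i))"
  unfolding wedge_power_def by (simp add: prod.distrib sum_distrib_left mult_ac)

lemma UNIV_frame_idx: "(UNIV :: 'm frame_idx set) = range IZ \<union> range IV \<union> range IZbar \<union> range IVbar"
proof (rule UNIV_eq_I)
  show "x \<in> range IZ \<union> range IV \<union> range IZbar \<union> range IVbar" for x :: "'m frame_idx"
    by (cases x) auto
qed

lemma sum_frame_idx:
  fixes f :: "'m::finite frame_idx \<Rightarrow> 'a::comm_monoid_add"
  shows "(\<Sum>I\<in>UNIV. f I) = (\<Sum>\<alpha>\<in>UNIV. f (IZ \<alpha>)) + (\<Sum>\<alpha>\<in>UNIV. f (IV \<alpha>))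
    + (\<Sum>\<alpha>\<in>UNIV. f (IZbar \<alpha>)) + (\<Sum>\<alpha>\<in>UNIV. f (IVbar \<alpha>))"
proof -
  have inj: "inj IZ" "inj IV" "inj IZbar" "inj IVbar" by (auto intro: injI)
  have "(\<Sum>I\<in>UNIV. f I) = sum f (range IZ) + sum f (range IV) + sum f (range IZbar) + sum f (range IVbar)"
    unfolding UNIV_frame_idx
    by (subst sum.union_disjoint; (auto; fail)?)+ 
  then show ?thesis by (simp add: sum.reindex inj)
qed

text \<open>The frame listed in symplectic order: each index is followed by its conjugate, the
  horizontal pairs preceding the vertical ones.  \<open>\<nu>\<close> enumerates the index type.\<close>

fun frame_pos :: "('m::finite \<Rightarrow> nat) \<Rightarrow> 'm frame_idx \<Rightarrow> nat" where
  "frame_pos \<nu> (IZ \<alpha>) = 2 * \<nu> \<alpha>"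
| "frame_pos \<nu> (IZbar \<alpha>) = 2 * \<nu> \<alpha> + 1"
| "frame_pos \<nu> (IV \<alpha>) = 2 * (CARD('m) + \<nu> \<alpha>)"
| "frame_pos \<nu> (IVbar \<alpha>) = 2 * (CARD('m) + \<nu> \<alpha>) + 1"

lemma frame_pos_div_mod:
  "frame_pos \<nu> (IZ \<alpha>) div 2 = \<nu> \<alpha>" "frame_pos \<nu> (IZ \<alpha>) mod 2 = 0"
  "frame_pos \<nu> (IZbar \<alpha>) div 2 = \<nu> \<alpha>" "frame_pos \<nu> (IZbar \<alpha>) mod 2 = 1"
  "frame_pos \<nu> (IV \<alpha>) div 2 = CARD('m) + \<nu> \<alpha>" "frame_pos \<nu> (IV \<alpha>) mod 2 = 0"
  "frame_pos \<nu> (IVbar \<alpha>) div 2 = CARD('m) + \<nu> \<alpha>" "frame_pos \<nu> (IVbar \<alpha>) mod 2 = 1"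
  for \<nu> :: "'m::finite \<Rightarrow> nat"
  by simp_all

lemma frame_pos_bij:
  fixes \<nu> :: "'m::finite \<Rightarrow> nat"
  assumes \<nu>: "bij_betw \<nu> UNIV {..<CARD('m)}"
  shows "bij_betw (frame_pos \<nu>) UNIV {..<2 * (2 * CARD('m))}"
proof -
  have inj: "\<nu> a = \<nu> b \<longleftrightarrow> a = b" for a b using \<nu> by (simp add: bij_betw_def inj_eq)
  have lt: "\<nu> a < CARD('m)" for a using \<nu> by (auto simp: bij_betw_def)
  have ne: "\<nu> a \<noteq> CARD('m) + n" "CARD('m) + n \<noteq> \<nu> a" for a n using lt[of a] by linarith+
  have inj: "inj (frame_pos \<nu>)"
  proof (rule injI)
    fix I J assume "frame_pos \<nu> I = frame_pos \<nu> J"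
    then have "frame_pos \<nu> I div 2 = frame_pos \<nu> J div 2" "frame_pos \<nu> I mod 2 = frame_pos \<nu> J mod 2"
      by (simp_all only:)
    then show "I = J"
      by (cases I; cases J)
        (simp_all only: frame_pos_div_mod inj ne add_left_cancel zero_neq_one zero_neq_one[symmetric])
  qed
  have lt': "frame_pos \<nu> I < 2 * (2 * CARD('m))" for I
  proof -
    obtain a where "I \<in> {IZ a, IV a, IZbar a, IVbar a}" by (cases I) auto
    then show ?thesis using lt[of a] by auto
  qed
  have "card (range (frame_pos \<nu>)) = (\<Sum>I\<in>(UNIV :: 'm frame_idx set). 1)"
    by (simp add: card_image inj)
  also have "\<dots> = card {..<2 * (2 * CARD('m))}" unfolding sum_frame_idx by simp
  finally have "range (frame_pos \<nu>) = {..<2 * (2 * CARD('m))}"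
    using lt' by (intro card_subset_eq) auto
  with inj show ?thesis by (simp add: bij_betw_def)
qed

text \<open>The change from the coframe \<open>\<Z>\<^sup>\<alpha>, \<V>\<^sup>\<alpha>\<close> to the adapted coframe \<open>\<Z>\<^sup>\<alpha>, \<delta>\<V>\<^sup>\<alpha>\<close>, with conjugates.\<close>

definition coframe_shear :: "('n::finite, 'm::finite) local_data \<Rightarrow> complex^('n + 'm) \<Rightarrow>
    complex^('m frame_idx)^('m frame_idx)" where
  "coframe_shear G x = (\<chi> I J. if I = J then 1 else (case (I, J) of
      (IV \<alpha>, IZ \<beta>) \<Rightarrow> Ncoef G \<alpha> \<beta> x | (IVbar \<alpha>, IZbar \<beta>) \<Rightarrow> cnj (Ncoef G \<alpha> \<beta> x) | _ \<Rightarrow> 0))"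

definition embed_block :: "('m \<Rightarrow> 'i) \<Rightarrow> complex^'m^'m \<Rightarrow> complex^'i^'i" where
  "embed_block f h = (\<chi> i j. if i \<in> range f \<and> j \<in> range f then h $ inv f i $ inv f j
     else if i = j then 1 else 0)"

lemma det_embed_block: "inj f \<Longrightarrow> det (embed_block f h) = det h"
  by (rule det_embedded_block[where f = f]) (auto simp: embed_block_def)

lemma embed_block_mult_vec:
  fixes f :: "'m::finite \<Rightarrow> 'i::finite"
  assumes "inj f"
  shows "(embed_block f h *v X) $ f a = (\<Sum>b\<in>UNIV. h $ a $ b * X $ f b)"
    and "i \<notin> range f \<Longrightarrow> (embed_block f h *v X) $ i = X $ i"
proof -
  have "(embed_block f h *v X) $ f a = (\<Sum>j\<in>range f. embed_block f h $ f a $ j * X $ j)"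
    unfolding matrix_vector_mult_def vec_lambda_beta
    by (rule sum.mono_neutral_right) (auto simp: embed_block_def)
  then show "(embed_block f h *v X) $ f a = (\<Sum>b\<in>UNIV. h $ a $ b * X $ f b)"
    by (simp add: sum.reindex assms embed_block_def)
  show "i \<notin> range f \<Longrightarrow> (embed_block f h *v X) $ i = X $ i"
    by (simp add: matrix_vector_mult_def embed_block_def if_distrib[of "\<lambda>c. c * _"] cong: if_cong)
qed

text \<open>The covectors \<open>\<Z>\<^sup>\<alpha>\<close>, \<open>\<delta>\<V>\<^sup>\<alpha>\<close> together with the conjugates contracted with
  \<open>h\<^sub>\<alpha>\<^sub>\<beta>\<close>-bar.  This coframe is symplectic for \<open>Phi\<close> up to the factor \<open>\<i>\<close>.\<close>

definition coframe_matrix :: "('n::finite, 'm::finite) local_data \<Rightarrow> complex^('n + 'm) \<Rightarrow>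
    complex^('m frame_idx)^('m frame_idx)" where
  "coframe_matrix G x = embed_block IZbar (hmat G x) ** (embed_block IVbar (hmat G x) ** coframe_shear G x)"

text \<open>One factor \<open>h\<close> from the horizontal and one from the vertical block.\<close>

lemma det_coframe_matrix: "det (coframe_matrix G x) = (hdet G x)\<^sup>2"
proof -
  have "det (coframe_shear G x) = 1"
    by (rule det_unipotent[where S = "range IV \<union> range IVbar"])
      (auto simp: coframe_shear_def split: frame_idx.splits if_splits)
  then show ?thesis
    by (simp add: coframe_matrix_def det_mul det_embed_block inj_def hdet_def power2_eq_square)
qed

lemma coframe_matrix_mult_vec:
  "(coframe_matrix G x *v X) $ IZ \<alpha> = coZ \<alpha> X"
  "(coframe_matrix G x *v X) $ IV \<alpha> = coV G x \<alpha> X"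
  "(coframe_matrix G x *v X) $ IZbar \<alpha> = (\<Sum>\<beta>\<in>UNIV. hmat G x $ \<alpha> $ \<beta> * coZ_bar \<beta> X)"
  "(coframe_matrix G x *v X) $ IVbar \<alpha> = (\<Sum>\<beta>\<in>UNIV. hmat G x $ \<alpha> $ \<beta> * coV_bar G x \<beta> X)"
proof -
  have inj: "inj IZbar" "inj IVbar" by (auto intro: injI)
  have d: "(\<Sum>\<beta>\<in>UNIV. (if \<alpha> = \<beta> then 1 else 0) * c \<beta>) = (c \<alpha> :: complex)" for \<alpha> and c :: "'m::finite \<Rightarrow> complex"
    by (simp add: if_distrib[of "\<lambda>a. a * _"] cong: if_cong)
  have sh: "(coframe_shear G x *v X) $ IZ \<alpha> = coZ \<alpha> X" 
    "(coframe_shear G x *v X) $ IV \<alpha> = coV G x \<alpha> X"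
    "(coframe_shear G x *v X) $ IZbar \<alpha> = coZ_bar \<alpha> X"
    "(coframe_shear G x *v X) $ IVbar \<alpha> = coV_bar G x \<alpha> X" for \<alpha>
    by (simp_all add: matrix_vector_mult_def coframe_shear_def sum_frame_idx d
        coZ_def coV_def coZ_bar_def coV_bar_def cong: if_cong)
  have nin: "IZ \<alpha> \<notin> range IZbar" "IZ \<alpha> \<notin> range IVbar" "IV \<alpha> \<notin> range IZbar" "IV \<alpha> \<notin> range IVbar"
    "IVbar \<alpha> \<notin> range IZbar" "IZbar \<alpha> \<notin> range IVbar" for \<alpha> :: 'm by auto
  show "(coframe_matrix G x *v X) $ IZ \<alpha> = coZ \<alpha> X"
    "(coframe_matrix G x *v X) $ IV \<alpha> = coV G x \<alpha> X"
    "(coframe_matrix G x *v X) $ IZbar \<alpha> = (\<Sum>\<beta>\<in>UNIV. hmat G x $ \<alpha> $ \<beta> * coZ_bar \<beta> X)"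
    "(coframe_matrix G x *v X) $ IVbar \<alpha> = (\<Sum>\<beta>\<in>UNIV. hmat G x $ \<alpha> $ \<beta> * coV_bar G x \<beta> X)"
    unfolding coframe_matrix_def matrix_vector_mul_assoc[symmetric]
    by (simp_all add: embed_block_mult_vec[OF inj(1)] embed_block_mult_vec[OF inj(2)] nin sh)
qed

definition std_symp :: "('m::finite \<Rightarrow> nat) \<Rightarrow> 'm tvec \<Rightarrow> 'm tvec \<Rightarrow> complex" where
  "std_symp \<nu> X Z = (\<Sum>I\<in>UNIV. \<Sum>J\<in>UNIV. of_int (symp (frame_pos \<nu> I) (frame_pos \<nu> J)) * (X $ I * Z $ J))"

lemma std_symp_eq:
  fixes \<nu> :: "'m::finite \<Rightarrow> nat"
  assumes \<nu>: "bij_betw \<nu> UNIV {..<CARD('m)}"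
  shows "std_symp \<nu> X Z = (\<Sum>\<alpha>\<in>UNIV. X $ IZ \<alpha> * Z $ IZbar \<alpha> - X $ IZbar \<alpha> * Z $ IZ \<alpha>
     + (X $ IV \<alpha> * Z $ IVbar \<alpha> - X $ IVbar \<alpha> * Z $ IV \<alpha>))"
proof -
  have inj: "\<nu> a = \<nu> b \<longleftrightarrow> a = b" for a b using \<nu> by (simp add: bij_betw_def inj_eq)
  have lt: "\<nu> a < CARD('m)" for a using \<nu> by (auto simp: bij_betw_def)
  have ne: "\<nu> a \<noteq> CARD('m) + n" "CARD('m) + n \<noteq> \<nu> a" for a n using lt[of a] by linarith+
  have d: "(\<Sum>\<beta>\<in>UNIV. (if \<alpha> = \<beta> then a else 0) * c \<beta>) = (a * c \<alpha> :: complex)" for \<alpha> a and c :: "'m \<Rightarrow> complex"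
    by (simp add: if_distrib[of "\<lambda>a. a * _"] cong: if_cong)
  have i: "of_int (if P then k else 0) = (if P then of_int k else 0 :: complex)" for P k by simp
  show ?thesis
    unfolding std_symp_def sum_frame_idx symp_def frame_pos_div_mod inj ne add_left_cancel
    by (simp only: if_False i d) (simp add: ne sum.distrib sum_subtractf sum_negf)
qed

lemma Phi_eq_std_symp:
  fixes \<nu> :: "'m::finite \<Rightarrow> nat"
  assumes \<nu>: "bij_betw \<nu> UNIV {..<CARD('m)}"
  shows "Phi G x = (\<lambda>X Z. \<i> * std_symp \<nu> (coframe_matrix G x *v X) (coframe_matrix G x *v Z))"
  unfolding Phi_def std_symp_eq[OF \<nu>] coframe_matrix_mult_vec wedge11_def fun_eq_iff
  by (simp add: algebra_simps sum_distrib_left sum.distrib sum_subtractf)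

text \<open>The constant and the enumeration depend on the rank alone, not on the point: hence
  derivatives of the volume form come only from \<open>h\<^sup>2\<close> and the determinant.\<close>

lemma volume_form_eq_det:
  obtains C :: complex and enc :: "'m::finite frame_idx \<Rightarrow> nat" where
    "C \<noteq> 0" "bij_betw enc UNIV {..<4 * CARD('m)}"
    "\<And>(G :: ('n::finite, 'm) local_data) x Y.
       volume_form G x Y = C * (hdet G x)\<^sup>2 * det (\<chi> I. Y (enc I))"
proof -
  let ?k = "2 * CARD('m)"
  obtain \<nu> :: "'m \<Rightarrow> nat" where \<nu>: "bij_betw \<nu> UNIV {..<CARD('m)}"
    using ex_bij_betw_finite_nat[of "UNIV :: 'm set"] by (auto simp: atLeast0LessThan)
  define enc where "enc = frame_pos \<nu>"
  have bij: "bij_betw enc UNIV {..<2 * ?k}" unfolding enc_def by (rule frame_pos_bij[OF \<nu>])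
  define K where "K = wedge_power ?k (std_symp \<nu>) (\<lambda>i. axis (inv enc i) 1)"
  have det: "wedge_power ?k (std_symp \<nu>) Y = det (\<chi> I. Y (enc I)) * K" for Y
    unfolding K_def
    by (rule wedge_power_bilinear_eq_det[OF bij,
          where W = "\<chi> I J. of_int (symp (frame_pos \<nu> I) (frame_pos \<nu> J))"])
      (simp add: std_symp_def)
  have "K \<noteq> 0" unfolding K_def
  proof (rule wedge_power_symplectic_basis_nonzero)
    fix i j assume "i < 2 * ?k" "j < 2 * ?k"
    then have e: "enc (inv enc i) = i" "enc (inv enc j) = j"
      using bij by (auto simp: bij_betw_def intro!: f_inv_into_f)
    have ax: "axis a 1 $ b = (if a = b then 1 else 0 :: complex)" for a b :: "'m frame_idx"
      by (simp add: axis_def)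
    have "std_symp \<nu> (axis a 1) (axis b 1) = of_int (symp (enc a) (enc b))" for a b
      unfolding std_symp_def enc_def ax
      by (simp add: if_distrib[of "\<lambda>x. _ * x"] if_distrib[of "\<lambda>x. x * _"] cong: if_cong)
    then show "std_symp \<nu> (axis (inv enc i) 1) (axis (inv enc j) 1) = of_int (symp i j)"
      by (simp add: e)
  qed
  define C where "C = \<i> ^ ?k * K / fact ?k"
  have vol: "volume_form G x Y = C * (hdet G x)\<^sup>2 * det (\<chi> I. Y (enc I))"
    for G :: "('n, 'm) local_data" and x Y
  proof -
    have "(\<chi> I. coframe_matrix G x *v Y (enc I)) = (\<chi> I. Y (enc I)) ** transpose (coframe_matrix G x)"
      by (simp add: vec_eq_iff matrix_matrix_mult_def matrix_vector_mult_def Finite_Cartesian_Product.transpose_def mult.commute)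
    then have "wedge_power ?k (Phi G x) Y = \<i> ^ ?k * (det (\<chi> I. Y (enc I)) * (hdet G x)\<^sup>2 * K)"
      unfolding Phi_eq_std_symp[OF \<nu>] wedge_power_pullback det
      by (simp add: det_mul det_coframe_matrix)
    then show ?thesis by (simp add: volume_form_def C_def)
  qed
  show thesis
    by (rule that[OF _ _ vol]) (use \<open>K \<noteq> 0\<close> bij in \<open>simp_all add: C_def\<close>)
qed

section \<open>Divergence\<close>

lemma derivation_at_frame_act: "derivation_at x (\<lambda>g. frame_act G I g x)"
  by (cases I) (simp_all add: d_base_def d_base_bar_def d_fib_def d_fib_bar_def
      derivation_at_sum derivation_at_mult derivation_at_wirt derivation_at_wirt_bar)

lemma derivation_at_sec_act: "derivation_at x (\<lambda>g. sec_act G Z g x)"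
  unfolding sec_act_def by (intro derivation_at_sum derivation_at_mult derivation_at_frame_act)

text \<open>The \<open>K\<close>-th component of \<open>[Z, Y\<^sub>i]\<close> is \<open>Z(Y\<^sub>i\<^sup>K)\<close> minus the \<open>K\<close>-th component of \<open>Y\<^sub>i A\<close>, where \<open>A\<close> is a
  matrix independent of \<open>Y\<close>.  In the Lie derivative the terms \<open>Z(Y\<^sub>i\<^sup>K)\<close> cancel against the derivative
  of the determinant, and what remains is the derivative of \<open>h\<^sup>2\<close> and the trace of \<open>A\<close>.  Constant
  sections have nonzero volume, so that this determines the divergence.\<close>

lemma divergence_eq:
  fixes G :: "('n::finite, 'm::finite) local_data"
  assumes x: "x \<in> slit G" and h: "hdet G differentiable (at x)" "hdet G x \<noteq> 0"
  shows "divergence G Z x = 2 * sec_act G Z (hdet G) x / hdet G x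
     + (\<Sum>K\<in>UNIV. frame_act G K (\<lambda>y. Z y $ K) x)
     - (\<Sum>I\<in>UNIV. \<Sum>K\<in>UNIV. Z x $ I * frame_str G K I K x)" (is "_ = ?d")
proof -
  obtain C :: complex and enc :: "'m frame_idx \<Rightarrow> nat" where C: "C \<noteq> 0"
    and bij: "bij_betw enc UNIV {..<4 * CARD('m)}"
    and vol: "\<And>(G :: ('n, 'm) local_data) x Y.
       volume_form G x Y = C * (hdet G x)\<^sup>2 * det (\<chi> I. Y (enc I))"
    using volume_form_eq_det by blast
  have inj: "enc I = enc J \<longleftrightarrow> I = J" for I J using bij by (simp add: bij_betw_def inj_eq)
  define D where "D g = sec_act G Z g x" for g
  have D: "derivation_at x D" unfolding D_def by (rule derivation_at_sec_act)
  define A :: "complex^('m frame_idx)^('m frame_idx)" where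
    "A = (\<chi> J K. frame_act G J (\<lambda>y. Z y $ K) x - (\<Sum>I\<in>UNIV. Z x $ I * frame_str G K I J x))"
  have tr: "trace A = (\<Sum>K\<in>UNIV. frame_act G K (\<lambda>y. Z y $ K) x)
     - (\<Sum>I\<in>UNIV. \<Sum>K\<in>UNIV. Z x $ I * frame_str G K I K x)"
    unfolding trace_def A_def by (simp add: sum_subtractf) (rule sum.swap)
  have lie: "lie_derivative G Z (volume_form G) Y x = ?d * volume_form G x (\<lambda>i. Y i x)"
    if Y: "\<forall>i<4 * CARD('m). smooth_on (slit G) (Y i)" for Y
  proof -
    define M where "M = (\<chi> I. Y (enc I) x)"
    define DM where "DM I = (\<chi> K. D (\<lambda>y. Y (enc I) y $ K))" for I
    have "enc I < 4 * CARD('m)" for I using bij by (auto simp: bij_betw_def)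
    then have Yd: "(\<lambda>y. Y (enc I) y $ K) differentiable (at x)" for I K
      using Y x frechet_derivative_bounded_linear_comp(2)[OF bounded_linear_vec_nth] smooth_on_differentiable
      by blast
    then have Md: "(\<lambda>y. (\<chi> I. Y (enc I) y) $ I $ K) differentiable (at x)" for I K by simp
    have dd: "(\<lambda>y. det (\<chi> I. Y (enc I) y)) differentiable (at x)"
      by (rule differentiable_det) (rule Md)
    have D1: "D (\<lambda>y. det (\<chi> I. Y (enc I) y)) = (\<Sum>R\<in>UNIV. det (\<chi> I. if I = R then DM R else M $ I))"
      by (subst derivation_det[OF D]) (simp_all add: Yd M_def DM_def cong: if_cong)
    have br: "bracket G Z (Y (enc I)) x = DM I - (M ** A) $ I" for I
      unfolding bracket_def vec_eq_iff
    proof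
      fix K
      have "(M ** A) $ I $ K = sec_act G (Y (enc I)) (\<lambda>y. Z y $ K) x
          - (\<Sum>I'\<in>UNIV. \<Sum>J\<in>UNIV. Z x $ I' * Y (enc I) x $ J * frame_str G K I' J x)"
        unfolding sec_act_def matrix_matrix_mult_def A_def M_def
        by (simp add: algebra_simps sum_subtractf sum_distrib_left) (rule sum.swap)
      then show "(\<chi> K. sec_act G Z (\<lambda>y. Y (enc I) y $ K) x - sec_act G (Y (enc I)) (\<lambda>y. Z y $ K) x
         + (\<Sum>I'\<in>UNIV. \<Sum>J\<in>UNIV. Z x $ I' * Y (enc I) x $ J * frame_str G K I' J x)) $ K
         = (DM I - (M ** A) $ I) $ K"
        by (simp add: DM_def D_def)
    qed
    have row: "det (\<chi> I. ((\<lambda>j. Y j x)(enc R := bracket G Z (Y (enc R)) x)) (enc I))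
       = det (\<chi> I. if I = R then DM R else M $ I) - det (\<chi> I. if I = R then (M ** A) $ R else M $ I)" for R
    proof -
      have "(\<chi> I. ((\<lambda>j. Y j x)(enc R := bracket G Z (Y (enc R)) x)) (enc I))
          = (\<chi> I. if I = R then bracket G Z (Y (enc R)) x else M $ I)"
        by (simp add: vec_eq_iff inj M_def)
      moreover have "det (\<chi> I. if I = R then DM R else M $ I)
          = det (\<chi> I. if I = R then bracket G Z (Y (enc R)) x else M $ I) + det (\<chi> I. if I = R then (M ** A) $ R else M $ I)"
      proof -
        have "DM R = bracket G Z (Y (enc R)) x + (M ** A) $ R" by (simp add: br)
        then show ?thesis by (simp only: det_row_add)
      qed
      ultimately show ?thesis by simp
    qed
    have "(\<Sum>i<4 * CARD('m). volume_form G x ((\<lambda>j. Y j x)(i := bracket G Z (Y i) x)))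
       = (\<Sum>R\<in>UNIV. volume_form G x ((\<lambda>j. Y j x)(enc R := bracket G Z (Y (enc R)) x)))"
      by (rule sum.reindex_bij_betw[OF bij, symmetric])
    also have "\<dots> = C * (hdet G x)\<^sup>2 * (D (\<lambda>y. det (\<chi> I. Y (enc I) y)) - trace A * det M)"
      unfolding vol row D1 sum_det_replace_row[symmetric] by (simp add: sum_distrib_left sum_subtractf algebra_simps cong: if_cong)
    finally have S: "(\<Sum>i<4 * CARD('m). volume_form G x ((\<lambda>j. Y j x)(i := bracket G Z (Y i) x))) = \<dots>" .
    have "sec_act G Z (\<lambda>y. volume_form G y (\<lambda>i. Y i y)) x
       = D (\<lambda>y. (C * (hdet G y * hdet G y)) * det (\<chi> I. Y (enc I) y))"
      unfolding vol D_def power2_eq_square ..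
    also have "\<dots> = C * (2 * hdet G x * D (hdet G)) * det M + C * (hdet G x)\<^sup>2 * D (\<lambda>y. det (\<chi> I. Y (enc I) y))"
      using h dd
      by (simp add: derivation_mult[OF D] derivation_const[OF D] differentiable_mult M_def power2_eq_square)
    finally show ?thesis
      unfolding lie_derivative_def S using h(2)
      by (simp add: vol tr[symmetric] D_def[symmetric] M_def[symmetric] field_simps power2_eq_square)
        (simp add: tr algebra_simps)
  qed
  \<comment> \<open>The coordinate frame itself, as a test family that pins the divergence down.\<close>
  define Y0 :: "nat \<Rightarrow> ('n, 'm) sec" where "Y0 i y = axis (inv enc i) 1" for i y
  have inve: "inv enc (enc I) = I" for I by (metis inj injI inv_f_f)
  have "(\<chi> I. Y0 (enc I) x) = mat 1"
    by (simp add: Y0_def inve vec_eq_iff mat_def axis_def eq_commute)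
  then have nz: "volume_form G x (\<lambda>i. Y0 i x) \<noteq> 0" using C h(2) by (simp add: vol)
  have Y0: "\<forall>i<4 * CARD('m). smooth_on (slit G) (Y0 i)" by (simp add: Y0_def[abs_def] smooth_on_const)
  show ?thesis unfolding divergence_def
  proof (rule the_equality)
    show "\<forall>Y. (\<forall>i<4 * CARD('m). smooth_on (slit G) (Y i)) \<longrightarrow>
       lie_derivative G Z (volume_form G) Y x = ?d * volume_form G x (\<lambda>i. Y i x)"
      by (rule allI, rule impI, rule lie)
  next
    fix d assume d: "\<forall>Y. (\<forall>i<4 * CARD('m). smooth_on (slit G) (Y i)) \<longrightarrow>
       lie_derivative G Z (volume_form G) Y x = d * volume_form G x (\<lambda>i. Y i x)"
    have "lie_derivative G Z (volume_form G) Y0 x = d * volume_form G x (\<lambda>i. Y0 i x)"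
      by (rule d[THEN spec[where x = Y0], THEN mp]) (rule Y0)
    then have "d * volume_form G x (\<lambda>i. Y0 i x) = ?d * volume_form G x (\<lambda>i. Y0 i x)"
      by (rule trans[OF sym]) (rule lie[OF Y0])
    then show "d = ?d" by (rule mult_right_cancel[OF nz, THEN iffD1])
  qed
qed

section \<open>Wirtinger derivatives of smooth functions\<close>

lemma smooth_on_lincomb:
  fixes f g :: "'a::real_normed_vector \<Rightarrow> complex"
  assumes "open S" "smooth_on S f" "smooth_on S g"
  shows "smooth_on S (\<lambda>x. a * f x + b * g x)"
proof -
  have "Ck_on k (\<lambda>x. c * h x) S" if "smooth_on S h"
    for c k and h :: "'a \<Rightarrow> complex"
    using Ck_on_bounded_linear_comp[OF assms(1) bounded_linear_mult_right[of c]] that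
    by (simp add: smooth_on_def)
  then show ?thesis using assms by (simp add: smooth_on_def Ck_on_add)
qed

lemma wirt_lincomb:
  "wirt i f = (\<lambda>x. (1/2) * frechet_derivative f (at x) (axis i 1) + (-\<i>/2) * frechet_derivative f (at x) (axis i \<i>))"
  "wirt_bar i f = (\<lambda>x. (1/2) * frechet_derivative f (at x) (axis i 1) + (\<i>/2) * frechet_derivative f (at x) (axis i \<i>))"
  by (simp_all add: wirt_def wirt_bar_def fun_eq_iff field_simps)

lemma smooth_on_wirt:
  assumes "open S" "smooth_on S f"
  shows "smooth_on S (wirt i f)" "smooth_on S (wirt_bar i f)"
  unfolding wirt_lincomb
  by (rule smooth_on_lincomb[OF assms(1) smooth_on_frechet_derivative smooth_on_frechet_derivative];
    rule assms)+

lemma wirt_commute: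
  assumes S: "open S" "x \<in> S" and f: "smooth_on S f"
  shows "wirt i (wirt j f) x = wirt j (wirt i f) x"
proof -
  have d: "(\<lambda>y. frechet_derivative f (at y) v) differentiable (at x)" for v
    by (rule smooth_on_differentiable[OF smooth_on_frechet_derivative[OF f] S(2)])
  have e: "wirt i (wirt j f) x = 1/2 * wirt i (\<lambda>y. frechet_derivative f (at y) (axis j 1)) x
      + (-\<i>/2) * wirt i (\<lambda>y. frechet_derivative f (at y) (axis j \<i>)) x" for i j
    unfolding wirt_lincomb(1)[of j]
    by (rule derivation_lincomb[OF derivation_at_wirt d d])
  have sym: "frechet_derivative (\<lambda>y. frechet_derivative f (at y) (axis j c)) (at x) (axis i d)
      = frechet_derivative (\<lambda>y. frechet_derivative f (at y) (axis i d)) (at x) (axis j c)" for c d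
    by (rule second_derivative_symmetric[OF S f])
  show ?thesis
    unfolding e[of i j] e[of j i] unfolding wirt_def sym by (simp add: field_simps)
qed

section \<open>Inverse matrices and Jacobi's formula\<close>

lemma matrix_inv_mult:
  fixes M :: "'a::field^'n^'n"
  assumes "det M \<noteq> 0"
  shows "M ** matrix_inv M = mat 1" "matrix_inv M ** M = mat 1"
proof -
  have "\<exists>N. M ** N = mat 1 \<and> N ** M = mat 1"
    using assms invertible_det_nz[of M] by (simp add: invertible_def)
  then have "M ** matrix_inv M = mat 1 \<and> matrix_inv M ** M = mat 1"
    unfolding matrix_inv_def by (rule someI_ex)
  then show "M ** matrix_inv M = mat 1" "matrix_inv M ** M = mat 1" by simp_all
qed

text \<open>By Cramer's rule the entries of the inverse are quotients of determinants.\<close>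

lemma matrix_inv_differentiable:
  fixes M :: "'a::real_normed_vector \<Rightarrow> complex^'n^'n"
  assumes M: "\<And>i j. (\<lambda>y. M y $ i $ j) differentiable (at x)"
    and S: "open S" "x \<in> S" "\<And>y. y \<in> S \<Longrightarrow> det (M y) \<noteq> 0"
  shows "(\<lambda>y. matrix_inv (M y) $ i $ j) differentiable (at x)"
proof -
  define N where "N y = (\<chi> r c. if c = i then axis j 1 $ r else M y $ r $ c)" for y
  have "matrix_inv (M y) $ i $ j = det (N y) / det (M y)" if "y \<in> S" for y
  proof -
    have inv: "M y ** matrix_inv (M y) = mat 1"
      by (rule matrix_inv_mult(1)[OF S(3)[OF that]])
    have "M y *v (matrix_inv (M y) *v axis j 1) = axis j 1"
      by (simp add: matrix_vector_mul_assoc inv)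
    then have "matrix_inv (M y) *v axis j 1
        = (\<chi> k. det (\<chi> r c. if c = k then axis j 1 $ r else M y $ r $ c) / det (M y))"
      using cramer[OF S(3)[OF that]] by blast
    moreover have "(matrix_inv (M y) *v axis j 1) $ i = matrix_inv (M y) $ i $ j"
      by (simp add: matrix_vector_mult_def axis_def if_distrib[of "\<lambda>c. _ * c"] cong: if_cong)
    ultimately show ?thesis by (simp add: N_def)
  qed
  moreover have "(\<lambda>y. det (N y) / det (M y)) differentiable (at x)"
  proof (rule differentiable_divide)
    show "(\<lambda>y. det (M y)) differentiable (at x)"
      by (rule differentiable_det[OF M])
    show "(\<lambda>y. det (N y)) differentiable (at x)"
    proof (rule differentiable_det)
      show "(\<lambda>y. N y $ r $ c) differentiable (at x)" for r c
        by (cases "c = i") (simp_all add: N_def M)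
    qed
    show "det (M x) \<noteq> 0" using S by blast
  qed
  ultimately show ?thesis
    using has_derivative_transform_within_open[OF _ S(1,2), of "\<lambda>y. det (N y) / det (M y)" _ UNIV "\<lambda>y. matrix_inv (M y) $ i $ j"]
    unfolding differentiable_def by fastforce
qed

text \<open>Jacobi's formula.  Writing the derivative \<open>DM\<close> of the matrix as \<open>M (M\<^sup>-\<^sup>1 DM)\<close> reduces it to the
  trace identity for replaced rows.\<close>

lemma derivation_det_matrix_inv:
  fixes M :: "'a::real_normed_vector \<Rightarrow> complex^'n^'n"
  assumes D: "derivation_at x D" and M: "\<And>i j. (\<lambda>y. M y $ i $ j) differentiable (at x)"
    and nz: "det (M x) \<noteq> 0"
  shows "D (\<lambda>y. det (M y)) = (\<Sum>i\<in>UNIV. \<Sum>j\<in>UNIV. matrix_inv (M x) $ j $ i * D (\<lambda>y. M y $ i $ j)) * det (M x)"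
proof -
  define DM where "DM = (\<chi> i j. D (\<lambda>y. M y $ i $ j))"
  have "M x ** (matrix_inv (M x) ** DM) = DM"
    using nz by (simp add: matrix_mul_assoc matrix_inv_mult)
  then have "D (\<lambda>y. det (M y)) = (\<Sum>i\<in>UNIV. det (\<chi> r. if r = i then (M x ** (matrix_inv (M x) ** DM)) $ r else M x $ r))"
    unfolding derivation_det[OF D M] by (intro sum.cong refl arg_cong[where f = det]) (simp add: DM_def vec_eq_iff)
  also have "\<dots> = trace (matrix_inv (M x) ** DM) * det (M x)" by (rule sum_det_replace_row)
  also have "trace (matrix_inv (M x) ** DM) = (\<Sum>i\<in>UNIV. \<Sum>j\<in>UNIV. matrix_inv (M x) $ j $ i * D (\<lambda>y. M y $ i $ j))"
    unfolding trace_def matrix_matrix_mult_def DM_def by simp (rule sum.swap)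
  finally show ?thesis .
qed

section \<open>The Chern-Finsler connection and the Laplacians in a chart\<close>

text \<open>What a bundle chart supplies to the computation.  The coefficients \<open>\<rho>\<^sup>k\<^sub>\<alpha>\<close> need to be
  differentiable because they are differentiated, along the fibre, as factors of products.\<close>

locale local_finsler =
  fixes G :: "('n::finite, 'm::finite) local_data"
  assumes open_slit: "open (slit G)"
    and smooth_fins: "smooth_on (slit G) (fins G)"
    and det_nz: "x \<in> slit G \<Longrightarrow> hdet G x \<noteq> 0"
    and rho_differentiable: "x \<in> slit G \<Longrightarrow> rho G k \<alpha> differentiable (at (zpart x))"
begin

lemma zpart_has_derivative: "(zpart has_derivative zpart) (at (x :: complex^('n + 'm)))"
proof (rule bounded_linear_imp_has_derivative)
  show "bounded_linear (zpart :: complex^('n + 'm) \<Rightarrow> complex^'n)"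
    unfolding linear_conv_bounded_linear[symmetric]
    by (rule linearI) (simp_all add: zpart_def vec_eq_iff)
qed

lemma rho_zpart:
  assumes x: "x \<in> slit G"
  shows "(\<lambda>y. rho G k \<alpha> (zpart y)) differentiable (at x)"
    and "d_fib \<gamma> (\<lambda>y. rho G k \<alpha> (zpart y)) x = 0"
proof -
  let ?D = "frechet_derivative (rho G k \<alpha>) (at (zpart x))"
  have D: "(rho G k \<alpha> has_derivative ?D) (at (zpart x))"
    using rho_differentiable[OF x] frechet_derivative_works by blast
  have *: "((\<lambda>y. rho G k \<alpha> (zpart y)) has_derivative (\<lambda>v. ?D (zpart v))) (at x)"
    using diff_chain_at[OF zpart_has_derivative D] by (simp add: o_def)
  then show "(\<lambda>y. rho G k \<alpha> (zpart y)) differentiable (at x)" by (auto simp: differentiable_def)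
  have "zpart (axis (Inr \<gamma>) c :: complex^('n + 'm)) = 0" for c
    by (simp add: zpart_def axis_def vec_eq_iff)
  moreover have "?D 0 = 0" using has_derivative_linear[OF D] linear_0 by blast
  ultimately show "d_fib \<gamma> (\<lambda>y. rho G k \<alpha> (zpart y)) x = 0"
    by (simp add: d_fib_def wirt_def frechet_derivative_at[OF *, symmetric])
qed

lemma smooth_fib_bar_fins: "smooth_on (slit G) (d_fib_bar \<sigma> (fins G))"
  unfolding d_fib_bar_def by (rule smooth_on_wirt[OF open_slit smooth_fins])

lemma hmat_entry: "(\<lambda>y. hmat G y $ \<alpha> $ \<sigma>) = d_fib \<alpha> (d_fib_bar \<sigma> (fins G))"
  by (simp add: hmat_def levi_def d_fib_def d_fib_bar_def)

lemma smooth_hmat: "smooth_on (slit G) (\<lambda>y. hmat G y $ \<alpha> $ \<sigma>)"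
  unfolding hmat_entry d_fib_def by (rule smooth_on_wirt[OF open_slit smooth_fib_bar_fins])

lemma smooth_d_base_differentiable:
  assumes "smooth_on (slit G) g" "x \<in> slit G"
  shows "d_base G \<alpha> g differentiable (at x)"
  unfolding d_base_def[abs_def]
  by (intro differentiable_sum ballI differentiable_mult rho_zpart assms
      smooth_on_differentiable[OF smooth_on_wirt(1)[OF open_slit]]) simp

lemma smooth_d_base_bar_differentiable:
  assumes "smooth_on (slit G) g" "x \<in> slit G"
  shows "d_base_bar G \<alpha> g differentiable (at x)"
  unfolding d_base_bar_def[abs_def]
  by (intro differentiable_sum ballI differentiable_mult assms rho_zpart
      frechet_derivative_bounded_linear_comp(2)[OF bounded_linear_cnj]
      smooth_on_differentiable[OF smooth_on_wirt(2)[OF open_slit]]) simp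

text \<open>The operators \<open>\<partial>\<^sub>\<alpha> = \<rho>\<^sup>k\<^sub>\<alpha> \<partial>\<^sub>k\<close> commute with fibre derivatives since \<open>\<rho>\<^sup>k\<^sub>\<alpha>\<close> is constant on the
  fibres.\<close>

lemma d_fib_d_base:
  assumes g: "smooth_on (slit G) g" and x: "x \<in> slit G"
  shows "d_fib \<gamma> (d_base G \<alpha> g) x = d_base G \<alpha> (d_fib \<gamma> g) x"
proof -
  note D = derivation_at_wirt[of x "Inr \<gamma>"]
  have w: "wirt i g differentiable (at x)" for i
    by (rule smooth_on_differentiable[OF smooth_on_wirt(1)[OF open_slit g] x])
  have r: "wirt (Inr \<gamma>) (\<lambda>y. rho G k \<alpha> (zpart y)) x = 0" for k
    using rho_zpart(2)[OF x] by (simp add: d_fib_def)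
  show ?thesis
    unfolding d_base_def[abs_def] d_fib_def
    by (simp add: derivation_sum[OF D] derivation_mult[OF D] differentiable_mult rho_zpart(1)[OF x] w r
        wirt_commute[OF open_slit x g, of "Inr \<gamma>"])
qed

lemma hinv_differentiable:
  assumes "x \<in> slit G" shows "(\<lambda>y. hinv G y $ \<sigma> $ \<alpha>) differentiable (at x)"
  unfolding hinv_def
  by (rule matrix_inv_differentiable[OF smooth_on_differentiable[OF smooth_hmat assms] open_slit assms])
    (use det_nz in \<open>simp add: hdet_def\<close>)

lemma hdet_differentiable: "x \<in> slit G \<Longrightarrow> hdet G differentiable (at x)"
  unfolding hdet_def[abs_def]
  by (rule differentiable_det[OF smooth_on_differentiable[OF smooth_hmat]])

lemma Ncoef_differentiable: "x \<in> slit G \<Longrightarrow> Ncoef G \<beta> \<alpha> differentiable (at x)"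
  unfolding Ncoef_def[abs_def]
  by (intro differentiable_sum ballI differentiable_mult hinv_differentiable
      smooth_d_base_differentiable smooth_fib_bar_fins) simp_all

lemma delta_bar_differentiable:
  assumes "smooth_on (slit G) g" "x \<in> slit G"
  shows "delta_bar G \<alpha> g differentiable (at x)"
  unfolding delta_bar_def[abs_def] d_fib_bar_def
  by (intro differentiable_diff differentiable_sum ballI differentiable_mult assms
      frechet_derivative_bounded_linear_comp(2)[OF bounded_linear_cnj] Ncoef_differentiable
      smooth_d_base_bar_differentiable smooth_on_differentiable[OF smooth_on_wirt(2)[OF open_slit]]) simp_all

lemma derivation_at_delta: "derivation_at x (\<lambda>g. delta G \<alpha> g x)"
  unfolding delta_def d_base_def d_fib_def
  by (intro derivation_at_diff derivation_at_sum derivation_at_mult derivation_at_wirt)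

lemma derivation_hdet:
  assumes "derivation_at x D" "x \<in> slit G"
  shows "D (hdet G) = (\<Sum>\<gamma>\<in>UNIV. \<Sum>\<sigma>\<in>UNIV. hinv G x $ \<sigma> $ \<gamma> * D (\<lambda>y. hmat G y $ \<gamma> $ \<sigma>)) * hdet G x"
  unfolding hdet_def[abs_def] hinv_def
  by (rule derivation_det_matrix_inv[OF assms(1) smooth_on_differentiable[OF smooth_hmat assms(2)]])
    (use det_nz[OF assms(2)] in \<open>simp add: hdet_def\<close>)

lemma hinv_hmat:
  assumes "x \<in> slit G"
  shows "(\<Sum>\<beta>\<in>UNIV. hinv G x $ \<sigma> $ \<beta> * hmat G x $ \<beta> $ \<tau>) = (if \<sigma> = \<tau> then 1 else 0)"
    and "(\<Sum>\<sigma>\<in>UNIV. hmat G x $ \<beta> $ \<sigma> * hinv G x $ \<sigma> $ \<gamma>) = (if \<beta> = \<gamma> then 1 else 0)"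
proof -
  have "det (hmat G x) \<noteq> 0" using det_nz[OF assms] by (simp add: hdet_def)
  then have "hinv G x ** hmat G x = mat 1" "hmat G x ** hinv G x = mat 1"
    by (simp_all add: hinv_def matrix_inv_mult)
  then show "(\<Sum>\<beta>\<in>UNIV. hinv G x $ \<sigma> $ \<beta> * hmat G x $ \<beta> $ \<tau>) = (if \<sigma> = \<tau> then 1 else 0)"
    "(\<Sum>\<sigma>\<in>UNIV. hmat G x $ \<beta> $ \<sigma> * hinv G x $ \<sigma> $ \<gamma>) = (if \<beta> = \<gamma> then 1 else 0)"
    by (auto simp: vec_eq_iff matrix_matrix_mult_def mat_def)
qed

text \<open>Both sides are third derivatives of \<open>F\<close> that differ in the order of two unbarred fibre
  derivatives.\<close>

lemma d_fib_hmat_symmetric: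
  assumes "x \<in> slit G"
  shows "d_fib \<gamma> (\<lambda>y. hmat G y $ \<beta> $ \<sigma>) x = d_fib \<beta> (\<lambda>y. hmat G y $ \<gamma> $ \<sigma>) x"
  unfolding hmat_entry d_fib_def
  by (rule wirt_commute[OF open_slit assms smooth_fib_bar_fins])

text \<open>The definition of \<open>N\<close> with the inverse matrix cleared, which is easier to differentiate.\<close>

lemma Ncoef_hmat:
  assumes "x \<in> slit G"
  shows "(\<Sum>\<beta>\<in>UNIV. Ncoef G \<beta> \<alpha> x * hmat G x $ \<beta> $ \<sigma>) = d_base G \<alpha> (d_fib_bar \<sigma> (fins G)) x"
proof -
  have "(\<Sum>\<beta>\<in>UNIV. Ncoef G \<beta> \<alpha> x * hmat G x $ \<beta> $ \<sigma>)
     = (\<Sum>\<tau>\<in>UNIV. (\<Sum>\<beta>\<in>UNIV. hinv G x $ \<tau> $ \<beta> * hmat G x $ \<beta> $ \<sigma>) * d_base G \<alpha> (d_fib_bar \<tau> (fins G)) x)"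
    unfolding Ncoef_def sum_distrib_right by (subst sum.swap) (simp add: mult_ac)
  also have "\<dots> = d_base G \<alpha> (d_fib_bar \<sigma> (fins G)) x"
    by (simp add: hinv_hmat[OF assms] if_distrib[of "\<lambda>c. c * _"] cong: if_cong)
  finally show ?thesis .
qed

text \<open>Differentiate \<open>Ncoef_hmat\<close> along \<open>u\<^sup>\<gamma>\<close>.  The symmetry of the derivatives of \<open>h\<close> turns the terms
  in which \<open>h\<close> is differentiated into the correction that makes \<open>\<delta>\<^sub>\<alpha>\<close> out of \<open>\<partial>\<^sub>\<alpha>\<close>.\<close>

lemma d_fib_Ncoef_hmat:
  assumes x: "x \<in> slit G"
  shows "(\<Sum>\<beta>\<in>UNIV. d_fib \<gamma> (Ncoef G \<beta> \<alpha>) x * hmat G x $ \<beta> $ \<sigma>) = delta G \<alpha> (\<lambda>y. hmat G y $ \<gamma> $ \<sigma>) x"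
proof -
  have D: "derivation_at x (\<lambda>f. d_fib \<gamma> f x)" unfolding d_fib_def by (rule derivation_at_wirt)
  have h: "(\<lambda>y. hmat G y $ \<beta> $ \<sigma>) differentiable (at x)" for \<beta>
    by (rule smooth_on_differentiable[OF smooth_hmat x])
  have "d_base G \<alpha> (\<lambda>y. hmat G y $ \<gamma> $ \<sigma>) x = d_fib \<gamma> (d_base G \<alpha> (d_fib_bar \<sigma> (fins G))) x"
    unfolding hmat_entry by (rule d_fib_d_base[OF smooth_fib_bar_fins x, symmetric])
  also have "\<dots> = d_fib \<gamma> (\<lambda>y. \<Sum>\<beta>\<in>UNIV. Ncoef G \<beta> \<alpha> y * hmat G y $ \<beta> $ \<sigma>) x"
    by (rule derivation_cong[OF D smooth_d_base_differentiable[OF smooth_fib_bar_fins x] open_slit x])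
      (simp add: Ncoef_hmat)
  also have "\<dots> = (\<Sum>\<beta>\<in>UNIV. d_fib \<gamma> (Ncoef G \<beta> \<alpha>) x * hmat G x $ \<beta> $ \<sigma>
       + Ncoef G \<beta> \<alpha> x * d_fib \<gamma> (\<lambda>y. hmat G y $ \<beta> $ \<sigma>) x)"
    by (simp add: derivation_sum[OF D] derivation_mult[OF D] differentiable_mult h Ncoef_differentiable[OF x])
  finally show ?thesis
    by (simp add: delta_def sum.distrib d_fib_hmat_symmetric[OF x, of \<gamma>])
qed

text \<open>Solving \<open>d_fib_Ncoef_hmat\<close> for the derivatives of \<open>N\<close> and taking the trace gives the right side
  of Jacobi's formula for \<open>\<delta>\<^sub>\<alpha> h\<close>.\<close>

lemma sum_d_fib_Ncoef:
  assumes x: "x \<in> slit G"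
  shows "(\<Sum>\<gamma>\<in>UNIV. d_fib \<gamma> (Ncoef G \<gamma> \<alpha>) x) = delta G \<alpha> (hdet G) x / hdet G x"
proof -
  have "d_fib \<gamma> (Ncoef G \<tau> \<alpha>) x = (\<Sum>\<sigma>\<in>UNIV. hinv G x $ \<sigma> $ \<tau> * delta G \<alpha> (\<lambda>y. hmat G y $ \<gamma> $ \<sigma>) x)" for \<gamma> \<tau>
  proof -
    have "(\<Sum>\<sigma>\<in>UNIV. hinv G x $ \<sigma> $ \<tau> * delta G \<alpha> (\<lambda>y. hmat G y $ \<gamma> $ \<sigma>) x)
       = (\<Sum>\<beta>\<in>UNIV. d_fib \<gamma> (Ncoef G \<beta> \<alpha>) x * (\<Sum>\<sigma>\<in>UNIV. hmat G x $ \<beta> $ \<sigma> * hinv G x $ \<sigma> $ \<tau>))"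
      unfolding d_fib_Ncoef_hmat[OF x, symmetric] sum_distrib_left
      by (subst sum.swap) (simp add: mult_ac)
    also have "\<dots> = d_fib \<gamma> (Ncoef G \<tau> \<alpha>) x"
      by (simp add: hinv_hmat[OF x] if_distrib[of "\<lambda>c. _ * c"] cong: if_cong)
    finally show ?thesis by simp
  qed
  then show ?thesis
    using det_nz[OF x] by (simp add: derivation_hdet[OF derivation_at_delta x])
qed

text \<open>The contraction of the vertical coefficients is Jacobi's formula for a fibre derivative.\<close>

lemma trace_Cvert:
  assumes x: "x \<in> slit G"
  shows "(\<Sum>\<beta>\<in>UNIV. Cvert G \<beta> \<beta> \<alpha> x) = d_fib \<alpha> (hdet G) x / hdet G x"
proof -
  have D: "derivation_at x (\<lambda>f. d_fib \<alpha> f x)" unfolding d_fib_def by (rule derivation_at_wirt)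
  show ?thesis using det_nz[OF x] by (simp add: derivation_hdet[OF D x] Cvert_def)
qed

lemma Cvert_symmetric:
  assumes x: "x \<in> slit G"
  shows "Cvert G \<gamma> \<alpha> \<beta> x = Cvert G \<gamma> \<beta> \<alpha> x"
  unfolding Cvert_def by (simp add: d_fib_hmat_symmetric[OF x, of \<beta> \<alpha>])

text \<open>Of the two terms \<open>w\<^sup>\<alpha> \<delta>\<^sub>\<alpha> h / h\<close> coming from \<open>h\<^sup>2\<close>, one is cancelled by the fibre derivatives of
  \<open>N\<close> (\<open>sum_d_fib_Ncoef\<close>).\<close>

lemma hor_divergence_eq:
  assumes x: "x \<in> slit G" and w: "\<And>\<alpha>. (\<lambda>y. coZ \<alpha> (Z y)) differentiable (at x)"
  shows "hor_divergence G Z x = 1 / hdet G x * (\<Sum>\<alpha>\<in>UNIV. delta G \<alpha> (\<lambda>y. hdet G y * coZ \<alpha> (Z y)) x)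
     - (\<Sum>\<alpha>\<in>UNIV. coZ \<alpha> (Z x) * (\<Sum>\<beta>\<in>UNIV. str G \<beta> \<alpha> \<beta> (zpart x)))"
proof -
  define w where "w \<alpha> y = coZ \<alpha> (Z y)" for \<alpha> y
  have wd: "w \<alpha> differentiable (at x)" for \<alpha> using assms(2) by (simp add: w_def[abs_def])
  define H where "H y = (\<Sum>\<alpha>\<in>UNIV. w \<alpha> y *s Xframe G \<alpha> y)" for y
  note h = hdet_differentiable[OF x] det_nz[OF x]
  have fib: "derivation_at x (\<lambda>f. d_fib \<beta> f x)" for \<beta> unfolding d_fib_def by (rule derivation_at_wirt)
  have H: "H y $ IZ \<alpha> = w \<alpha> y" "H y $ IV \<beta> = - (\<Sum>\<alpha>\<in>UNIV. w \<alpha> y * Ncoef G \<beta> \<alpha> y)"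
    "H y $ IZbar \<alpha> = 0" "H y $ IVbar \<alpha> = 0" for y \<alpha> \<beta>
    by (simp_all add: H_def Xframe_def axis_def if_distrib[of "\<lambda>c. _ * c"] sum_negf cong: if_cong)
  have act: "sec_act G H f x = (\<Sum>\<alpha>\<in>UNIV. w \<alpha> x * delta G \<alpha> f x)" for f
    unfolding sec_act_def sum_frame_idx
    by (simp add: H delta_def algebra_simps sum_subtractf sum_distrib_left sum_distrib_right sum_negf)
      (rule sum.swap)
  have "(\<Sum>K\<in>UNIV. frame_act G K (\<lambda>y. H y $ K) x)
     = (\<Sum>\<alpha>\<in>UNIV. d_base G \<alpha> (w \<alpha>) x) - (\<Sum>\<beta>\<in>UNIV. \<Sum>\<alpha>\<in>UNIV. d_fib \<beta> (w \<alpha>) x * Ncoef G \<beta> \<alpha> x + w \<alpha> x * d_fib \<beta> (Ncoef G \<beta> \<alpha>) x)"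
  proof -
    have "frame_act G (IZbar \<alpha>) (\<lambda>y. 0) x = 0" "frame_act G (IVbar \<alpha>) (\<lambda>y. 0) x = 0" for \<alpha>
      by (rule derivation_const[OF derivation_at_frame_act])+
    then show ?thesis
      unfolding sum_frame_idx H
      by (simp add: derivation_uminus[OF fib] derivation_sum[OF fib] derivation_mult[OF fib]
          differentiable_sum differentiable_mult wd Ncoef_differentiable[OF x] sum_negf)
  qed
  also have "\<dots> = (\<Sum>\<alpha>\<in>UNIV. delta G \<alpha> (w \<alpha>) x) - (\<Sum>\<alpha>\<in>UNIV. w \<alpha> x * (\<Sum>\<beta>\<in>UNIV. d_fib \<beta> (Ncoef G \<beta> \<alpha>) x))"
    unfolding delta_def
    by (subst sum.swap) (simp add: sum.distrib sum_subtractf sum_distrib_left mult_ac)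
  finally have tr: "(\<Sum>K\<in>UNIV. frame_act G K (\<lambda>y. H y $ K) x) = \<dots>" .
  have str: "(\<Sum>I\<in>UNIV. \<Sum>K\<in>UNIV. H x $ I * frame_str G K I K x)
     = (\<Sum>\<alpha>\<in>UNIV. w \<alpha> x * (\<Sum>\<beta>\<in>UNIV. str G \<beta> \<alpha> \<beta> (zpart x)))"
    unfolding sum_frame_idx by (simp add: H frame_str_def sum_distrib_left)
  have leib: "delta G \<alpha> (\<lambda>y. hdet G y * w \<alpha> y) x = delta G \<alpha> (hdet G) x * w \<alpha> x + hdet G x * delta G \<alpha> (w \<alpha>) x" for \<alpha>
    by (rule derivation_mult[OF derivation_at_delta h(1) wd])
  have "hor_divergence G Z x = divergence G H x"
    unfolding hor_divergence_def H_def[abs_def] w_def ..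
  also have "\<dots> = 1 / hdet G x * (\<Sum>\<alpha>\<in>UNIV. delta G \<alpha> (\<lambda>y. hdet G y * w \<alpha> y) x)
     - (\<Sum>\<alpha>\<in>UNIV. w \<alpha> x * (\<Sum>\<beta>\<in>UNIV. str G \<beta> \<alpha> \<beta> (zpart x)))"
    unfolding divergence_eq[OF x h] act tr str leib sum_d_fib_Ncoef[OF x]
    using h(2) by (simp add: sum.distrib sum_distrib_left sum_divide_distrib field_simps)
  finally show ?thesis by (simp add: w_def)
qed

text \<open>The vertical frame has constant coefficients, so nothing cancels the second term from
  \<open>h\<^sup>2\<close>; it becomes the contraction with the vertical connection coefficients.\<close>

lemma ver_divergence_eq:
  assumes x: "x \<in> slit G" and w: "\<And>\<alpha>. (\<lambda>y. coV G y \<alpha> (Z y)) differentiable (at x)"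
  shows "ver_divergence G Z x = 1 / hdet G x * (\<Sum>\<alpha>\<in>UNIV. d_fib \<alpha> (\<lambda>y. hdet G y * coV G y \<alpha> (Z y)) x)
     + (\<Sum>\<alpha>\<in>UNIV. coV G x \<alpha> (Z x) * (\<Sum>\<beta>\<in>UNIV. Cvert G \<beta> \<alpha> \<beta> x))"
proof -
  define w where "w \<alpha> y = coV G y \<alpha> (Z y)" for \<alpha> y
  have wd: "w \<alpha> differentiable (at x)" for \<alpha> using assms(2) by (simp add: w_def[abs_def])
  define H where "H y = (\<Sum>\<alpha>\<in>UNIV. w \<alpha> y *s Vframe \<alpha> y)" for y :: "complex^('n + 'm)"
  note h = hdet_differentiable[OF x] det_nz[OF x]
  have fib: "derivation_at x (\<lambda>f. d_fib \<beta> f x)" for \<beta> unfolding d_fib_def by (rule derivation_at_wirt)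
  have H: "H y $ IZ \<alpha> = 0" "H y $ IV \<alpha> = w \<alpha> y"
    "H y $ IZbar \<alpha> = 0" "H y $ IVbar \<alpha> = 0" for y \<alpha>
    by (simp_all add: H_def Vframe_def axis_def if_distrib[of "\<lambda>c. _ * c"] cong: if_cong)
  have act: "sec_act G H f x = (\<Sum>\<alpha>\<in>UNIV. w \<alpha> x * d_fib \<alpha> f x)" for f
    unfolding sec_act_def sum_frame_idx by (simp add: H)
  have tr: "(\<Sum>K\<in>UNIV. frame_act G K (\<lambda>y. H y $ K) x) = (\<Sum>\<alpha>\<in>UNIV. d_fib \<alpha> (w \<alpha>) x)"
  proof -
    have "frame_act G I (\<lambda>y. 0) x = 0" for I
      by (rule derivation_const[OF derivation_at_frame_act])
    from this[of "IZ _"] this[of "IZbar _"] this[of "IVbar _"] show ?thesis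
      unfolding sum_frame_idx H by simp
  qed
  have str: "(\<Sum>I\<in>UNIV. \<Sum>K\<in>UNIV. H x $ I * frame_str G K I K x) = 0"
    unfolding sum_frame_idx by (simp add: H frame_str_def)
  have leib: "d_fib \<alpha> (\<lambda>y. hdet G y * w \<alpha> y) x = d_fib \<alpha> (hdet G) x * w \<alpha> x + hdet G x * d_fib \<alpha> (w \<alpha>) x" for \<alpha>
    by (rule derivation_mult[OF fib h(1) wd])
  have C: "(\<Sum>\<beta>\<in>UNIV. Cvert G \<beta> \<alpha> \<beta> x) = d_fib \<alpha> (hdet G) x / hdet G x" for \<alpha>
    unfolding trace_Cvert[OF x, symmetric] by (simp add: Cvert_symmetric[OF x, of _ \<alpha>])
  have "ver_divergence G Z x = divergence G H x"
    unfolding ver_divergence_def H_def[abs_def] w_def ..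
  also have "\<dots> = 1 / hdet G x * (\<Sum>\<alpha>\<in>UNIV. d_fib \<alpha> (\<lambda>y. hdet G y * w \<alpha> y) x)
     + (\<Sum>\<alpha>\<in>UNIV. w \<alpha> x * (\<Sum>\<beta>\<in>UNIV. Cvert G \<beta> \<alpha> \<beta> x))"
    unfolding divergence_eq[OF x h] act tr str leib C
    using h(2) by (simp add: sum.distrib sum_distrib_left sum_divide_distrib field_simps)
  finally show ?thesis by (simp add: w_def)
qed

lemma coZ_hor_grad: "coZ \<alpha> (hor_grad G g y) = (\<Sum>\<gamma>\<in>UNIV. hinv G y $ \<gamma> $ \<alpha> * delta_bar G \<gamma> g y)"
  by (simp add: coZ_def hor_grad_def Xframe_def axis_def if_distrib[of "\<lambda>c. _ * c"] cong: if_cong)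

lemma coV_ver_grad: "coV G y \<alpha> (ver_grad G g y) = (\<Sum>\<gamma>\<in>UNIV. hinv G y $ \<gamma> $ \<alpha> * d_fib_bar \<gamma> g y)"
  by (simp add: coV_def ver_grad_def Vframe_def axis_def if_distrib[of "\<lambda>c. _ * c"] cong: if_cong)

lemma laplacians_eq:
  assumes x: "x \<in> slit G" and g: "smooth_on (slit G) g"
  shows "hor_laplacian G g x =
           1 / hdet G x * (\<Sum>\<alpha>\<in>UNIV. delta G \<alpha>
             (\<lambda>y. hdet G y * (\<Sum>\<gamma>\<in>UNIV. hinv G y $ \<gamma> $ \<alpha> * delta_bar G \<gamma> g y)) x)
           - (\<Sum>\<alpha>\<in>UNIV. (\<Sum>\<gamma>\<in>UNIV. hinv G x $ \<gamma> $ \<alpha> * delta_bar G \<gamma> g x)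
                * (\<Sum>\<beta>\<in>UNIV. str G \<beta> \<alpha> \<beta> (zpart x)))" (is ?h)
    and "ver_laplacian G g x =
           1 / hdet G x * (\<Sum>\<alpha>\<in>UNIV. d_fib \<alpha>
             (\<lambda>y. hdet G y * (\<Sum>\<gamma>\<in>UNIV. hinv G y $ \<gamma> $ \<alpha> * d_fib_bar \<gamma> g y)) x)
           + (\<Sum>\<alpha>\<in>UNIV. (\<Sum>\<gamma>\<in>UNIV. hinv G x $ \<gamma> $ \<alpha> * d_fib_bar \<gamma> g x)
                * (\<Sum>\<beta>\<in>UNIV. Cvert G \<beta> \<alpha> \<beta> x))" (is ?v)
proof -
  have "(\<lambda>y. coZ \<alpha> (hor_grad G g y)) differentiable (at x)" for \<alpha>
    unfolding coZ_hor_grad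
    by (intro differentiable_sum ballI differentiable_mult hinv_differentiable[OF x]
        delta_bar_differentiable[OF g x]) simp
  from hor_divergence_eq[OF x this] show ?h unfolding hor_laplacian_def coZ_hor_grad .
  have "(\<lambda>y. coV G y \<alpha> (ver_grad G g y)) differentiable (at x)" for \<alpha>
    unfolding coV_ver_grad d_fib_bar_def
    by (intro differentiable_sum ballI differentiable_mult hinv_differentiable[OF x]
        smooth_on_differentiable[OF smooth_on_wirt(2)[OF open_slit g] x]) simp
  from ver_divergence_eq[OF x this] show ?v unfolding ver_laplacian_def coV_ver_grad .
qed

end

section \<open>Bundle charts\<close>

context
  fixes pr :: "'e::topological_space \<Rightarrow> 'p::topological_space"
    and B :: "('p, 'e, 'n::finite, 'm::finite) bchart set"
    and b :: "('p, 'e, 'n, 'm) bchart"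
  assumes E: "hol_vector_bundle pr B" and b: "b \<in> B"
begin

lemma open_slit_domain: "open (slit_domain pr b)"
proof -
  have "complex_atlas (total_atlas pr B)" using E by (simp add: hol_vector_bundle_def)
  then have "open (coord_domain pr b)"
    using b unfolding complex_atlas_def coord_domain_def by blast
  moreover have "bounded_linear (upart :: complex^('n + 'm) \<Rightarrow> complex^'m)"
    unfolding linear_conv_bounded_linear[symmetric]
    by (rule linearI) (simp_all add: upart_def vec_eq_iff)
  then have "open {x :: complex^('n + 'm). upart x \<noteq> 0}"
    by (intro open_Collect_neq continuous_on_const linear_continuous_on)
  moreover have "slit_domain pr b = coord_domain pr b \<inter> {x. upart x \<noteq> 0}"
    by (auto simp: slit_domain_def)
  ultimately show ?thesis by (simp add: open_Int)
qed

text \<open>Holomorphy of the anchor is a property on the total space; \<open>\<rho>\<^sup>k\<^sub>\<alpha>\<close> is its restriction to the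
  section \<open>z \<mapsto> (z, e\<^sub>\<alpha>)\<close>, which is affine in the coordinates.\<close>

lemma anchor_coefficient_differentiable:
  assumes \<rho>: "hol_bundle_morphism_to_tangent pr B \<rho>" and x: "x \<in> coord_domain pr b"
  shows "(\<lambda>z. \<rho> (local_frame pr b \<alpha> (chart_inv (base_chart b) z)) (base_chart b) $ k)
           differentiable (at (zpart x))"
proof -
  let ?tc = "total_chart pr b" and ?bc = "base_chart b"
  let ?H = "\<lambda>y. \<rho> (chart_inv ?tc y) ?bc $ k"
  have TA: "complex_atlas (total_atlas pr B)" and BA: "complex_atlas (base_atlas B)"
    using E by (simp_all add: hol_vector_bundle_def)
  have tc: "?tc \<in> total_atlas pr B" and bc: "?bc \<in> base_atlas B" using b by auto
  have frame: "join z (axis \<alpha> 1) \<in> coord_domain pr b \<and>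
      chart_inv ?tc (join z (axis \<alpha> 1)) = local_frame pr b \<alpha> (chart_inv ?bc z)"
    if z: "z \<in> snd ?bc ` fst ?bc" for z
  proof -
    obtain q where q: "q \<in> fst ?bc" "z = snd ?bc q" using z by blast
    then have "q \<in> fst b" by (simp add: base_chart_def)
    from triv_local_frame[OF E b this, of \<alpha>]
    have e: "local_frame pr b \<alpha> q \<in> fst ?tc" "snd ?tc (local_frame pr b \<alpha> q) = join z (axis \<alpha> 1)"
      using \<open>q \<in> fst b\<close> q by (simp_all add: total_chart_def base_chart_def)
    then show ?thesis
      using atlas_chart_inv[OF TA tc e(1)] atlas_chart_inv[OF BA bc q(1)] q(2)
      unfolding coord_domain_def by (metis imageI)
  qed
  have z0: "zpart x \<in> snd ?bc ` fst ?bc"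
    using x by (auto simp: coord_domain_def total_chart_def base_chart_def)
  have "hol_map_on (coord_domain pr b) (\<lambda>y. \<rho> (chart_inv ?tc y) ?bc)"
    using \<rho> b unfolding hol_bundle_morphism_to_tangent_def coord_domain_def by blast
  then obtain D where D: "(?H has_derivative D) (at (join (zpart x) (axis \<alpha> 1)))"
    using frame[OF z0] unfolding hol_map_on_def hol_fun_on_def by blast
  have "bounded_linear (\<lambda>z :: complex^'n. join z 0 :: complex^('n + 'm))"
    unfolding linear_conv_bounded_linear[symmetric]
    by (rule linearI) (auto simp: join_def vec_eq_iff split: sum.split)
  then have "((\<lambda>z. join z 0 + join 0 (axis \<alpha> 1)) has_derivative (\<lambda>v. join v 0)) (at (zpart x))"
    by (intro has_derivative_add_const bounded_linear_imp_has_derivative)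
  moreover have "(\<lambda>z. join z 0 + join 0 (axis \<alpha> 1)) = (\<lambda>z. join z (axis \<alpha> 1) :: complex^('n + 'm))"
    by (auto simp: join_def vec_eq_iff fun_eq_iff split: sum.split)
  ultimately have "((\<lambda>z. join z (axis \<alpha> 1) :: complex^('n + 'm)) has_derivative (\<lambda>v. join v 0)) (at (zpart x))"
    by simp
  from diff_chain_at[OF this D]
  have "((\<lambda>z. ?H (join z (axis \<alpha> 1))) has_derivative (\<lambda>v. D (join v 0))) (at (zpart x))"
    by (simp add: o_def)
  then have "((\<lambda>z. \<rho> (local_frame pr b \<alpha> (chart_inv ?bc z)) ?bc $ k) has_derivative (\<lambda>v. D (join v 0))) (at (zpart x))"
  proof (rule has_derivative_transform_within_open)
    show "open (snd ?bc ` fst ?bc)" using BA bc unfolding complex_atlas_def by blast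
  qed (use z0 frame in auto)
  then show ?thesis unfolding differentiable_def by blast
qed

end

text \<open>A vector annihilated by the transpose of \<open>h\<close> makes the form vanish.\<close>

lemma positive_hermitian_form_det_nonzero:
  fixes h :: "complex^'m^'m"
  assumes pos: "\<And>v. v \<noteq> 0 \<Longrightarrow> 0 < Re (\<Sum>\<alpha>\<in>UNIV. \<Sum>\<beta>\<in>UNIV. h $ \<alpha> $ \<beta> * v $ \<alpha> * cnj (v $ \<beta>))"
  shows "det h \<noteq> 0"
proof
  assume "det h = 0"
  then have "\<not> invertible (transpose h)" by (simp add: invertible_det_nz)
  then obtain v where v: "transpose h *v v = 0" "v \<noteq> 0"
    unfolding invertible_left_inverse matrix_left_invertible_ker by blast
  have "(\<Sum>\<alpha>\<in>UNIV. h $ \<alpha> $ \<beta> * v $ \<alpha>) = 0" for \<beta>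
    using arg_cong[OF v(1), of "\<lambda>u. u $ \<beta>"] by (simp add: matrix_vector_mult_def transpose_def)
  then have "(\<Sum>\<alpha>\<in>UNIV. \<Sum>\<beta>\<in>UNIV. h $ \<alpha> $ \<beta> * v $ \<alpha> * cnj (v $ \<beta>)) = 0"
    by (subst sum.swap) (simp flip: sum_distrib_right)
  then show False using pos[OF v(2)] by simp
qed

lemma local_finsler_chart_data:
  fixes pr :: "'e::topological_space \<Rightarrow> 'p::topological_space"
    and b :: "('p, 'e, 'n::finite, 'm::finite) bchart"
  assumes "hol_lie_algebroid pr B \<rho> br" and "complex_finsler pr B F" and "b \<in> B"
  shows "local_finsler (chart_data pr \<rho> br F b)"
proof
  have E: "hol_vector_bundle pr B" and \<rho>: "hol_bundle_morphism_to_tangent pr B \<rho>"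
    using assms(1) by (simp_all add: hol_lie_algebroid_def)
  let ?G = "chart_data pr \<rho> br F b"
  have slit: "slit ?G = slit_domain pr b" by (simp add: chart_data_def)
  show "open (slit ?G)" unfolding slit by (rule open_slit_domain[OF E assms(3)])
  have F: "smooth_on (slit_domain pr b) (local_rep pr b F)"
    using assms(2,3) by (simp add: complex_finsler_def)
  show "smooth_on (slit ?G) (fins ?G)"
    using F Ck_on_bounded_linear_comp[OF open_slit_domain[OF E assms(3)] bounded_linear_of_real[where 'a = complex]]
    by (simp add: chart_data_def smooth_on_def o_def)
  fix x assume x: "x \<in> slit ?G"
  show "hdet ?G x \<noteq> 0" unfolding hdet_def
  proof (rule positive_hermitian_form_det_nonzero)
    fix v :: "complex^'m" assume "v \<noteq> 0"
    then show "0 < Re (\<Sum>\<alpha>\<in>UNIV. \<Sum>\<beta>\<in>UNIV. hmat ?G x $ \<alpha> $ \<beta> * v $ \<alpha> * cnj (v $ \<beta>))"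
      using assms(2,3) x by (simp add: complex_finsler_def hmat_def chart_data_def)
  qed
  have "x \<in> coord_domain pr b" using x by (simp add: slit slit_domain_def)
  then show "rho ?G k \<alpha> differentiable (at (zpart x))" for k \<alpha>
    using anchor_coefficient_differentiable[OF E assms(3) \<rho>] by (simp add: chart_data_def)
qed

theorem proposition3p2:
  fixes pr :: "'e::topological_space \<Rightarrow> 'p::{t2_space, second_countable_topology}"
    and B :: "('p, 'e, 'n::finite, 'm::finite) bchart set"
    and \<rho> :: "'e \<Rightarrow> ('p, 'n) tvector"
    and br :: "'p set \<Rightarrow> ('p \<Rightarrow> 'e) \<Rightarrow> ('p \<Rightarrow> 'e) \<Rightarrow> 'p \<Rightarrow> 'e"
    and F :: "'e \<Rightarrow> real"
    and f :: "'e \<Rightarrow> complex"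
    and b :: "('p, 'e, 'n, 'm) bchart"
    and G :: "('n, 'm) local_data"
    and g :: "complex^('n + 'm) \<Rightarrow> complex"
    and x :: "complex^('n + 'm)"
  assumes "hol_lie_algebroid pr B \<rho> br"
    and "complex_finsler pr B F"
    and "smooth_function pr B f"
    and "b \<in> B"
    and "G = chart_data pr \<rho> br F b"
    and "g = local_rep pr b f"
    and "x \<in> slit_domain pr b"
  shows "hor_laplacian G g x =
           1 / hdet G x * (\<Sum>\<alpha>\<in>UNIV. delta G \<alpha>
             (\<lambda>y. hdet G y * (\<Sum>\<gamma>\<in>UNIV. hinv G y $ \<gamma> $ \<alpha> * delta_bar G \<gamma> g y)) x)
           - (\<Sum>\<alpha>\<in>UNIV. (\<Sum>\<gamma>\<in>UNIV. hinv G x $ \<gamma> $ \<alpha> * delta_bar G \<gamma> g x)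
                * (\<Sum>\<beta>\<in>UNIV. str G \<beta> \<alpha> \<beta> (zpart x)))
     \<and> ver_laplacian G g x =
           1 / hdet G x * (\<Sum>\<alpha>\<in>UNIV. d_fib \<alpha>
             (\<lambda>y. hdet G y * (\<Sum>\<gamma>\<in>UNIV. hinv G y $ \<gamma> $ \<alpha> * d_fib_bar \<gamma> g y)) x)
           + (\<Sum>\<alpha>\<in>UNIV. (\<Sum>\<gamma>\<in>UNIV. hinv G x $ \<gamma> $ \<alpha> * d_fib_bar \<gamma> g x)
                * (\<Sum>\<beta>\<in>UNIV. Cvert G \<beta> \<alpha> \<beta> x))
     \<and> (\<forall>\<alpha>. (\<Sum>\<beta>\<in>UNIV. Cvert G \<beta> \<alpha> \<beta> x) = (\<Sum>\<beta>\<in>UNIV. Cvert G \<beta> \<beta> \<alpha> x))"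
proof -
  interpret local_finsler G
    unfolding assms(5) by (rule local_finsler_chart_data[OF assms(1,2,4)])
  have slit: "slit G = slit_domain pr b" by (simp add: assms(5) chart_data_def)
  have x: "x \<in> slit G" using assms(7) slit by simp
  have "smooth_on (coord_domain pr b) g"
    using assms(3,4,6) by (simp add: smooth_function_def)
  then have g: "smooth_on (slit G) g"
    by (rule smooth_on_subset) (auto simp: slit slit_domain_def)
  have "(\<Sum>\<beta>\<in>UNIV. Cvert G \<beta> \<alpha> \<beta> x) = (\<Sum>\<beta>\<in>UNIV. Cvert G \<beta> \<beta> \<alpha> x)" for \<alpha>
    by (simp add: Cvert_symmetric[OF x, of _ \<alpha>])
  with laplacians_eq[OF x g] show ?thesis by blast
qed

end
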